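(* Let $R$ be a standard graded algebra over a field $k$, let $\boldsymbol y=y_1,\ldots,y_n$ be elements of $R$ of degree $1$, and let $M\in \mathsf{D}^{\mathsf f}_{\mathsf b}(\mathsf{Gr}\,R)$ be such that $H_i(\boldsymbol y,M)$ has finite length for each $i$. For any linear form $y_{n+1}\in R_1$, denote $\boldsymbol y'=y_1,\ldots,y_n,y_{n+1}$. Then $$\operatorname{kreg}^{\boldsymbol y}_R M=\operatorname{kreg}^{\boldsymbol y'}_R M.$$ In particular, $\operatorname{reg} M=\operatorname{kreg}^{\boldsymbol y}_R M$.
   Context: A standard graded $k$-algebra $R$ is a commutative $\mathbb{N}$-graded ring with $R_0=k$, generated over $k$ by finitely many elements of degree $1$; $\mathfrak m$ is its graded maximal ideal. Modules are graded and morphisms preserve degree. Complexes are indexed homologically. $\mathsf{D}^{\mathsf f}_{\mathsf b}(\mathsf{Gr}\,R)$ is the full subcategory of the derived category of graded $R$-modules consisting of complexes $M$ with every $H_i(M)$ finitely generated and $H_i(M)=0$ for $|i|\gg 0$. For a sequence $\boldsymbol x$ of degree-$1$ elements of $R$, $K[\boldsymbol x;R]$ is the (graded) Koszul complex, $K[\boldsymbol x;M]=K[\boldsymbol x;R]\otimes^{\mathsf L}_R M$, $H_i(\boldsymbol x,M)=H_i(K[\boldsymbol x;M])$, and $\operatorname{kreg}^{\boldsymbol x}_R M=\sup\{j-i: H_i(\boldsymbol x,M)_j\neq 0\}$. $\operatorname{reg} M=\sup\{i+j: H^i_{\mathfrak m}(M)_j\neq 0\}$, where $H^i_{\mathfrak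 m}(M)=H_{-i}(\mathsf R\Gamma_{\mathfrak m}(M))$ is local cohomology. The supremum of the empty set is $-\infty$. *)

theory Defs
  imports "HOL-Algebra.QuotRing" "HOL-Algebra.Generated_Rings" "HOL-Algebra.Ideal_Product" "HOL-Library.Extended_Real"
begin

section \<open>Graded rings and graded modules\<close>

text \<open>Internal direct sum decomposition of an abelian group: every element has a unique family of
  homogeneous components, of finite support. The grading of a ring is indexed by \<^typ>\<open>nat\<close>, that
  of a module by \<^typ>\<open>int\<close>.\<close>

definition direct_decomp :: "('a, 'z) ring_scheme \<Rightarrow> ('i \<Rightarrow> 'a set) \<Rightarrow> bool" where
  "direct_decomp A G \<longleftrightarrow>
     (\<forall>i. additive_subgroup (G i) A) \<and>
     (\<forall>x\<in>carrier A. \<exists>!c. (\<forall>i. c i \<in> G i) \<and> finite {i. c i \<noteq> \<zero>\<^bsub>A\<^esub>} \<and>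
        x = finsum A c {i. c i \<noteq> \<zero>\<^bsub>A\<^esub>})"

locale standard_graded_algebra = cring R
  for R :: "'r ring" (structure) and k :: "'r set" and G :: "nat \<Rightarrow> 'r set" +
  assumes base_field: "subfield k R"
    and decomp: "direct_decomp R G"
    and mult_degree: "\<And>a b r s. r \<in> G a \<Longrightarrow> s \<in> G b \<Longrightarrow> r \<otimes> s \<in> G (a + b)"
    and degree_zero: "G 0 = k"
    and generated: "\<exists>S. finite S \<and> S \<subseteq> G 1 \<and> carrier R = generate_ring R (k \<union> S)"

text \<open>As for every \<^type>\<open>module\<close> record, the multiplicative fields \<open>mult\<close> and \<open>one\<close> carry no meaning.\<close>

record ('r, 'm) gmodule = "('r, 'm) module" +
  hcomp :: "int \<Rightarrow> 'm set"

locale graded_module = module R M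
  for R :: "'r ring" (structure) and G :: "nat \<Rightarrow> 'r set" and M :: "('r, 'm) gmodule" (structure) +
  assumes decomp: "direct_decomp M (hcomp M)"
    and smult_degree: "\<And>a j r x. r \<in> G a \<Longrightarrow> x \<in> hcomp M j \<Longrightarrow> r \<odot>\<^bsub>M\<^esub> x \<in> hcomp M (int a + j)"

definition gr_hom :: "'r ring \<Rightarrow> ('r, 'm) gmodule \<Rightarrow> ('r, 'n) gmodule \<Rightarrow> ('m \<Rightarrow> 'n) set" where
  "gr_hom R M N = {f \<in> carrier M \<rightarrow> carrier N.
     (\<forall>x\<in>carrier M. \<forall>y\<in>carrier M. f (x \<oplus>\<^bsub>M\<^esub> y) = f x \<oplus>\<^bsub>N\<^esub> f y) \<and>
     (\<forall>r\<in>carrier R. \<forall>x\<in>carrier M. f (r \<odot>\<^bsub>M\<^esub> x) = r \<odot>\<^bsub>N\<^esub> f x) \<and>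
     (\<forall>j. f ` hcomp M j \<subseteq> hcomp N j)}"

definition sub_gmodule :: "('r, 'm) gmodule \<Rightarrow> 'm set \<Rightarrow> ('r, 'm) gmodule" where
  "sub_gmodule M N = M\<lparr>carrier := N, hcomp := \<lambda>j. hcomp M j \<inter> N\<rparr>"

definition quot_gmodule :: "('r, 'm) gmodule \<Rightarrow> 'm set \<Rightarrow> ('r, 'm set) gmodule" where
  "quot_gmodule M N =
     \<lparr>carrier = a_rcosets\<^bsub>M\<^esub> N, mult = undefined, one = undefined, zero = N, add = set_add M,
      smult = (\<lambda>r A. \<Union>x\<in>A. N +>\<^bsub>M\<^esub> (r \<odot>\<^bsub>M\<^esub> x)),
      hcomp = (\<lambda>j. (\<lambda>x. N +>\<^bsub>M\<^esub> x) ` hcomp M j)\<rparr>"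

definition finitely_generated :: "'r ring \<Rightarrow> ('r, 'm) gmodule \<Rightarrow> bool" where
  "finitely_generated R M \<longleftrightarrow>
     (\<exists>S. finite S \<and> S \<subseteq> carrier M \<and> (\<forall>H. submodule H R M \<and> S \<subseteq> H \<longrightarrow> H = carrier M))"

text \<open>The length of a module is the supremum of the lengths of chains of submodules.\<close>

definition finite_length :: "'r ring \<Rightarrow> ('r, 'm) gmodule \<Rightarrow> bool" where
  "finite_length R M \<longleftrightarrow>
     (\<exists>l. \<forall>N n. (\<forall>i\<le>n. submodule (N i) R M) \<and> (\<forall>i<n. N i \<subset> N (Suc i)) \<longrightarrow> n \<le> (l::nat))"

section \<open>Complexes of graded modules\<close>

text \<open>Homological indexing: \<open>diff C i\<close> maps \<open>obj C i\<close> to \<open>obj C (i - 1)\<close>.\<close>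

record ('r, 'm) gcomplex =
  obj :: "int \<Rightarrow> ('r, 'm) gmodule"
  diff :: "int \<Rightarrow> 'm \<Rightarrow> 'm"

definition graded_complex :: "'r ring \<Rightarrow> (nat \<Rightarrow> 'r set) \<Rightarrow> ('r, 'm) gcomplex \<Rightarrow> bool" where
  "graded_complex R G C \<longleftrightarrow>
     (\<forall>i. graded_module R G (obj C i)) \<and>
     (\<forall>i. diff C i \<in> gr_hom R (obj C i) (obj C (i - 1))) \<and>
     (\<forall>i. \<forall>x\<in>carrier (obj C i). diff C (i - 1) (diff C i x) = \<zero>\<^bsub>obj C (i - 2)\<^esub>)"

definition cycles :: "('r, 'm) gcomplex \<Rightarrow> int \<Rightarrow> 'm set" where
  "cycles C i = {x \<in> carrier (obj C i). diff C i x = \<zero>\<^bsub>obj C (i - 1)\<^esub>}"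

definition boundaries :: "('r, 'm) gcomplex \<Rightarrow> int \<Rightarrow> 'm set" where
  "boundaries C i = diff C (i + 1) ` carrier (obj C (i + 1))"

definition homology :: "('r, 'm) gcomplex \<Rightarrow> int \<Rightarrow> ('r, 'm set) gmodule" where
  "homology C i = quot_gmodule (sub_gmodule (obj C i) (cycles C i)) (boundaries C i)"

definition homology_nonzero :: "('r, 'm) gcomplex \<Rightarrow> int \<Rightarrow> int \<Rightarrow> bool" where
  "homology_nonzero C i j \<longleftrightarrow> hcomp (homology C i) j \<noteq> {\<zero>\<^bsub>homology C i\<^esub>}"

definition in_Dfb :: "'r ring \<Rightarrow> (nat \<Rightarrow> 'r set) \<Rightarrow> ('r, 'm) gcomplex \<Rightarrow> bool" where
  "in_Dfb R G M \<longleftrightarrow>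
     graded_complex R G M \<and>
     (\<forall>i. finitely_generated R (homology M i)) \<and>
     (\<exists>b. \<forall>i. b < \<bar>i\<bar> \<longrightarrow> carrier (homology M i) = {\<zero>\<^bsub>homology M i\<^esub>})"

definition chain_map ::
  "'r ring \<Rightarrow> ('r, 'm) gcomplex \<Rightarrow> ('r, 'n) gcomplex \<Rightarrow> (int \<Rightarrow> 'm \<Rightarrow> 'n) \<Rightarrow> bool" where
  "chain_map R C D \<phi> \<longleftrightarrow>
     (\<forall>i. \<phi> i \<in> gr_hom R (obj C i) (obj D i)) \<and>
     (\<forall>i. \<forall>x\<in>carrier (obj C i). \<phi> (i - 1) (diff C i x) = diff D i (\<phi> i x))"

definition homology_map ::
  "('r, 'n) gcomplex \<Rightarrow> (int \<Rightarrow> 'm \<Rightarrow> 'n) \<Rightarrow> int \<Rightarrow> 'm set \<Rightarrow> 'n set" where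
  "homology_map D \<phi> i A = (\<Union>x\<in>A. boundaries D i +>\<^bsub>obj D i\<^esub> \<phi> i x)"

definition quasi_iso ::
  "'r ring \<Rightarrow> ('r, 'm) gcomplex \<Rightarrow> ('r, 'n) gcomplex \<Rightarrow> (int \<Rightarrow> 'm \<Rightarrow> 'n) \<Rightarrow> bool" where
  "quasi_iso R C D \<phi> \<longleftrightarrow>
     chain_map R C D \<phi> \<and>
     (\<forall>i. bij_betw (homology_map D \<phi> i) (carrier (homology C i)) (carrier (homology D i)))"

section \<open>Koszul complexes and Koszul regularity\<close>

text \<open>
  The graded Koszul complex \<open>K[x;R]\<close> on \<open>n\<close> elements of degree 1 is free, with basis the products
  \<open>e_S\<close> for \<open>S \<subseteq> {0..<n}\<close>, where \<open>e_S\<close> has homological degree and internal degree \<open>card S\<close>, and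
  \<open>\<partial> e_S\<close> is the sum over \<open>s \<in> S\<close> of \<open>(-1)^(card {t \<in> S. t < s}) x_s e_(S - {s})\<close>.
  It is a bounded complex of free modules, so \<open>K[x;M]\<close> is the ordinary tensor product
  \<open>K[x;R] \<otimes> M\<close>. Its elements are written in the basis \<open>e_S\<close>: the function \<open>u\<close> below stands for
  the sum of the \<open>e_S \<otimes> u S\<close>, and
  \<open>\<partial> (e_S \<otimes> m) = \<partial> e_S \<otimes> m + (-1)^(card S) e_S \<otimes> \<partial> m\<close>.
\<close>

definition koszul_obj :: "nat \<Rightarrow> ('r, 'm) gcomplex \<Rightarrow> int \<Rightarrow> ('r, nat set \<Rightarrow> 'm) gmodule" where
  "koszul_obj n M i =
     \<lparr>carrier = (\<Pi>\<^sub>E S\<in>Pow {0..<n}. carrier (obj M (i - int (card S)))),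
      mult = undefined, one = undefined,
      zero = (\<lambda>S\<in>Pow {0..<n}. \<zero>\<^bsub>obj M (i - int (card S))\<^esub>),
      add = (\<lambda>u v. \<lambda>S\<in>Pow {0..<n}. u S \<oplus>\<^bsub>obj M (i - int (card S))\<^esub> v S),
      smult = (\<lambda>r u. \<lambda>S\<in>Pow {0..<n}. r \<odot>\<^bsub>obj M (i - int (card S))\<^esub> u S),
      hcomp = (\<lambda>j. \<Pi>\<^sub>E S\<in>Pow {0..<n}. hcomp (obj M (i - int (card S))) (j - int (card S)))\<rparr>"

definition koszul_sign :: "'r ring \<Rightarrow> nat \<Rightarrow> 'r" where
  "koszul_sign R p = (\<ominus>\<^bsub>R\<^esub> \<one>\<^bsub>R\<^esub>) [^]\<^bsub>R\<^esub> p"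

definition koszul_diff ::
  "'r ring \<Rightarrow> 'r list \<Rightarrow> ('r, 'm) gcomplex \<Rightarrow> int \<Rightarrow> (nat set \<Rightarrow> 'm) \<Rightarrow> (nat set \<Rightarrow> 'm)" where
  "koszul_diff R xs M i u =
     (\<lambda>T\<in>Pow {0..<length xs}. let N = obj M (i - 1 - int (card T)) in
        (\<Oplus>\<^bsub>N\<^esub>s\<in>{0..<length xs} - T.
           (koszul_sign R (card {t \<in> T. t < s}) \<otimes>\<^bsub>R\<^esub> xs ! s) \<odot>\<^bsub>N\<^esub> u (insert s T))
        \<oplus>\<^bsub>N\<^esub> koszul_sign R (card T) \<odot>\<^bsub>N\<^esub> diff M (i - int (card T)) (u T))"

definition koszul ::
  "'r ring \<Rightarrow> 'r list \<Rightarrow> ('r, 'm) gcomplex \<Rightarrow> ('r, nat set \<Rightarrow> 'm) gcomplex" where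
  "koszul R xs M = \<lparr>obj = koszul_obj (length xs) M, diff = koszul_diff R xs M\<rparr>"

definition kreg :: "'r ring \<Rightarrow> 'r list \<Rightarrow> ('r, 'm) gcomplex \<Rightarrow> ereal" where
  "kreg R xs M = Sup {ereal (of_int (j - i)) | i j. homology_nonzero (koszul R xs M) i j}"

section \<open>Local cohomology and regularity\<close>

text \<open>
  Injective objects of the category of graded modules. The test objects \<open>A\<close>, \<open>B\<close> have to live in a
  fixed type; by Baer's criterion it suffices that it accommodates the shifts of \<open>R\<close> and their graded
  submodules, so taking the type of elements of \<open>R\<close> is no restriction.
\<close>

definition gr_injective :: "'r ring \<Rightarrow> (nat \<Rightarrow> 'r set) \<Rightarrow> ('r, 'm) gmodule \<Rightarrow> bool" where
  "gr_injective R G E \<longleftrightarrow>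
     graded_module R G E \<and>
     (\<forall>(A :: ('r, 'r) gmodule) (B :: ('r, 'r) gmodule) \<iota> f.
        graded_module R G A \<and> graded_module R G B \<and>
        \<iota> \<in> gr_hom R A B \<and> inj_on \<iota> (carrier A) \<and> f \<in> gr_hom R A E \<longrightarrow>
        (\<exists>g\<in>gr_hom R B E. \<forall>a\<in>carrier A. g (\<iota> a) = f a))"

text \<open>Right derived functors of complexes with homology bounded above (in homological indexing) are
  computed from resolutions of the following kind.\<close>

definition injective_resolution ::
  "'r ring \<Rightarrow> (nat \<Rightarrow> 'r set) \<Rightarrow> ('r, 'm) gcomplex \<Rightarrow> ('r, 'n) gcomplex \<Rightarrow> (int \<Rightarrow> 'm \<Rightarrow> 'n) \<Rightarrow> bool"
  where
  "injective_resolution R G M J \<phi> \<longleftrightarrow>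
     graded_complex R G J \<and>
     (\<forall>i. gr_injective R G (obj J i)) \<and>
     (\<exists>b. \<forall>i>b. carrier (obj J i) = {\<zero>\<^bsub>obj J i\<^esub>}) \<and>
     quasi_iso R M J \<phi>"

definition irrelevant_ideal :: "'r ring \<Rightarrow> (nat \<Rightarrow> 'r set) \<Rightarrow> 'r set" where
  "irrelevant_ideal R G = genideal R (\<Union>a\<in>{1..}. G a)"

primrec ideal_power :: "'r ring \<Rightarrow> 'r set \<Rightarrow> nat \<Rightarrow> 'r set" where
  "ideal_power R I 0 = carrier R"
| "ideal_power R I (Suc t) = ideal_prod R I (ideal_power R I t)"

definition torsion :: "'r ring \<Rightarrow> 'r set \<Rightarrow> ('r, 'm) gmodule \<Rightarrow> 'm set" where
  "torsion R I M = {x \<in> carrier M. \<exists>t. \<forall>r\<in>ideal_power R I t. r \<odot>\<^bsub>M\<^esub> x = \<zero>\<^bsub>M\<^esub>}"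

definition torsion_complex :: "'r ring \<Rightarrow> 'r set \<Rightarrow> ('r, 'm) gcomplex \<Rightarrow> ('r, 'm) gcomplex" where
  "torsion_complex R I C = C\<lparr>obj := \<lambda>i. sub_gmodule (obj C i) (torsion R I (obj C i))\<rparr>"

text \<open>
  If \<open>J\<close> is an injective resolution of \<open>M\<close>, then \<open>\<Gamma>(J)\<close>, for \<open>\<Gamma>\<close> the torsion functor of the graded
  maximal ideal, represents the right derived functor of \<open>\<Gamma>\<close> at \<open>M\<close>; the \<open>i\<close>-th local cohomology of
  \<open>M\<close> is its homology in degree \<open>-i\<close>, and \<open>reg_by_resolution R G J\<close> is the regularity of \<open>M\<close>.
\<close>

definition reg_by_resolution :: "'r ring \<Rightarrow> (nat \<Rightarrow> 'r set) \<Rightarrow> ('r, 'n) gcomplex \<Rightarrow> ereal" where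
  "reg_by_resolution R G J =
     Sup {ereal (of_int (i + j)) | i j.
            homology_nonzero (torsion_complex R (irrelevant_ideal R G) J) (- i) j}"

end

theory Submission
  imports Defs
begin

text \<open>
  The Koszul complex on \<open>xs @ [w]\<close> is the mapping cone of \<open>w\<close> on the Koszul complex on \<open>xs\<close>. By the long
  exact sequence, adjoining \<open>w\<close> never increases the Koszul regularity. Conversely, a homology class
  that is killed by \<open>w\<close> yields a class for \<open>xs @ [w]\<close> with the same value of \<open>j - i\<close>, and if every
  class is killed by some power of \<open>w\<close>, then above the regularity for \<open>xs @ [w]\<close> multiplication by
  \<open>w\<close> is both injective and locally nilpotent. Homology of finite length vanishes in large degrees, so
  it satisfies this condition.

  For local cohomology, let \<open>J\<close> be an injective resolution of \<open>M\<close>, so that \<open>M\<close> and \<open>J\<close> have the same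
  Koszul regularity, and let \<open>z\<^sub>1, \<dots>, z\<^sub>n\<close> be linear forms generating \<open>R\<close>. Adjoin the \<open>z\<^sub>l\<close> to \<open>ys\<close> one
  at a time, and after each step pass to the subcomplex of elements killed by a power of \<open>z\<^sub>l\<close>. As \<open>R\<close>
  is Noetherian and \<open>J\<close> is injective, \<open>z\<^sub>l\<close> acts bijectively on the quotient by this subcomplex, so the
  Koszul homology does not change. One ends with \<open>\<Gamma>(J)\<close>, on which every linear form is locally
  nilpotent, so that all elements of the Koszul complex can be dropped again.
\<close>

section \<open>Direct sum decompositions\<close>

text \<open>The regularities are suprema over possibly empty or unbounded sets and are never
  computed. They are compared through \<open>exact_above C r\<close>, the absence of homology with j
  - i > r: two such suprema agree as soon as the same integers bound both. Everything reduces to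
  diagram chases with homogeneous elements, one bidegree at a time; neither long exact sequences nor
  derived functors are constructed.

  Adjoining a form needs nilpotence on homology, and finite length is awkward to pass on. Only its
  consequence \<open>bounded_exact\<close> is carried along: for each i, homology vanishes in large
  internal degrees. Cones inherit this at once, and acyclic maps transport it. So adjoining and
  shrinking can alternate on J, whose terms are not finitely generated in general.

  Graded injectivity alone does not make w act surjectively: an element is divisible by w only up to
  w-power torsion, once the annihilators of its multiples by powers of w have become stationary.
  This is where R has to be Noetherian, and Hilbert's argument is carried out on subrings of
  R.\<close>

definition add_hom :: "('a, 'z) ring_scheme \<Rightarrow> ('b, 'y) ring_scheme \<Rightarrow> ('a \<Rightarrow> 'b) set" where
  "add_hom A B = {f \<in> carrier A \<rightarrow> carrier B.
     \<forall>x\<in>carrier A. \<forall>y\<in>carrier A. f (x \<oplus>\<^bsub>A\<^esub> y) = f x \<oplus>\<^bsub>B\<^esub> f y}"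

lemma add_homI:
  assumes "\<And>x. x \<in> carrier A \<Longrightarrow> f x \<in> carrier B"
    and "\<And>x y. x \<in> carrier A \<Longrightarrow> y \<in> carrier A \<Longrightarrow> f (x \<oplus>\<^bsub>A\<^esub> y) = f x \<oplus>\<^bsub>B\<^esub> f y"
  shows "f \<in> add_hom A B"
  using assms by (auto simp: add_hom_def)

lemma add_hom_closed: "f \<in> add_hom A B \<Longrightarrow> x \<in> carrier A \<Longrightarrow> f x \<in> carrier B"
  by (auto simp: add_hom_def)

lemma add_hom_add:
  "f \<in> add_hom A B \<Longrightarrow> x \<in> carrier A \<Longrightarrow> y \<in> carrier A \<Longrightarrow> f (x \<oplus>\<^bsub>A\<^esub> y) = f x \<oplus>\<^bsub>B\<^esub> f y"
  by (auto simp: add_hom_def)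

lemma add_hom_zero:
  assumes "abelian_group A" "abelian_group B" "f \<in> add_hom A B"
  shows "f \<zero>\<^bsub>A\<^esub> = \<zero>\<^bsub>B\<^esub>"
proof -
  interpret A: abelian_group A by fact
  interpret B: abelian_group B by fact
  have "f \<zero>\<^bsub>A\<^esub> \<oplus>\<^bsub>B\<^esub> f \<zero>\<^bsub>A\<^esub> = f \<zero>\<^bsub>A\<^esub>"
    using add_hom_add[OF assms(3), of "\<zero>\<^bsub>A\<^esub>" "\<zero>\<^bsub>A\<^esub>"] by simp
  then show ?thesis
    using add_hom_closed[OF assms(3), of "\<zero>\<^bsub>A\<^esub>"] B.add.r_cancel_one by simp
qed

lemma add_hom_neg:
  assumes "abelian_group A" "abelian_group B" "f \<in> add_hom A B" "x \<in> carrier A"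
  shows "f (\<ominus>\<^bsub>A\<^esub> x) = \<ominus>\<^bsub>B\<^esub> f x"
proof -
  interpret A: abelian_group A by fact
  interpret B: abelian_group B by fact
  have "f (\<ominus>\<^bsub>A\<^esub> x) \<oplus>\<^bsub>B\<^esub> f x = \<zero>\<^bsub>B\<^esub>"
    using add_hom_add[OF assms(3), of "\<ominus>\<^bsub>A\<^esub> x" x] assms(4) A.l_neg add_hom_zero[OF assms(1-3)]
    by simp
  then show ?thesis
    using add_hom_closed[OF assms(3)] assms(4) by (metis A.a_inv_closed B.minus_equality)
qed

lemma add_hom_finsum:
  assumes "abelian_group A" "abelian_group B" "f \<in> add_hom A B" "g \<in> I \<rightarrow> carrier A"
  shows "f (finsum A g I) = finsum B (\<lambda>i. f (g i)) I"
proof -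
  interpret A: abelian_group A by fact
  interpret B: abelian_group B by fact
  note [simp] = add_hom_zero[OF assms(1-3)]
  show ?thesis
    using assms(4)
  proof (induction I rule: infinite_finite_induct)
    case (insert i I)
    then have "g i \<in> carrier A" "g \<in> I \<rightarrow> carrier A" by auto
    moreover have "(\<lambda>i. f (g i)) \<in> I \<rightarrow> carrier B"
      using insert(4) add_hom_closed[OF assms(3)] by auto
    ultimately show ?case
      using insert add_hom_closed[OF assms(3)] by (simp add: add_hom_add[OF assms(3)])
  qed simp_all
qed

lemma direct_decomp_additive_subgroup: "direct_decomp A G \<Longrightarrow> additive_subgroup (G i) A"
  by (simp add: direct_decomp_def)

section \<open>Homogeneous components\<close>

definition hpart :: "('a, 'z) ring_scheme \<Rightarrow> ('i \<Rightarrow> 'a set) \<Rightarrow> 'i \<Rightarrow> 'a \<Rightarrow> 'a" where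
  "hpart A G i x = (THE c. (\<forall>i. c i \<in> G i) \<and> finite {i. c i \<noteq> \<zero>\<^bsub>A\<^esub>} \<and>
     x = finsum A c {i. c i \<noteq> \<zero>\<^bsub>A\<^esub>}) i"

lemma (in abelian_group) finsum_support:
  assumes "finite S" "{i. c i \<noteq> \<zero>} \<subseteq> S" "\<And>i. c i \<in> carrier G"
  shows "finsum G c S = finsum G c {i. c i \<noteq> \<zero>}"
  by (rule add.finprod_mono_neutral_cong_right) (use assms in auto)

locale graded_group = abelian_group A for A (structure) +
  fixes H :: "'i \<Rightarrow> 'a set"
  assumes dd: "direct_decomp A H"
begin

lemma homog_subgroup: "additive_subgroup (H i) A"
  using dd by (rule direct_decomp_additive_subgroup)

lemma homog_carrier: "x \<in> H i \<Longrightarrow> x \<in> carrier A"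
  using additive_subgroup.a_subset[OF homog_subgroup] by blast

lemma homog_zero [simp]: "\<zero> \<in> H i"
  using additive_subgroup.zero_closed[OF homog_subgroup] .

lemma homog_add: "x \<in> H i \<Longrightarrow> y \<in> H i \<Longrightarrow> x \<oplus> y \<in> H i"
  using additive_subgroup.a_closed[OF homog_subgroup] .

lemma homog_neg: "x \<in> H i \<Longrightarrow> \<ominus> x \<in> H i"
  using additive_subgroup.a_inv_closed[OF homog_subgroup] .

lemma hpart_props:
  assumes "x \<in> carrier A"
  shows hpart_in: "hpart A H i x \<in> H i"
    and hpart_finite: "finite {i. hpart A H i x \<noteq> \<zero>}"
    and hpart_sum: "x = finsum A (\<lambda>i. hpart A H i x) {i. hpart A H i x \<noteq> \<zero>}"
proof -
  have "\<exists>!c. (\<forall>i. c i \<in> H i) \<and> finite {i. c i \<noteq> \<zero>} \<and> x = finsum A c {i. c i \<noteq> \<zero>}"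
    using dd assms unfolding direct_decomp_def by blast
  note T = theI'[OF this]
  show "hpart A H i x \<in> H i" unfolding hpart_def by (rule spec[OF T[THEN conjunct1]])
  show "finite {i. hpart A H i x \<noteq> \<zero>}"
    unfolding hpart_def by (rule T[THEN conjunct2, THEN conjunct1])
  show "x = finsum A (\<lambda>i. hpart A H i x) {i. hpart A H i x \<noteq> \<zero>}"
    unfolding hpart_def by (rule T[THEN conjunct2, THEN conjunct2])
qed

lemma hpart_carrier: "x \<in> carrier A \<Longrightarrow> hpart A H i x \<in> carrier A"
  using hpart_in homog_carrier by blast

lemma hpart_sum_superset:
  assumes "x \<in> carrier A" "finite S" "{i. hpart A H i x \<noteq> \<zero>} \<subseteq> S"
  shows "x = finsum A (\<lambda>i. hpart A H i x) S"
  by (subst finsum_support[OF assms(2,3) hpart_carrier[OF assms(1)]]) (rule hpart_sum[OF assms(1)])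

text \<open>The finite set \<open>S\<close> may exceed the support, which spares computing supports
  when two decompositions are added.\<close>

lemma hpart_unique:
  assumes "\<And>i. c i \<in> H i" "finite S" "{i. c i \<noteq> \<zero>} \<subseteq> S" "x = finsum A c S"
  shows "hpart A H i x = c i"
proof -
  have c: "\<And>i. c i \<in> carrier A" using assms(1) homog_carrier by blast
  then have x: "x \<in> carrier A" using assms(4) by simp
  have "x = finsum A c {i. c i \<noteq> \<zero>}"
    using assms(4) finsum_support[OF assms(2,3)] c by simp
  moreover have "finite {i. c i \<noteq> \<zero>}" using assms(2,3) finite_subset by blast
  moreover have "\<exists>!c. (\<forall>i. c i \<in> H i) \<and> finite {i. c i \<noteq> \<zero>} \<and> x = finsum A c {i. c i \<noteq> \<zero>}"
    using dd x unfolding direct_decomp_def by blast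
  ultimately have "(THE c. (\<forall>i. c i \<in> H i) \<and> finite {i. c i \<noteq> \<zero>} \<and>
      x = finsum A c {i. c i \<noteq> \<zero>}) = c"
    using assms(1) by (intro the1_equality) auto
  then show ?thesis unfolding hpart_def by simp
qed

lemma hpart_homog:
  assumes "x \<in> H j"
  shows "hpart A H i x = (if i = j then x else \<zero>)"
proof (rule hpart_unique[where S = "{j}"])
  have "x \<in> carrier A" using assms homog_carrier by blast
  then show "x = (\<Oplus>i\<in>{j}. if i = j then x else \<zero>)"
    by simp
qed (use assms in auto)

lemma hpart_zero [simp]: "hpart A H i \<zero> = \<zero>"
  using hpart_homog[OF homog_zero, of i i] by simp

lemma hpart_add_hom: "hpart A H i \<in> add_hom A A"
proof (rule add_homI)
  fix x y assume xy: "x \<in> carrier A" "y \<in> carrier A"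
  let ?S = "{i. hpart A H i x \<noteq> \<zero>} \<union> {i. hpart A H i y \<noteq> \<zero>}"
  have fin: "finite ?S" using xy hpart_finite by simp
  show "hpart A H i (x \<oplus> y) = hpart A H i x \<oplus> hpart A H i y"
  proof (rule hpart_unique[where S = ?S])
    have "finsum A (\<lambda>i. hpart A H i x \<oplus> hpart A H i y) ?S =
        finsum A (\<lambda>i. hpart A H i x) ?S \<oplus> finsum A (\<lambda>i. hpart A H i y) ?S"
      by (rule finsum_addf) (use xy hpart_carrier in auto)
    moreover have "x \<oplus> y = finsum A (\<lambda>i. hpart A H i x) ?S \<oplus> finsum A (\<lambda>i. hpart A H i y) ?S"
      by (rule arg_cong2[where f = "(\<oplus>)"]) (rule hpart_sum_superset[OF _ fin], use xy in auto)+
    ultimately show "x \<oplus> y = finsum A (\<lambda>i. hpart A H i x \<oplus> hpart A H i y) ?S"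
      by (rule trans[OF _ sym, rotated])
  qed (use xy hpart_in homog_add fin in auto)
qed (rule hpart_carrier)

lemmas hpart_add = add_hom_add[OF hpart_add_hom]
lemmas hpart_neg = add_hom_neg[OF abelian_group_axioms abelian_group_axioms hpart_add_hom]

lemma hpart_all_zero:
  assumes "x \<in> carrier A" "\<And>i. hpart A H i x = \<zero>"
  shows "x = \<zero>"
  by (subst hpart_sum[OF assms(1)]) (simp add: assms(2))

end

text \<open>The images of the components of \<open>x\<close>, reindexed along \<sigma> and padded
  with zeros, form a decomposition of \<open>f x\<close>, so uniqueness identifies them. The map
  \<sigma> absorbs degree shifts; the second conclusion covers degrees such as those below the
  degree of a multiplier.\<close>

lemma hpart_naturality:
  assumes "graded_group A H" "graded_group B K" "f \<in> add_hom A B" "inj \<sigma>"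
    and "\<And>i x. x \<in> H i \<Longrightarrow> f x \<in> K (\<sigma> i)" and x: "x \<in> carrier A"
  shows hpart_natural: "hpart B K (\<sigma> i) (f x) = f (hpart A H i x)"
    and hpart_natural_off_range: "l \<notin> range \<sigma> \<Longrightarrow> hpart B K l (f x) = \<zero>\<^bsub>B\<^esub>"
proof -
  interpret A: graded_group A H by fact
  interpret B: graded_group B K by fact
  note f0 = add_hom_zero[OF A.abelian_group_axioms B.abelian_group_axioms assms(3)]
  let ?c = "\<lambda>l. if l \<in> range \<sigma> then f (hpart A H (inv_into UNIV \<sigma> l) x) else \<zero>\<^bsub>B\<^esub>"
  let ?S = "{i. hpart A H i x \<noteq> \<zero>\<^bsub>A\<^esub>}"
  have c: "hpart B K l (f x) = ?c l" for l
  proof (rule B.hpart_unique[where S = "\<sigma> ` ?S"])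
    show "?c l \<in> K l" for l
      using assms(5)[OF A.hpart_in[OF x]] \<open>inj \<sigma>\<close> by auto
    show "finite (\<sigma> ` ?S)" using A.hpart_finite[OF x] by simp
    show "{i. ?c i \<noteq> \<zero>\<^bsub>B\<^esub>} \<subseteq> \<sigma> ` ?S"
      using \<open>inj \<sigma>\<close> f0 by (auto split: if_splits)
    have fh: "f (hpart A H i x) \<in> carrier B" for i
      using add_hom_closed[OF assms(3) A.hpart_carrier[OF x]] .
    have "f x = f (finsum A (\<lambda>i. hpart A H i x) ?S)" using A.hpart_sum[OF x] by simp
    also have "\<dots> = finsum B (\<lambda>i. f (hpart A H i x)) ?S"
      by (rule add_hom_finsum[OF A.abelian_group_axioms B.abelian_group_axioms assms(3)])
        (use A.hpart_carrier[OF x] in auto)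
    also have "\<dots> = finsum B (\<lambda>i. ?c (\<sigma> i)) ?S"
      by (rule B.finsum_cong') (auto simp: fh \<open>inj \<sigma>\<close>)
    also have "\<dots> = finsum B ?c (\<sigma> ` ?S)"
      by (rule B.finsum_reindex[symmetric])
        (auto simp: fh \<open>inj \<sigma>\<close> intro: inj_on_subset[OF \<open>inj \<sigma>\<close>])
    finally show "f x = finsum B ?c (\<sigma> ` ?S)" .
  qed
  show "hpart B K (\<sigma> i) (f x) = f (hpart A H i x)" using c[of "\<sigma> i"] \<open>inj \<sigma>\<close> by simp
  show "hpart B K l (f x) = \<zero>\<^bsub>B\<^esub>" if "l \<notin> range \<sigma>" using c[of l] that by simp
qed

text \<open>Additive projections determine a grading. Applied to any decomposition of
  \<open>x\<close> they read off its terms, which gives uniqueness. For existence, the difference of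
  \<open>x\<close> and the sum of its projections is killed by every projection, hence zero.\<close>

lemma direct_decompI:
  assumes "abelian_group A" and sub: "\<And>i. additive_subgroup (H i) A"
    and p_hom: "\<And>i. p i \<in> add_hom A A"
    and p_in: "\<And>i x. x \<in> carrier A \<Longrightarrow> p i x \<in> H i"
    and p_homog: "\<And>i j x. x \<in> H j \<Longrightarrow> p i x = (if i = j then x else \<zero>\<^bsub>A\<^esub>)"
    and fin: "\<And>x. x \<in> carrier A \<Longrightarrow> finite {i. p i x \<noteq> \<zero>\<^bsub>A\<^esub>}"
    and inj: "\<And>x. x \<in> carrier A \<Longrightarrow> (\<And>i. p i x = \<zero>\<^bsub>A\<^esub>) \<Longrightarrow> x = \<zero>\<^bsub>A\<^esub>"
  shows "direct_decomp A H"
proof -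
  interpret A: abelian_group A by fact
  have H: "x \<in> carrier A" if "x \<in> H i" for x i
    using additive_subgroup.a_subset[OF sub] that by blast
  have p_sum: "p i (finsum A c S) = (if i \<in> S then c i else \<zero>\<^bsub>A\<^esub>)"
    if "\<And>i. c i \<in> H i" "finite S" for c i S
  proof -
    have "p i (finsum A c S) = finsum A (\<lambda>l. p i (c l)) S"
      by (rule add_hom_finsum[OF assms(1,1) p_hom]) (use that H in auto)
    also have "\<dots> = finsum A (\<lambda>l. if i = l then c l else \<zero>\<^bsub>A\<^esub>) S"
    proof (rule A.finsum_cong')
      show "p i (c l) = (if i = l then c l else \<zero>\<^bsub>A\<^esub>)" for l
        using p_homog[OF that(1)] .
    qed (use H[OF that(1)] in auto)
    also have "\<dots> = (if i \<in> S then c i else \<zero>\<^bsub>A\<^esub>)"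
    proof (cases "i \<in> S")
      case True
      then show ?thesis using A.finsum_singleton[OF True that(2), of c] H[OF that(1)] by auto
    next
      case False
      then show ?thesis by (auto intro!: A.add.finprod_one_eqI)
    qed
    finally show ?thesis .
  qed
  show ?thesis
    unfolding direct_decomp_def
  proof (intro conjI allI ballI sub)
    fix x assume x: "x \<in> carrier A"
    have pc: "\<And>i. p i x \<in> carrier A" using p_in[OF x] H by blast
    let ?S = "{i. p i x \<noteq> \<zero>\<^bsub>A\<^esub>}"
    let ?y = "finsum A (\<lambda>i. p i x) ?S"
    have y: "?y \<in> carrier A" using pc by simp
    have "x \<oplus>\<^bsub>A\<^esub> \<ominus>\<^bsub>A\<^esub> ?y = \<zero>\<^bsub>A\<^esub>"
    proof (rule inj)
      fix i
      have "p i ?y = p i x" using p_sum[of "\<lambda>i. p i x" ?S i] p_in[OF x] fin[OF x] by auto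
      then show "p i (x \<oplus>\<^bsub>A\<^esub> \<ominus>\<^bsub>A\<^esub> ?y) = \<zero>\<^bsub>A\<^esub>"
        using x y pc by (simp add: add_hom_add[OF p_hom] add_hom_neg[OF assms(1,1) p_hom] A.r_neg)
    qed (use x y in simp)
    then have "x = ?y" using x y
      by (metis A.add.inv_closed A.add.inv_inv A.minus_equality)
    show "\<exists>!c. (\<forall>i. c i \<in> H i) \<and> finite {i. c i \<noteq> \<zero>\<^bsub>A\<^esub>} \<and> x = finsum A c {i. c i \<noteq> \<zero>\<^bsub>A\<^esub>}"
    proof (intro ex1I[of _ "\<lambda>i. p i x"] conjI allI)
      fix c assume c: "(\<forall>i. c i \<in> H i) \<and> finite {i. c i \<noteq> \<zero>\<^bsub>A\<^esub>} \<and> x = finsum A c {i. c i \<noteq> \<zero>\<^bsub>A\<^esub>}"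
      then have xc: "x = finsum A c {i. c i \<noteq> \<zero>\<^bsub>A\<^esub>}" by blast
      show "c = (\<lambda>i. p i x)"
      proof
        fix i
        have "p i x = p i (finsum A c {i. c i \<noteq> \<zero>\<^bsub>A\<^esub>})" using xc by (rule arg_cong)
        also have "\<dots> = c i" using p_sum[of c "{i. c i \<noteq> \<zero>\<^bsub>A\<^esub>}" i] c by auto
        finally show "c i = p i x" ..
      qed
    next
      show "x = ?y" by fact
    qed (use p_in[OF x] fin[OF x] in auto)
  qed
qed

section \<open>Graded modules and complexes\<close>

lemma (in abelian_group) additive_subgroupI':
  assumes "H \<subseteq> carrier G" "\<zero> \<in> H" "\<And>x y. x \<in> H \<Longrightarrow> y \<in> H \<Longrightarrow> x \<oplus> y \<in> H"
    "\<And>x. x \<in> H \<Longrightarrow> \<ominus> x \<in> H"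
  shows "additive_subgroup H G"
  using assms by (auto intro!: additive_subgroup.intro subgroup.intro simp: a_inv_def)

lemma (in abelian_group) add_neg_cancel:
  "x \<in> carrier G \<Longrightarrow> y \<in> carrier G \<Longrightarrow> (x \<oplus> y) \<oplus> \<ominus> y = x"
  by (simp add: a_assoc r_neg)

lemma (in abelian_group) neg_add_cancel:
  "x \<in> carrier G \<Longrightarrow> y \<in> carrier G \<Longrightarrow> (x \<oplus> \<ominus> y) \<oplus> y = x"
  by (simp add: a_assoc l_neg)

lemma (in abelian_group) a_inv_zero [simp]: "\<ominus> \<zero> = \<zero>"
  by (rule minus_equality) simp_all

lemma (in abelian_group) coset_eq_iff:
  assumes "additive_subgroup B G" "x \<in> carrier G"
  shows "B +> x = B \<longleftrightarrow> x \<in> B"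
  using a_coset_join1[of B x] a_coset_join2[of x B] assms by (auto simp: additive_subgroup_def)

sublocale graded_module \<subseteq> gr: graded_group M "hcomp M"
  by unfold_locales (rule decomp)

sublocale standard_graded_algebra \<subseteq> Rgr: graded_group R G
  by unfold_locales (rule decomp)

context graded_module
begin

lemma scalar_add_hom: "r \<in> carrier R \<Longrightarrow> (\<lambda>x. r \<odot>\<^bsub>M\<^esub> x) \<in> add_hom M M"
  by (auto intro!: add_homI simp: smult_r_distr)

lemma hpart_smult:
  assumes "w \<in> G a" "w \<in> carrier R" "x \<in> carrier M"
  shows "hpart M (hcomp M) (int a + j) (w \<odot>\<^bsub>M\<^esub> x) = w \<odot>\<^bsub>M\<^esub> hpart M (hcomp M) j x"
  by (rule hpart_natural[OF gr.graded_group_axioms gr.graded_group_axioms scalar_add_hom])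
    (use assms smult_degree in \<open>auto simp: inj_def\<close>)

end

section \<open>Homogeneous submodules\<close>

lemma carrier_sub_gmodule [simp]: "carrier (sub_gmodule M N) = N"
  and zero_sub_gmodule [simp]: "zero (sub_gmodule M N) = zero M"
  and add_sub_gmodule [simp]: "add (sub_gmodule M N) = add M"
  and smult_sub_gmodule [simp]: "smult (sub_gmodule M N) = smult M"
  and hcomp_sub_gmodule [simp]: "hcomp (sub_gmodule M N) j = hcomp M j \<inter> N"
  by (simp_all add: sub_gmodule_def)

lemma (in graded_module) abelian_group_sub_gmodule:
  assumes "submodule N R M"
  shows "abelian_group (sub_gmodule M N)"
proof -
  interpret submodule N R M by fact
  note N = submoduleE[OF assms]
  have sub: "x \<in> N \<Longrightarrow> x \<in> carrier M" for x using N(1) by blast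
  show ?thesis
  proof (rule abelian_groupI)
    fix x assume "x \<in> carrier (sub_gmodule M N)"
    then have "\<ominus>\<^bsub>M\<^esub> x \<in> N" "\<ominus>\<^bsub>M\<^esub> x \<oplus>\<^bsub>M\<^esub> x = \<zero>\<^bsub>M\<^esub>" using N(6) sub M.l_neg by auto
    then show "\<exists>y\<in>carrier (sub_gmodule M N). y \<oplus>\<^bsub>sub_gmodule M N\<^esub> x = \<zero>\<^bsub>sub_gmodule M N\<^esub>"
      by auto
  qed (use sub N(5) one_closed in \<open>auto simp: M.a_ac\<close>)
qed

lemma (in graded_module) a_inv_sub_gmodule:
  assumes "submodule N R M" "x \<in> N"
  shows "\<ominus>\<^bsub>sub_gmodule M N\<^esub> x = \<ominus>\<^bsub>M\<^esub> x"
proof -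
  interpret S: abelian_group "sub_gmodule M N" by (rule abelian_group_sub_gmodule) fact
  note N = submoduleE[OF assms(1)]
  have "\<ominus>\<^bsub>M\<^esub> x \<oplus>\<^bsub>M\<^esub> x = \<zero>\<^bsub>M\<^esub>" "\<ominus>\<^bsub>M\<^esub> x \<in> N" using N(1,6) assms(2) M.l_neg by auto
  then show ?thesis using S.minus_equality[of "\<ominus>\<^bsub>M\<^esub> x" x] assms(2) by simp
qed

text \<open>Closure under components lets the projections of \<open>M\<close> restrict to
  \<open>N\<close>. The hypothesis \<open>GR\<close> is explicit because the locale
  \<open>graded_module\<close> does not place the \<open>G a\<close> inside the ring.\<close>

lemma (in graded_module) graded_module_sub_gmodule:
  assumes "submodule N R M" and GR: "\<And>a. G a \<subseteq> carrier R" and closed: "\<And>x j. x \<in> N \<Longrightarrow> hpart M (hcomp M) j x \<in> N"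
  shows "graded_module R G (sub_gmodule M N)"
proof -
  interpret S: abelian_group "sub_gmodule M N" by (rule abelian_group_sub_gmodule) fact
  note N = submoduleE[OF assms(1)]
  have sub: "x \<in> N \<Longrightarrow> x \<in> carrier M" for x using N(1) by blast
  have zero: "\<zero>\<^bsub>M\<^esub> \<in> N" using S.zero_closed by simp
  have mod: "module R (sub_gmodule M N)"
    by (rule moduleI[OF R.is_cring S.abelian_group_axioms])
      (use N(4) sub in \<open>auto simp: smult_l_distr smult_r_distr smult_assoc1\<close>)
  have dd: "direct_decomp (sub_gmodule M N) (hcomp (sub_gmodule M N))"
  proof (rule direct_decompI[where p = "hpart M (hcomp M)"])
    show "additive_subgroup (hcomp (sub_gmodule M N) i) (sub_gmodule M N)" for i
      by (rule S.additive_subgroupI')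
        (use zero N(5,6) gr.homog_add gr.homog_neg in \<open>auto simp: a_inv_sub_gmodule[OF assms(1)]\<close>)
    show "hpart M (hcomp M) i \<in> add_hom (sub_gmodule M N) (sub_gmodule M N)" for i
      by (rule add_homI) (use closed sub gr.hpart_add in auto)
    show "x = \<zero>\<^bsub>sub_gmodule M N\<^esub>"
      if "x \<in> carrier (sub_gmodule M N)" "\<And>i. hpart M (hcomp M) i x = \<zero>\<^bsub>sub_gmodule M N\<^esub>" for x
      using gr.hpart_all_zero[of x] sub that by simp
  qed (use S.abelian_group_axioms sub closed gr.hpart_in gr.hpart_homog gr.hpart_finite in auto)
  have "r \<odot>\<^bsub>M\<^esub> x \<in> hcomp M (int a + j) \<inter> N" if "r \<in> G a" "x \<in> hcomp M j \<inter> N" for r a x j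
    using smult_degree[of r a x j] N(4)[of r x] GR that by blast
  then show ?thesis
    by (intro graded_module.intro mod graded_module_axioms.intro dd) auto
qed

section \<open>Degree-preserving maps\<close>

lemma gr_homD:
  assumes "f \<in> gr_hom R M N"
  shows gr_hom_closed: "x \<in> carrier M \<Longrightarrow> f x \<in> carrier N"
    and gr_hom_add: "x \<in> carrier M \<Longrightarrow> y \<in> carrier M \<Longrightarrow> f (x \<oplus>\<^bsub>M\<^esub> y) = f x \<oplus>\<^bsub>N\<^esub> f y"
    and gr_hom_smult: "r \<in> carrier R \<Longrightarrow> x \<in> carrier M \<Longrightarrow> f (r \<odot>\<^bsub>M\<^esub> x) = r \<odot>\<^bsub>N\<^esub> f x"
    and gr_hom_homog: "x \<in> hcomp M j \<Longrightarrow> f x \<in> hcomp N j"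
    and gr_hom_add_hom: "f \<in> add_hom M N"
  using assms unfolding gr_hom_def add_hom_def by blast+

lemma gr_homI:
  assumes "\<And>x. x \<in> carrier M \<Longrightarrow> f x \<in> carrier N"
    and "\<And>x y. x \<in> carrier M \<Longrightarrow> y \<in> carrier M \<Longrightarrow> f (x \<oplus>\<^bsub>M\<^esub> y) = f x \<oplus>\<^bsub>N\<^esub> f y"
    and "\<And>r x. r \<in> carrier R \<Longrightarrow> x \<in> carrier M \<Longrightarrow> f (r \<odot>\<^bsub>M\<^esub> x) = r \<odot>\<^bsub>N\<^esub> f x"
    and "\<And>x j. x \<in> hcomp M j \<Longrightarrow> f x \<in> hcomp N j"
  shows "f \<in> gr_hom R M N"
  using assms by (auto simp: gr_hom_def)

lemma gr_hom_hpart: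
  assumes "graded_module R G M" "graded_module R G N" "f \<in> gr_hom R M N" "x \<in> carrier M"
  shows "hpart N (hcomp N) j (f x) = f (hpart M (hcomp M) j x)"
proof -
  interpret M: graded_module R G M by fact
  interpret N: graded_module R G N by fact
  show ?thesis
    using hpart_natural[OF M.gr.graded_group_axioms N.gr.graded_group_axioms
        gr_hom_add_hom[OF assms(3)], where \<sigma> = "\<lambda>x. x"] gr_hom_homog[OF assms(3)] assms(4)
    by (simp add: inj_def)
qed

section \<open>Complexes: cycles, boundaries and vanishing of homology\<close>

locale graded_cx = standard_graded_algebra R k G
  for R :: "'r ring" (structure) and k G +
  fixes C :: "('r, 'm) gcomplex"
  assumes cx: "graded_complex R G C"
begin

lemma obj_gm: "graded_module R G (obj C i)"
  using cx by (simp add: graded_complex_def)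

lemma d_hom: "diff C i \<in> gr_hom R (obj C i) (obj C (i - 1))"
  using cx by (simp add: graded_complex_def)

lemma d_d: "x \<in> carrier (obj C i) \<Longrightarrow> diff C (i - 1) (diff C i x) = \<zero>\<^bsub>obj C (i - 2)\<^esub>"
  using cx by (simp add: graded_complex_def)

sublocale ob: graded_module R G "obj C i" for i
  by (rule obj_gm)

lemma G_carrier: "r \<in> G a \<Longrightarrow> r \<in> carrier R"
  using Rgr.homog_carrier .

lemmas d_closed [simp, intro] = gr_hom_closed[OF d_hom]
lemmas d_add = gr_hom_add[OF d_hom]
lemmas d_smult = gr_hom_smult[OF d_hom]
lemmas d_homog = gr_hom_homog[OF d_hom]
lemmas d_hpart = gr_hom_hpart[OF obj_gm obj_gm d_hom]

lemma d_zero [simp]: "diff C i \<zero>\<^bsub>obj C i\<^esub> = \<zero>\<^bsub>obj C (i - 1)\<^esub>"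
  by (rule add_hom_zero[OF ob.M.abelian_group_axioms ob.M.abelian_group_axioms
        gr_hom_add_hom[OF d_hom]])

lemma d_neg:
  "x \<in> carrier (obj C i) \<Longrightarrow> diff C i (\<ominus>\<^bsub>obj C i\<^esub> x) = \<ominus>\<^bsub>obj C (i - 1)\<^esub> diff C i x"
  by (rule add_hom_neg[OF ob.M.abelian_group_axioms ob.M.abelian_group_axioms
        gr_hom_add_hom[OF d_hom]])

lemma d_up_closed: "x \<in> carrier (obj C (i + 1)) \<Longrightarrow> diff C (i + 1) x \<in> carrier (obj C i)"
  using d_closed[of x "i + 1"] by simp

lemma d_up_homog: "x \<in> hcomp (obj C (i + 1)) j \<Longrightarrow> diff C (i + 1) x \<in> hcomp (obj C i) j"
  using d_homog[of x "i + 1" j] by simp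

lemma d_d_up: "x \<in> carrier (obj C (i + 1)) \<Longrightarrow> diff C i (diff C (i + 1) x) = \<zero>\<^bsub>obj C (i - 1)\<^esub>"
  using d_d[of x "i + 1"] by simp

lemma submodule_cycles: "submodule (cycles C i) R (obj C i)"
  by (rule ob.submoduleI) (auto simp: cycles_def d_add d_neg d_smult)

lemma boundariesI: "u \<in> carrier (obj C (i + 1)) \<Longrightarrow> diff C (i + 1) u \<in> boundaries C i"
  by (simp add: boundaries_def)

lemma submodule_boundaries: "submodule (boundaries C i) R (obj C i)"
proof (rule ob.submoduleI)
  show "boundaries C i \<subseteq> carrier (obj C i)"
    by (auto simp: boundaries_def d_up_closed)
  show "\<zero>\<^bsub>obj C i\<^esub> \<in> boundaries C i"
    using boundariesI[OF ob.M.zero_closed[of "i + 1"]] by simp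
  fix a assume "a \<in> boundaries C i"
  then obtain u where u: "u \<in> carrier (obj C (i + 1))" "a = diff C (i + 1) u"
    unfolding boundaries_def by blast
  show "\<ominus>\<^bsub>obj C i\<^esub> a \<in> boundaries C i"
    using d_neg[OF u(1)] boundariesI[OF ob.M.a_inv_closed[OF u(1)]] u(2) by simp
  show "r \<odot>\<^bsub>obj C i\<^esub> a \<in> boundaries C i" if "r \<in> carrier R" for r
    using d_smult[OF that u(1)] boundariesI[OF ob.smult_closed[OF that u(1)]] u(2) by simp
  fix b assume "b \<in> boundaries C i"
  then obtain v where v: "v \<in> carrier (obj C (i + 1))" "b = diff C (i + 1) v"
    unfolding boundaries_def by blast
  show "a \<oplus>\<^bsub>obj C i\<^esub> b \<in> boundaries C i"
    using d_add[OF u(1) v(1)] boundariesI[OF ob.M.a_closed[OF u(1) v(1)]] u(2) v(2) by simp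
qed

lemma boundaries_subset_cycles: "boundaries C i \<subseteq> cycles C i"
  by (auto simp: boundaries_def cycles_def d_up_closed d_d_up)

text \<open>The differential commutes with taking components, so any preimage may be replaced by its
  component of degree \<open>j\<close>.\<close>

lemma hpart_boundaries:
  assumes "x \<in> boundaries C i"
  shows "\<exists>u\<in>hcomp (obj C (i + 1)) j. diff C (i + 1) u = hpart (obj C i) (hcomp (obj C i)) j x"
proof -
  obtain u where u: "u \<in> carrier (obj C (i + 1))" "x = diff C (i + 1) u"
    using assms by (auto simp: boundaries_def)
  show ?thesis
    using d_hpart[OF u(1), of j] ob.gr.hpart_in[OF u(1), of j] u(2) by auto
qed

end

text \<open>Vanishing of homology in bidegree (i, j), phrased with homogeneous chains only;
  \<open>homology_nonzero_iff\<close> ties it to the quotient modules.\<close>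

definition exact_at :: "('r, 'm) gcomplex \<Rightarrow> int \<Rightarrow> int \<Rightarrow> bool" where
  "exact_at C i j \<longleftrightarrow> (\<forall>x\<in>hcomp (obj C i) j. diff C i x = \<zero>\<^bsub>obj C (i - 1)\<^esub> \<longrightarrow>
     (\<exists>u\<in>hcomp (obj C (i + 1)) j. diff C (i + 1) u = x))"

lemma a_r_coset_sub_gmodule [simp]:
  "B +>\<^bsub>sub_gmodule M N\<^esub> x = B +>\<^bsub>M\<^esub> x"
  by (simp add: a_r_coset_def')

lemma homology_simps:
  "zero (homology C i) = boundaries C i"
  "carrier (homology C i) = (\<lambda>x. boundaries C i +>\<^bsub>obj C i\<^esub> x) ` cycles C i"
  "hcomp (homology C i) j =
     (\<lambda>x. boundaries C i +>\<^bsub>obj C i\<^esub> x) ` (hcomp (obj C i) j \<inter> cycles C i)"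
  "add (homology C i) = set_add (obj C i)"
  "smult (homology C i) = (\<lambda>r A. \<Union>x\<in>A. boundaries C i +>\<^bsub>obj C i\<^esub> (r \<odot>\<^bsub>obj C i\<^esub> x))"
  by (auto simp: homology_def quot_gmodule_def A_RCOSETS_def' set_add_def' fun_eq_iff)

text \<open>The degree j part of homology consists of the cosets of homogeneous cycles. Such a coset
  is zero exactly when its representative is a boundary, and by \<open>hpart_boundaries\<close> it
  is then the boundary of a homogeneous chain of the same degree.\<close>

lemma (in graded_cx) homology_nonzero_iff: "homology_nonzero C i j \<longleftrightarrow> \<not> exact_at C i j"
proof -
  let ?M = "obj C i" and ?B = "boundaries C i" and ?Z = "hcomp (obj C i) j \<inter> cycles C i"
  have B: "additive_subgroup ?B ?M"
    using submodule_boundaries by (simp add: submodule_def additive_subgroup_def)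
  have coset: "?B +>\<^bsub>?M\<^esub> x = ?B \<longleftrightarrow> x \<in> ?B" if "x \<in> ?Z" for x
    using ob.M.coset_eq_iff[OF B] that ob.gr.homog_carrier by blast
  have "\<zero>\<^bsub>?M\<^esub> \<in> ?Z" by (simp add: cycles_def)
  then have "homology_nonzero C i j \<longleftrightarrow> (\<exists>x\<in>?Z. ?B +>\<^bsub>?M\<^esub> x \<noteq> ?B)"
    unfolding homology_nonzero_def homology_simps by blast
  also have "\<dots> \<longleftrightarrow> (\<exists>x\<in>?Z. x \<notin> ?B)"
    using coset by blast
  also have "\<dots> \<longleftrightarrow> \<not> exact_at C i j"
  proof -
    have "x \<in> ?B \<longleftrightarrow> (\<exists>u\<in>hcomp (obj C (i + 1)) j. diff C (i + 1) u = x)"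
      if "x \<in> hcomp ?M j" for x
    proof
      assume "x \<in> ?B"
      then show "\<exists>u\<in>hcomp (obj C (i + 1)) j. diff C (i + 1) u = x"
        using hpart_boundaries[of x i j] ob.gr.hpart_homog[OF that, of j] by simp
    qed (use ob.gr.homog_carrier in \<open>auto simp: boundaries_def\<close>)
    then show ?thesis
      unfolding exact_at_def cycles_def using ob.gr.homog_carrier by blast
  qed
  finally show ?thesis .
qed

section \<open>Koszul complexes as iterated cones\<close>

definition gprod ::
  "'i set \<Rightarrow> ('i \<Rightarrow> ('r, 'm) gmodule) \<Rightarrow> ('i \<Rightarrow> int) \<Rightarrow> ('r, 'i \<Rightarrow> 'm) gmodule" where
  "gprod I N \<sigma> =
     \<lparr>carrier = (\<Pi>\<^sub>E S\<in>I. carrier (N S)), mult = undefined, one = undefined,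
      zero = (\<lambda>S\<in>I. \<zero>\<^bsub>N S\<^esub>),
      add = (\<lambda>u v. \<lambda>S\<in>I. u S \<oplus>\<^bsub>N S\<^esub> v S),
      smult = (\<lambda>r u. \<lambda>S\<in>I. r \<odot>\<^bsub>N S\<^esub> u S),
      hcomp = (\<lambda>j. \<Pi>\<^sub>E S\<in>I. hcomp (N S) (j - \<sigma> S))\<rparr>"

lemma gprod_simps [simp]:
  "carrier (gprod I N \<sigma>) = (\<Pi>\<^sub>E S\<in>I. carrier (N S))"
  "zero (gprod I N \<sigma>) = (\<lambda>S\<in>I. \<zero>\<^bsub>N S\<^esub>)"
  "add (gprod I N \<sigma>) u v = (\<lambda>S\<in>I. u S \<oplus>\<^bsub>N S\<^esub> v S)"
  "smult (gprod I N \<sigma>) r u = (\<lambda>S\<in>I. r \<odot>\<^bsub>N S\<^esub> u S)"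
  "hcomp (gprod I N \<sigma>) j = (\<Pi>\<^sub>E S\<in>I. hcomp (N S) (j - \<sigma> S))"
  by (simp_all add: gprod_def)

lemma koszul_obj_eq_gprod:
  "koszul_obj n M i = gprod (Pow {0..<n}) (\<lambda>S. obj M (i - int (card S))) (\<lambda>S. int (card S))"
  by (simp add: koszul_obj_def gprod_def)

lemma PiE_cong_eqI:
  assumes "u \<in> (\<Pi>\<^sub>E S\<in>I. A S)" "v \<in> (\<Pi>\<^sub>E S\<in>I. B S)" "\<And>S. S \<in> I \<Longrightarrow> u S = v S"
  shows "u = v"
  using assms by (auto simp: PiE_iff intro: extensionalityI)

lemma (in standard_graded_algebra) abelian_group_gprod:
  assumes N: "\<And>S. graded_module R G (N S)"
  shows "abelian_group (gprod I N \<sigma>)"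
proof -
  interpret N: graded_module R G "N S" for S by (rule N)
  show ?thesis
  proof (rule abelian_groupI)
    fix x assume x: "x \<in> carrier (gprod I N \<sigma>)"
    then have "(\<lambda>S\<in>I. \<ominus>\<^bsub>N S\<^esub> x S) \<in> carrier (gprod I N \<sigma>)"
      "(\<lambda>S\<in>I. \<ominus>\<^bsub>N S\<^esub> x S) \<oplus>\<^bsub>gprod I N \<sigma>\<^esub> x = \<zero>\<^bsub>gprod I N \<sigma>\<^esub>"
      by (auto simp: PiE_iff N.M.l_neg fun_eq_iff)
    then show "\<exists>y\<in>carrier (gprod I N \<sigma>). y \<oplus>\<^bsub>gprod I N \<sigma>\<^esub> x = \<zero>\<^bsub>gprod I N \<sigma>\<^esub>" by blast
  next
    fix x y z
    assume x: "x \<in> carrier (gprod I N \<sigma>)" "y \<in> carrier (gprod I N \<sigma>)" "z \<in> carrier (gprod I N \<sigma>)"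
    then show "x \<oplus>\<^bsub>gprod I N \<sigma>\<^esub> y \<oplus>\<^bsub>gprod I N \<sigma>\<^esub> z = x \<oplus>\<^bsub>gprod I N \<sigma>\<^esub> (y \<oplus>\<^bsub>gprod I N \<sigma>\<^esub> z)"
      by (auto simp: PiE_iff N.M.a_assoc fun_eq_iff)
  next
    fix x assume x: "x \<in> carrier (gprod I N \<sigma>)"
    then show "\<zero>\<^bsub>gprod I N \<sigma>\<^esub> \<oplus>\<^bsub>gprod I N \<sigma>\<^esub> x = x"
      by (auto simp: PiE_iff fun_eq_iff extensional_def)
  next
    fix x y
    assume x: "x \<in> carrier (gprod I N \<sigma>)" "y \<in> carrier (gprod I N \<sigma>)"
    then show "x \<oplus>\<^bsub>gprod I N \<sigma>\<^esub> y \<in> carrier (gprod I N \<sigma>)" by (auto simp: PiE_iff)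
    show "x \<oplus>\<^bsub>gprod I N \<sigma>\<^esub> y = y \<oplus>\<^bsub>gprod I N \<sigma>\<^esub> x"
      using x by (auto simp: PiE_iff N.M.a_comm fun_eq_iff)
  qed auto
qed

lemma (in standard_graded_algebra) a_inv_gprod:
  assumes N: "\<And>S. graded_module R G (N S)" and x: "x \<in> carrier (gprod I N \<sigma>)"
  shows "\<ominus>\<^bsub>gprod I N \<sigma>\<^esub> x = (\<lambda>S\<in>I. \<ominus>\<^bsub>N S\<^esub> x S)"
proof -
  interpret N: graded_module R G "N S" for S by (rule N)
  interpret P: abelian_group "gprod I N \<sigma>" by (rule abelian_group_gprod[OF N])
  show ?thesis
    by (rule P.minus_equality) (use x in \<open>auto simp: PiE_iff N.M.l_neg fun_eq_iff\<close>)
qed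

lemma (in standard_graded_algebra) graded_module_gprod:
  assumes N: "\<And>S. graded_module R G (N S)" and "finite I"
  shows "graded_module R G (gprod I N \<sigma>)"
proof -
  interpret N: graded_module R G "N S" for S by (rule N)
  interpret P: abelian_group "gprod I N \<sigma>" by (rule abelian_group_gprod[OF N])
  let ?P = "gprod I N \<sigma>"
  have mod: "module R ?P"
  proof (rule moduleI[OF is_cring P.abelian_group_axioms])
    fix a b x y
    assume "a \<in> carrier R" "x \<in> carrier ?P"
    then show "a \<odot>\<^bsub>?P\<^esub> x \<in> carrier ?P" by (auto simp: PiE_iff)
    assume "b \<in> carrier R"
    show "(a \<oplus> b) \<odot>\<^bsub>?P\<^esub> x = a \<odot>\<^bsub>?P\<^esub> x \<oplus>\<^bsub>?P\<^esub> b \<odot>\<^bsub>?P\<^esub> x"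
      using \<open>a \<in> _\<close> \<open>b \<in> _\<close> \<open>x \<in> _\<close> by (auto simp: PiE_iff fun_eq_iff N.smult_l_distr)
    show "(a \<otimes> b) \<odot>\<^bsub>?P\<^esub> x = a \<odot>\<^bsub>?P\<^esub> (b \<odot>\<^bsub>?P\<^esub> x)"
      using \<open>a \<in> _\<close> \<open>b \<in> _\<close> \<open>x \<in> _\<close> by (auto simp: PiE_iff fun_eq_iff N.smult_assoc1)
  next
    fix a x y
    assume "a \<in> carrier R" "x \<in> carrier ?P" "y \<in> carrier ?P"
    then show "a \<odot>\<^bsub>?P\<^esub> (x \<oplus>\<^bsub>?P\<^esub> y) = a \<odot>\<^bsub>?P\<^esub> x \<oplus>\<^bsub>?P\<^esub> a \<odot>\<^bsub>?P\<^esub> y"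
      by (auto simp: PiE_iff fun_eq_iff N.smult_r_distr)
  next
    fix x assume "x \<in> carrier ?P"
    then show "\<one> \<odot>\<^bsub>?P\<^esub> x = x" by (auto simp: PiE_iff fun_eq_iff extensional_def)
  qed
  let ?p = "\<lambda>j u. \<lambda>S\<in>I. hpart (N S) (hcomp (N S)) (j - \<sigma> S) (u S)"
  have dd: "direct_decomp ?P (hcomp ?P)"
  proof (rule direct_decompI[where p = ?p])
    show "abelian_group ?P" by (rule P.abelian_group_axioms)
    have sub: "x \<in> carrier ?P" if "x \<in> hcomp ?P j" for x j
      using that N.gr.homog_carrier by (auto simp: PiE_iff)
    show "additive_subgroup (hcomp ?P j) ?P" for j
    proof (rule P.additive_subgroupI')
      show "hcomp ?P j \<subseteq> carrier ?P" using sub by blast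
      show "\<ominus>\<^bsub>?P\<^esub> x \<in> hcomp ?P j" if "x \<in> hcomp ?P j" for x
        using that N.gr.homog_neg unfolding a_inv_gprod[OF N sub[OF that]] by (auto simp: PiE_iff)
    qed (auto simp: PiE_iff N.gr.homog_add)
    show "?p j \<in> add_hom ?P ?P" for j
      by (rule add_homI)
        (auto simp: PiE_iff fun_eq_iff N.gr.hpart_carrier N.gr.hpart_add)
    fix x assume x: "x \<in> carrier ?P"
    show "?p j x \<in> hcomp ?P j" for j
      using x N.gr.hpart_in by (auto simp: PiE_iff)
    have xS: "S \<in> I \<Longrightarrow> x S \<in> carrier (N S)" for S using x by auto
    \<comment> \<open>Each coordinate has finite support, shifted by \<open>\<sigma> S\<close>;
      finiteness of \<open>I\<close> keeps the union finite.\<close>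
    show "finite {j. ?p j x \<noteq> \<zero>\<^bsub>?P\<^esub>}"
    proof (rule finite_subset)
      show "{j. ?p j x \<noteq> \<zero>\<^bsub>?P\<^esub>} \<subseteq>
          (\<Union>S\<in>I. (\<lambda>l. l + \<sigma> S) ` {l. hpart (N S) (hcomp (N S)) l (x S) \<noteq> \<zero>\<^bsub>N S\<^esub>})"
      proof
        fix j assume "j \<in> {j. ?p j x \<noteq> \<zero>\<^bsub>?P\<^esub>}"
        then obtain S where "S \<in> I" "hpart (N S) (hcomp (N S)) (j - \<sigma> S) (x S) \<noteq> \<zero>\<^bsub>N S\<^esub>"
          by (auto simp: fun_eq_iff split: if_splits)
        then show "j \<in> (\<Union>S\<in>I. (\<lambda>l. l + \<sigma> S) ` {l. hpart (N S) (hcomp (N S)) l (x S) \<noteq> \<zero>\<^bsub>N S\<^esub>})"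
          by (auto intro!: bexI[of _ S] image_eqI[of _ _ "j - \<sigma> S"])
      qed
    qed (use \<open>finite I\<close> xS N.gr.hpart_finite in auto)
    show "x = \<zero>\<^bsub>?P\<^esub>" if z: "\<And>j. ?p j x = \<zero>\<^bsub>?P\<^esub>"
    proof -
      have "x S = \<zero>\<^bsub>N S\<^esub>" if "S \<in> I" for S
      proof (rule N.gr.hpart_all_zero[OF xS[OF that]])
        fix l show "hpart (N S) (hcomp (N S)) l (x S) = \<zero>\<^bsub>N S\<^esub>"
          using fun_cong[OF z[of "l + \<sigma> S"], of S] that by simp
      qed
      then show ?thesis using x by (auto simp: PiE_iff fun_eq_iff extensional_def)
    qed
  next
    fix i j x assume x: "x \<in> hcomp ?P j"
    show "?p i x = (if i = j then x else \<zero>\<^bsub>?P\<^esub>)"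
    proof -
      have "hpart (N S) (hcomp (N S)) (i - \<sigma> S) (x S) = (if i = j then x S else \<zero>\<^bsub>N S\<^esub>)"
        if "S \<in> I" for S
        using N.gr.hpart_homog[of "x S" S "j - \<sigma> S" "i - \<sigma> S"] x that by (auto simp: PiE_iff)
      then show ?thesis using x by (auto simp: PiE_iff fun_eq_iff extensional_def)
    qed
  qed
  have "r \<odot>\<^bsub>?P\<^esub> x \<in> hcomp ?P (int a + j)" if "r \<in> G a" "x \<in> hcomp ?P j" for r a x j
    using N.smult_degree[OF that(1)] that(2) by (auto simp: PiE_iff add_diff_eq[symmetric])
  then show ?thesis
    by (intro graded_module.intro mod graded_module_axioms.intro dd)
qed

lemma (in graded_cx) graded_module_koszul_obj: "graded_module R G (koszul_obj n C i)"
  unfolding koszul_obj_eq_gprod by (rule graded_module_gprod) (auto intro: obj_gm)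

text \<open>\<open>D\<close> is the mapping cone of multiplication by \<open>w\<close> on
  \<open>C\<close>, seen through coordinates: \<open>pr i a b\<close> pairs a chain of degree i with
  one of degree i - 1, whose internal degree is lower by one because \<open>w\<close> is linear. The
  chases use only the axioms for \<open>pr\<close>, so the subset indexing of Koszul chains stays
  out of them. That \<open>D\<close> is a complex is a consequence,
  \<open>graded_complex_cone\<close>.\<close>

locale cone_cx = graded_cx R k G C
  for R :: "'r ring" (structure) and k G and C :: "('r, 'm) gcomplex" +
  fixes w :: 'r and D :: "('r, 'n) gcomplex" and pr :: "int \<Rightarrow> 'm \<Rightarrow> 'm \<Rightarrow> 'n"
  assumes w_degree: "w \<in> G 1"
    and D_gm: "graded_module R G (obj D i)"
    and pr_cases: "x \<in> carrier (obj D i) \<Longrightarrow>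
      \<exists>a b. a \<in> carrier (obj C i) \<and> b \<in> carrier (obj C (i - 1)) \<and> x = pr i a b"
    and pr_closed: "a \<in> carrier (obj C i) \<Longrightarrow> b \<in> carrier (obj C (i - 1)) \<Longrightarrow>
      pr i a b \<in> carrier (obj D i)"
    and pr_homog: "a \<in> carrier (obj C i) \<Longrightarrow> b \<in> carrier (obj C (i - 1)) \<Longrightarrow>
      pr i a b \<in> hcomp (obj D i) j \<longleftrightarrow>
        a \<in> hcomp (obj C i) j \<and> b \<in> hcomp (obj C (i - 1)) (j - 1)"
    and pr_inj: "a \<in> carrier (obj C i) \<Longrightarrow> b \<in> carrier (obj C (i - 1)) \<Longrightarrow>
      a' \<in> carrier (obj C i) \<Longrightarrow> b' \<in> carrier (obj C (i - 1)) \<Longrightarrow>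
      pr i a b = pr i a' b' \<longleftrightarrow> a = a' \<and> b = b'"
    and pr_add: "a \<in> carrier (obj C i) \<Longrightarrow> b \<in> carrier (obj C (i - 1)) \<Longrightarrow>
      a' \<in> carrier (obj C i) \<Longrightarrow> b' \<in> carrier (obj C (i - 1)) \<Longrightarrow>
      pr i a b \<oplus>\<^bsub>obj D i\<^esub> pr i a' b' = pr i (a \<oplus>\<^bsub>obj C i\<^esub> a') (b \<oplus>\<^bsub>obj C (i - 1)\<^esub> b')"
    and pr_smult: "r \<in> carrier R \<Longrightarrow> a \<in> carrier (obj C i) \<Longrightarrow> b \<in> carrier (obj C (i - 1)) \<Longrightarrow>
      r \<odot>\<^bsub>obj D i\<^esub> pr i a b = pr i (r \<odot>\<^bsub>obj C i\<^esub> a) (r \<odot>\<^bsub>obj C (i - 1)\<^esub> b)"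
    and pr_diff: "a \<in> carrier (obj C i) \<Longrightarrow> b \<in> carrier (obj C (i - 1)) \<Longrightarrow>
      diff D i (pr i a b) =
        pr (i - 1) (diff C i a \<oplus>\<^bsub>obj C (i - 1)\<^esub> w \<odot>\<^bsub>obj C (i - 1)\<^esub> b)
          (\<ominus>\<^bsub>obj C (i - 2)\<^esub> diff C (i - 1) b)"
begin

lemma w_carrier [simp]: "w \<in> carrier R"
  using w_degree G_carrier by blast

lemma w_homog: "x \<in> hcomp (obj C i) j \<Longrightarrow> w \<odot>\<^bsub>obj C i\<^esub> x \<in> hcomp (obj C i) (j + 1)"
  using ob.smult_degree[OF w_degree, of x i j] by (simp add: add.commute)

lemma d_closed2: "b \<in> carrier (obj C (i - 1)) \<Longrightarrow> diff C (i - 1) b \<in> carrier (obj C (i - 2))"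
  using d_closed[of b "i - 1"] by simp

text \<open>The axioms do not say that \<open>pr\<close> preserves zero; scaling some presentation
  of zero by the zero of the ring gives it.\<close>

lemma pr_zero: "\<zero>\<^bsub>obj D i\<^esub> = pr i \<zero>\<^bsub>obj C i\<^esub> \<zero>\<^bsub>obj C (i - 1)\<^esub>"
proof -
  interpret D: graded_module R G "obj D i" by (rule D_gm)
  obtain a b where ab: "a \<in> carrier (obj C i)" "b \<in> carrier (obj C (i - 1))"
    "\<zero>\<^bsub>obj D i\<^esub> = pr i a b"
    using pr_cases[OF D.M.zero_closed] by blast
  have "pr i a b = \<zero> \<odot>\<^bsub>obj D i\<^esub> pr i a b"
    using D.smult_l_null[OF pr_closed[OF ab(1,2)]] ab(3) by simp
  also have "\<dots> = pr i \<zero>\<^bsub>obj C i\<^esub> \<zero>\<^bsub>obj C (i - 1)\<^esub>"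
    using pr_smult[OF _ ab(1,2), of \<zero>] ab(1,2) by simp
  finally show ?thesis using ab(3) by simp
qed

lemma cone_diff_closed:
  assumes "a \<in> carrier (obj C i)" "b \<in> carrier (obj C (i - 1))"
  shows "diff C i a \<oplus>\<^bsub>obj C (i - 1)\<^esub> w \<odot>\<^bsub>obj C (i - 1)\<^esub> b \<in> carrier (obj C (i - 1))"
    "\<ominus>\<^bsub>obj C (i - 2)\<^esub> diff C (i - 1) b \<in> carrier (obj C (i - 2))"
  using assms d_closed2 by auto

lemma graded_complex_cone: "graded_complex R G D"
  unfolding graded_complex_def
proof (intro conjI allI ballI D_gm)
  fix i
  show "diff D i \<in> gr_hom R (obj D i) (obj D (i - 1))"
  proof (rule gr_homI)
    fix x assume "x \<in> carrier (obj D i)"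
    then obtain a b where ab: "a \<in> carrier (obj C i)" "b \<in> carrier (obj C (i - 1))" "x = pr i a b"
      using pr_cases by blast
    note cl = cone_diff_closed[OF ab(1,2)]
    show "diff D i x \<in> carrier (obj D (i - 1))"
      unfolding ab(3) pr_diff[OF ab(1,2)] by (rule pr_closed) (use cl in auto)
    show "diff D i (r \<odot>\<^bsub>obj D i\<^esub> x) = r \<odot>\<^bsub>obj D (i - 1)\<^esub> diff D i x" if r: "r \<in> carrier R" for r
    proof -
      have "w \<odot>\<^bsub>obj C (i - 1)\<^esub> (r \<odot>\<^bsub>obj C (i - 1)\<^esub> b) = r \<odot>\<^bsub>obj C (i - 1)\<^esub> (w \<odot>\<^bsub>obj C (i - 1)\<^esub> b)"
        using r ab(2) by (simp add: ob.smult_assoc1[symmetric] m_comm)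
      then show ?thesis
        using r ab cl d_closed2[OF ab(2)] d_smult[OF r ab(2)]
        by (simp add: pr_smult pr_diff d_smult ob.smult_r_distr ob.smult_r_minus)
    qed
    fix y assume "y \<in> carrier (obj D i)"
    then obtain a' b' where ab': "a' \<in> carrier (obj C i)" "b' \<in> carrier (obj C (i - 1))" "y = pr i a' b'"
      using pr_cases by blast
    note cl' = cone_diff_closed[OF ab'(1,2)]
    show "diff D i (x \<oplus>\<^bsub>obj D i\<^esub> y) = diff D i x \<oplus>\<^bsub>obj D (i - 1)\<^esub> diff D i y"
      using ab ab' cl cl' d_closed2[OF ab(2)] d_closed2[OF ab'(2)] d_add[OF ab(2) ab'(2)]
      by (simp add: pr_add pr_diff d_add ob.smult_r_distr ob.M.minus_add ob.M.a_ac)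
  next
    fix x j assume x: "x \<in> hcomp (obj D i) j"
    interpret D: graded_module R G "obj D i" by (rule D_gm)
    obtain a b where ab: "a \<in> carrier (obj C i)" "b \<in> carrier (obj C (i - 1))" "x = pr i a b"
      using pr_cases D.gr.homog_carrier[OF x] by blast
    have h: "a \<in> hcomp (obj C i) j" "b \<in> hcomp (obj C (i - 1)) (j - 1)"
      using x pr_homog[OF ab(1,2)] ab(3) by auto
    note cl = cone_diff_closed[OF ab(1,2)]
    have "diff C i a \<oplus>\<^bsub>obj C (i - 1)\<^esub> w \<odot>\<^bsub>obj C (i - 1)\<^esub> b \<in> hcomp (obj C (i - 1)) j"
      using ob.gr.homog_add[OF d_homog[OF h(1)]] w_homog[OF h(2)] by simp
    moreover have "\<ominus>\<^bsub>obj C (i - 2)\<^esub> diff C (i - 1) b \<in> hcomp (obj C (i - 2)) (j - 1)"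
      using ob.gr.homog_neg[OF d_homog[OF h(2)]] by simp
    ultimately show "diff D i x \<in> hcomp (obj D (i - 1)) j"
      unfolding ab(3) pr_diff[OF ab(1,2)] using pr_homog[of _ "i - 1"] cl by simp
  qed
  fix x assume "x \<in> carrier (obj D i)"
  then obtain a b where ab: "a \<in> carrier (obj C i)" "b \<in> carrier (obj C (i - 1))" "x = pr i a b"
    using pr_cases by blast
  note cl = cone_diff_closed[OF ab(1,2)]
  have c2: "w \<odot>\<^bsub>obj C (i - 2)\<^esub> diff C (i - 1) b \<in> carrier (obj C (i - 2))"
    using d_closed2[OF ab(2)] by simp
  \<comment> \<open>The two terms with \<open>w\<close> cancel thanks to the sign in
    \<open>pr_diff\<close>.\<close>
  have "diff C (i - 1) (diff C i a \<oplus>\<^bsub>obj C (i - 1)\<^esub> w \<odot>\<^bsub>obj C (i - 1)\<^esub> b) \<oplus>\<^bsub>obj C (i - 2)\<^esub>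
      w \<odot>\<^bsub>obj C (i - 2)\<^esub> (\<ominus>\<^bsub>obj C (i - 2)\<^esub> diff C (i - 1) b) = \<zero>\<^bsub>obj C (i - 2)\<^esub>"
    using ab d_closed2[OF ab(2)] c2 d_add[of "diff C i a" "i - 1"] d_d[OF ab(1)]
      d_smult[OF w_carrier ab(2)]
    by (simp add: ob.smult_r_minus ob.M.r_neg)
  moreover have "\<ominus>\<^bsub>obj C (i - 1 - 2)\<^esub> diff C (i - 1 - 1) (\<ominus>\<^bsub>obj C (i - 2)\<^esub> diff C (i - 1) b) = \<zero>\<^bsub>obj C (i - 1 - 2)\<^esub>"
    using d_neg[OF d_closed2[OF ab(2)]] d_d[OF ab(2)] by simp
  ultimately show "diff D (i - 1) (diff D i x) = \<zero>\<^bsub>obj D (i - 2)\<^esub>"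
    using ab cl pr_diff[of _ "i - 1"] pr_diff[OF ab(1,2)] pr_zero[of "i - 2"] by simp
qed

text \<open>Exactness in the middle of H_i(C)_j, H_i(D)_j, H_(i-1)(C)_(j-1). Both outer bidegrees
  have the same difference j - i, which is why a bound on it passes from \<open>C\<close> to
  \<open>D\<close>.\<close>

lemma exact_cone:
  assumes e1: "exact_at C i j" and e2: "exact_at C (i - 1) (j - 1)"
  shows "exact_at D i j"
  unfolding exact_at_def
proof (intro ballI impI)
  interpret D: graded_module R G "obj D i" by (rule D_gm)
  fix x assume x: "x \<in> hcomp (obj D i) j" and dx: "diff D i x = \<zero>\<^bsub>obj D (i - 1)\<^esub>"
  obtain a b where ab: "a \<in> carrier (obj C i)" "b \<in> carrier (obj C (i - 1))" "x = pr i a b"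
    using pr_cases D.gr.homog_carrier[OF x] by blast
  note cl = cone_diff_closed[OF ab(1,2)]
  have h: "a \<in> hcomp (obj C i) j" "b \<in> hcomp (obj C (i - 1)) (j - 1)"
    using x pr_homog[OF ab(1,2)] ab(3) by auto
  have da: "diff C i a \<oplus>\<^bsub>obj C (i - 1)\<^esub> w \<odot>\<^bsub>obj C (i - 1)\<^esub> b = \<zero>\<^bsub>obj C (i - 1)\<^esub>"
    and "\<ominus>\<^bsub>obj C (i - 2)\<^esub> diff C (i - 1) b = \<zero>\<^bsub>obj C (i - 2)\<^esub>"
    using dx cl pr_inj[of _ "i - 1"] unfolding ab(3) pr_diff[OF ab(1,2)] pr_zero by auto
  then have db: "diff C (i - 1) b = \<zero>\<^bsub>obj C (i - 2)\<^esub>"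
    using ob.M.add.inv_eq_1_iff[OF d_closed2[OF ab(2)]] by simp
  then obtain b' where b': "b' \<in> hcomp (obj C i) (j - 1)" "diff C i b' = b"
    using e2 h(2) unfolding exact_at_def by auto
  have b'c: "b' \<in> carrier (obj C i)" using ob.gr.homog_carrier[OF b'(1)] .
  \<comment> \<open>A chain \<open>b'\<close> with boundary \<open>b\<close> corrects
    \<open>a\<close> to a cycle.\<close>
  have "diff C i (a \<oplus>\<^bsub>obj C i\<^esub> w \<odot>\<^bsub>obj C i\<^esub> b') = \<zero>\<^bsub>obj C (i - 1)\<^esub>"
    using da ab(1) b'c b'(2) by (simp add: d_add d_smult)
  moreover have "a \<oplus>\<^bsub>obj C i\<^esub> w \<odot>\<^bsub>obj C i\<^esub> b' \<in> hcomp (obj C i) j"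
    using ob.gr.homog_add[OF h(1)] w_homog[OF b'(1)] by simp
  ultimately obtain a' where a': "a' \<in> hcomp (obj C (i + 1)) j"
    "diff C (i + 1) a' = a \<oplus>\<^bsub>obj C i\<^esub> w \<odot>\<^bsub>obj C i\<^esub> b'"
    using e1 unfolding exact_at_def by blast
  have a'c: "a' \<in> carrier (obj C (i + 1))" using ob.gr.homog_carrier[OF a'(1)] .
  have nb: "\<ominus>\<^bsub>obj C i\<^esub> b' \<in> carrier (obj C (i + 1 - 1))" using b'c by simp
  have "pr (i + 1) a' (\<ominus>\<^bsub>obj C i\<^esub> b') \<in> hcomp (obj D (i + 1)) j"
    using pr_homog[OF a'c nb] a'(1) ob.gr.homog_neg[OF b'(1)] by simp
  moreover have "diff D (i + 1) (pr (i + 1) a' (\<ominus>\<^bsub>obj C i\<^esub> b')) = x"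
    using pr_diff[OF a'c nb] a'(2) ab b'(2) b'c d_neg[OF b'c]
    by (simp add: ob.smult_r_minus ob.M.add_neg_cancel)
  ultimately show "\<exists>u\<in>hcomp (obj D (i + 1)) j. diff D (i + 1) u = x" by blast
qed

text \<open>If \<open>w z\<close> is the boundary of \<open>c\<close>, then the pair of
  \<open>- c\<close> and \<open>z\<close> is a cycle of \<open>D\<close> in bidegree (i + 1, j + 1),
  where the difference is again j - i. The second coordinate of a chain bounding it has boundary
  \<open>- z\<close>.\<close>

lemma mult_injective_of_exact_cone:
  assumes e: "exact_at D (i + 1) (j + 1)"
    and z: "z \<in> hcomp (obj C i) j" "diff C i z = \<zero>\<^bsub>obj C (i - 1)\<^esub>"
    and c: "c \<in> hcomp (obj C (i + 1)) (j + 1)" "diff C (i + 1) c = w \<odot>\<^bsub>obj C i\<^esub> z"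
  shows "\<exists>u\<in>hcomp (obj C (i + 1)) j. diff C (i + 1) u = z"
proof -
  interpret D: graded_module R G "obj D (i + 2)" by (rule D_gm)
  have zc: "z \<in> carrier (obj C (i + 1 - 1))" and cc: "c \<in> carrier (obj C (i + 1))"
    using ob.gr.homog_carrier[OF z(1)] ob.gr.homog_carrier[OF c(1)] by auto
  let ?x = "pr (i + 1) (\<ominus>\<^bsub>obj C (i + 1)\<^esub> c) z"
  have nc: "\<ominus>\<^bsub>obj C (i + 1)\<^esub> c \<in> carrier (obj C (i + 1))" using cc by simp
  have "?x \<in> hcomp (obj D (i + 1)) (j + 1)"
    using pr_homog[OF nc zc] ob.gr.homog_neg[OF c(1)] z(1) by simp
  moreover have "diff D (i + 1) ?x = \<zero>\<^bsub>obj D (i + 1 - 1)\<^esub>"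
    using pr_diff[OF nc zc] d_neg[OF cc] c(2) z(2) zc pr_zero[of i] by (simp add: ob.M.l_neg)
  ultimately obtain u where u: "u \<in> hcomp (obj D (i + 1 + 1)) (j + 1)"
    "diff D (i + 1 + 1) u = ?x"
    using e unfolding exact_at_def by blast
  then have u: "u \<in> hcomp (obj D (i + 2)) (j + 1)" "diff D (i + 2) u = ?x" by (simp_all add: add.assoc)
  obtain a b where ab: "a \<in> carrier (obj C (i + 2))" "b \<in> carrier (obj C (i + 2 - 1))" "u = pr (i + 2) a b"
    using pr_cases[OF D.gr.homog_carrier[OF u(1)]] by blast
  have idx: "i + 2 - 1 = i + 1" "i + 2 - 2 = i" by simp_all
  have bh: "b \<in> hcomp (obj C (i + 1)) j"
    using u(1) pr_homog[OF ab(1,2), unfolded idx, of "j + 1"] ab(3) by simp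
  have "\<ominus>\<^bsub>obj C i\<^esub> diff C (i + 1) b = z"
    using u(2) pr_diff[OF ab(1,2), unfolded idx] ab(3) cone_diff_closed[OF ab(1,2), unfolded idx]
      pr_inj[OF _ _ nc zc] by simp
  then have "diff C (i + 1) (\<ominus>\<^bsub>obj C (i + 1)\<^esub> b) = z"
    using d_neg[OF ab(2)[unfolded idx]] by simp
  then show ?thesis using ob.gr.homog_neg[OF bh] by blast
qed

text \<open>Induction on \<open>t\<close> with \<open>w z\<close> in place of \<open>z\<close>: it
  sits in internal degree j + 1, still above the bound, and one power of \<open>w\<close> fewer
  makes it a boundary. So \<open>w z\<close> is a boundary, and
  \<open>mult_injective_of_exact_cone\<close> cancels the factor \<open>w\<close>.\<close>

lemma torsion_exact_of_exact_cone:
  assumes e: "\<And>i j. j - i > r \<Longrightarrow> exact_at D i j"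
    and "z \<in> hcomp (obj C i) j" "diff C i z = \<zero>\<^bsub>obj C (i - 1)\<^esub>" "j - i > r"
    and "\<exists>c\<in>hcomp (obj C (i + 1)) (j + int t). diff C (i + 1) c = (w [^] t) \<odot>\<^bsub>obj C i\<^esub> z"
  shows "\<exists>u\<in>hcomp (obj C (i + 1)) j. diff C (i + 1) u = z"
  using assms(2-5)
proof (induction t arbitrary: z j)
  case 0
  then show ?case using ob.gr.homog_carrier[OF 0(1)] by simp
next
  case (Suc t)
  have zc: "z \<in> carrier (obj C i)" using ob.gr.homog_carrier[OF Suc.prems(1)] .
  have "\<exists>u\<in>hcomp (obj C (i + 1)) (j + 1). diff C (i + 1) u = w \<odot>\<^bsub>obj C i\<^esub> z"
  proof (rule Suc.IH)
    show "w \<odot>\<^bsub>obj C i\<^esub> z \<in> hcomp (obj C i) (j + 1)" by (rule w_homog[OF Suc.prems(1)])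
    show "diff C i (w \<odot>\<^bsub>obj C i\<^esub> z) = \<zero>\<^bsub>obj C (i - 1)\<^esub>"
      using d_smult[OF w_carrier zc] Suc.prems(2) by simp
    show "\<exists>c\<in>hcomp (obj C (i + 1)) (j + 1 + int t).
        diff C (i + 1) c = (w [^] t) \<odot>\<^bsub>obj C i\<^esub> (w \<odot>\<^bsub>obj C i\<^esub> z)"
      using Suc.prems(4) zc by (simp add: ob.smult_assoc1[symmetric] add.assoc)
  qed (use Suc.prems in simp)
  then show ?case
    using mult_injective_of_exact_cone[OF e Suc.prems(1,2)] Suc.prems(3) by auto
qed

end

section \<open>Splitting off the last Koszul variable\<close>

lemma (in standard_graded_algebra) koszul_sign_closed [simp]: "koszul_sign R p \<in> carrier R"
  by (simp add: koszul_sign_def)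

lemma (in graded_module) koszul_sign_smult:
  assumes "x \<in> carrier M"
  shows "koszul_sign R p \<odot>\<^bsub>M\<^esub> x = (if even p then x else \<ominus>\<^bsub>M\<^esub> x)"
proof (induction p)
  case (Suc p)
  have "koszul_sign R (Suc p) \<odot>\<^bsub>M\<^esub> x = koszul_sign R p \<odot>\<^bsub>M\<^esub> ((\<ominus> \<one>) \<odot>\<^bsub>M\<^esub> x)"
    using assms by (simp add: koszul_sign_def smult_assoc1)
  also have "(\<ominus> \<one>) \<odot>\<^bsub>M\<^esub> x = \<ominus>\<^bsub>M\<^esub> x"
    using assms by (simp add: smult_l_minus)
  finally show ?case
    using assms Suc smult_r_minus[of "koszul_sign R p" x] by (simp add: koszul_sign_def)
qed (use assms in \<open>simp add: koszul_sign_def\<close>)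

text \<open>The sign turns the last Koszul variable into a mapping cone without any further signs.\<close>

definition koszul_pair ::
  "'r ring \<Rightarrow> nat \<Rightarrow> ('r, 'm) gcomplex \<Rightarrow> int \<Rightarrow> (nat set \<Rightarrow> 'm) \<Rightarrow> (nat set \<Rightarrow> 'm) \<Rightarrow> nat set \<Rightarrow> 'm"
  where
  "koszul_pair R n M i a b =
     (\<lambda>S\<in>Pow {0..<Suc n}.
        if n \<in> S then koszul_sign R (card S - 1) \<odot>\<^bsub>obj M (i - int (card S))\<^esub> b (S - {n}) else a S)"

lemma koszul_obj_simps [simp]:
  "carrier (koszul_obj n M i) = (\<Pi>\<^sub>E S\<in>Pow {0..<n}. carrier (obj M (i - int (card S))))"
  "zero (koszul_obj n M i) = (\<lambda>S\<in>Pow {0..<n}. \<zero>\<^bsub>obj M (i - int (card S))\<^esub>)"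
  "add (koszul_obj n M i) u v = (\<lambda>S\<in>Pow {0..<n}. u S \<oplus>\<^bsub>obj M (i - int (card S))\<^esub> v S)"
  "smult (koszul_obj n M i) r u = (\<lambda>S\<in>Pow {0..<n}. r \<odot>\<^bsub>obj M (i - int (card S))\<^esub> u S)"
  "hcomp (koszul_obj n M i) j =
     (\<Pi>\<^sub>E S\<in>Pow {0..<n}. hcomp (obj M (i - int (card S))) (j - int (card S)))"
  by (simp_all add: koszul_obj_def)

lemma koszul_simps [simp]:
  "obj (koszul R xs M) = koszul_obj (length xs) M" "diff (koszul R xs M) = koszul_diff R xs M"
  by (simp_all add: koszul_def)

lemma koszul_pair_low:
  "S \<subseteq> {0..<n} \<Longrightarrow> koszul_pair R n M i a b S = a S"
  by (auto simp: koszul_pair_def)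

lemma koszul_pair_high:
  assumes "T \<subseteq> {0..<n}"
  shows "koszul_pair R n M i a b (insert n T) =
    koszul_sign R (card T) \<odot>\<^bsub>obj M (i - 1 - int (card T))\<^esub> b T"
proof -
  have "n \<notin> T" using assms by auto
  moreover have "finite T" using assms by (rule finite_subset) simp
  ultimately show ?thesis
    using assms by (auto simp: koszul_pair_def diff_diff_eq)
qed

lemma koszul_pair_extensional [simp]: "koszul_pair R n M i a b \<in> extensional (Pow {0..<Suc n})"
  by (simp add: koszul_pair_def)

text \<open>The subsets without \<open>n\<close> carry the first cone coordinate, those with
  \<open>n\<close> the second.\<close>

lemma ball_Pow_Suc:
  "(\<forall>S\<in>Pow {0..<Suc n}. P S) \<longleftrightarrow>
     (\<forall>S\<subseteq>{0..<n}. P S) \<and> (\<forall>T\<subseteq>{0..<n}. P (insert n T))"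
proof -
  have "Pow {0..<Suc n} = Pow {0..<n} \<union> insert n ` Pow {0..<n}"
    by (simp add: atLeast0_lessThan_Suc Pow_insert)
  then show ?thesis by auto
qed

lemma Pow_Suc_ext:
  assumes "u \<in> extensional (Pow {0..<Suc n})" "v \<in> extensional (Pow {0..<Suc n})"
    and "\<And>S. S \<subseteq> {0..<n} \<Longrightarrow> u S = v S" "\<And>T. T \<subseteq> {0..<n} \<Longrightarrow> u (insert n T) = v (insert n T)"
  shows "u = v"
proof (rule extensionalityI[OF assms(1,2)])
  show "u S = v S" if "S \<in> Pow {0..<Suc n}" for S
    using assms(3,4) ball_Pow_Suc[of n "\<lambda>S. u S = v S"] that by blast
qed

lemma card_insert_bound:
  fixes n :: nat
  assumes "T \<subseteq> {0..<n}"
  shows "card (insert n T) = Suc (card T)"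
proof -
  have "n \<notin> T" using assms by auto
  moreover have "finite T" using assms by (rule finite_subset) simp
  ultimately show ?thesis by simp
qed

context graded_cx
begin

lemma koszul_memD:
  "u \<in> carrier (koszul_obj n C i) \<Longrightarrow> S \<subseteq> {0..<n} \<Longrightarrow> u S \<in> carrier (obj C (i - int (card S)))"
  by auto

lemma a_inv_koszul_obj:
  assumes "u \<in> carrier (koszul_obj n C i)"
  shows "\<ominus>\<^bsub>koszul_obj n C i\<^esub> u = (\<lambda>S\<in>Pow {0..<n}. \<ominus>\<^bsub>obj C (i - int (card S))\<^esub> u S)"
  using assms unfolding koszul_obj_eq_gprod by (rule a_inv_gprod[OF obj_gm])

lemma koszul_diff_extensional [simp]:
  "koszul_diff R xs C i u \<in> extensional (Pow {0..<length xs})"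
  by (simp add: koszul_diff_def)

text \<open>Both sides are compared on \<open>T\<close> and on \<open>insert n T\<close>. On
  \<open>T\<close>, the summands below \<open>n\<close> and the internal differential give the
  differential of \<open>a\<close>, and the summand \<open>n\<close> gives \<open>w b\<close>. On
  \<open>insert n T\<close>, up to the sign built into \<open>koszul_pair\<close>, every term is the
  negative of one in the differential of \<open>b\<close>. The hypothesis \<open>db\<close> makes
  negation in \<open>koszul_obj\<close> computable; it is available because the shorter Koszul
  complex is already known to be a complex.\<close>

lemma koszul_diff_pair:
  assumes a: "a \<in> carrier (koszul_obj n C i)" and b: "b \<in> carrier (koszul_obj n C (i - 1))"
    and xs: "set xs \<subseteq> carrier R" "w \<in> carrier R" and n: "length xs = n"
    and db: "koszul_diff R xs C (i - 1) b \<in> carrier (koszul_obj n C (i - 1 - 1))"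
  shows "koszul_diff R (xs @ [w]) C i (koszul_pair R n C i a b) =
    koszul_pair R n C (i - 1)
      (koszul_diff R xs C i a \<oplus>\<^bsub>koszul_obj n C (i - 1)\<^esub> w \<odot>\<^bsub>koszul_obj n C (i - 1)\<^esub> b)
      (\<ominus>\<^bsub>koszul_obj n C (i - 1 - 1)\<^esub> koszul_diff R xs C (i - 1) b)" (is "?L = ?R")
proof (rule Pow_Suc_ext[of _ n])
  show "?L \<in> extensional (Pow {0..<Suc n})"
    using koszul_diff_extensional[of "xs @ [w]"] n by simp
  show "?R \<in> extensional (Pow {0..<Suc n})" by simp
  have x: "xs ! s \<in> carrier R" if "s < n" for s
    using xs(1) n that by auto
  fix T assume T: "T \<subseteq> {0..<n}"
  then have fin: "finite T" using finite_subset by auto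
  let ?c = "card T"
  have aT: "a T \<in> carrier (obj C (i - int ?c))" and bT: "b T \<in> carrier (obj C (i - 1 - int ?c))"
    using koszul_memD[OF a T] koszul_memD[OF b T] .
  show "?L T = ?R T"
  proof -
    let ?N = "obj C (i - 1 - int ?c)"
    let ?f = "\<lambda>s. (koszul_sign R (card {t \<in> T. t < s}) \<otimes> xs ! s) \<odot>\<^bsub>?N\<^esub> a (insert s T)"
    let ?g = "\<lambda>s. (koszul_sign R (card {t \<in> T. t < s}) \<otimes> (xs @ [w]) ! s) \<odot>\<^bsub>?N\<^esub>
        koszul_pair R n C i a b (insert s T)"
    have set: "{0..<Suc n} - T = insert n ({0..<n} - T)" using T by auto
    have aS: "a (insert s T) \<in> carrier ?N" if "s \<in> {0..<n} - T" for s
      using koszul_memD[OF a, of "insert s T"] that T fin by (simp add: diff_diff_eq)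
    have gf: "?g s = ?f s" if "s \<in> {0..<n} - T" for s
      using that T n by (simp add: koszul_pair_low nth_append)
    have f: "?f \<in> {0..<n} - T \<rightarrow> carrier ?N" using aS x by auto
    \<comment> \<open>All of \<open>T\<close> lies below \<open>n\<close>, so the sign of the
      summand \<open>n\<close> equals the one in \<open>koszul_pair\<close> and the two
      cancel.\<close>
    have "{t \<in> T. t < n} = T" using T by auto
    then have gn: "?g n = w \<odot>\<^bsub>?N\<^esub> b T"
      using T n xs(2) bT by (simp add: koszul_pair_high nth_append ob.smult_assoc1
          ob.koszul_sign_smult ob.smult_r_minus)
    have "finsum ?N ?g ({0..<Suc n} - T) = ?g n \<oplus>\<^bsub>?N\<^esub> finsum ?N ?g ({0..<n} - T)"
      unfolding set
      by (rule ob.M.finsum_insert) (use f gf gn xs(2) bT in auto)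
    also have "finsum ?N ?g ({0..<n} - T) = finsum ?N ?f ({0..<n} - T)"
      by (rule ob.M.finsum_cong') (use f gf in auto)
    finally have "finsum ?N ?g ({0..<Suc n} - T) = w \<odot>\<^bsub>?N\<^esub> b T \<oplus>\<^bsub>?N\<^esub> finsum ?N ?f ({0..<n} - T)"
      unfolding gn .
    moreover have "finsum ?N ?f ({0..<n} - T) \<in> carrier ?N" using f by simp
    moreover have "koszul_sign R ?c \<odot>\<^bsub>?N\<^esub> diff C (i - int ?c) (a T) \<in> carrier ?N"
      using d_closed[OF aT] by (simp add: algebra_simps)
    moreover have "T \<subseteq> {0..<Suc n}" using T by auto
    ultimately show ?thesis
      using T n xs(2) bT
      by (auto simp: koszul_diff_def Let_def koszul_pair_low ob.M.a_ac)
  qed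
  show "?L (insert n T) = ?R (insert n T)"
  proof -
    have T': "T \<subseteq> {0..<Suc n}" using T by auto
    \<comment> \<open>One name for an index that occurs in several arithmetically equal
      forms.\<close>
    define m where "m = i - 2 - int ?c"
    have idx: "i - 1 - int (Suc ?c) = m" "i - int (Suc ?c) = m + 1" "i - 1 - int ?c = m + 1"
      "i - 1 - 1 - int ?c = m" "i - (1 + int ?c) = m + 1"
      by (simp_all add: m_def)
    let ?N = "obj C m"
    let ?f = "\<lambda>s. (koszul_sign R (card {t \<in> T. t < s}) \<otimes> xs ! s) \<odot>\<^bsub>?N\<^esub> b (insert s T)"
    let ?g = "\<lambda>s. (koszul_sign R (card {t \<in> insert n T. t < s}) \<otimes> (xs @ [w]) ! s) \<odot>\<^bsub>?N\<^esub>
        koszul_pair R n C i a b (insert s (insert n T))"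
    have set: "{0..<Suc n} - insert n T = {0..<n} - T" using T by auto
    have bT': "b T \<in> carrier (obj C (m + 1))" using bT idx by simp
    have bS: "b (insert s T) \<in> carrier ?N" if "s \<in> {0..<n} - T" for s
      using koszul_memD[OF b, of "insert s T"] that T fin idx(1) by simp
    have f: "?f \<in> {0..<n} - T \<rightarrow> carrier ?N" using bS x by auto
    have gf: "?g s = koszul_sign R (Suc ?c) \<odot>\<^bsub>?N\<^esub> ?f s" if s: "s \<in> {0..<n} - T" for s
    proof -
      \<comment> \<open>The element \<open>n\<close> is not below \<open>s\<close>, so the Koszul
        sign of the summand \<open>s\<close> is unchanged; the extra factor comes from
        \<open>koszul_pair\<close>, as \<open>insert s T\<close> has one element more than
        \<open>T\<close>.\<close>
      have "{t \<in> insert n T. t < s} = {t \<in> T. t < s}" using s by auto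
      moreover have "koszul_pair R n C i a b (insert s (insert n T)) =
          koszul_sign R (Suc ?c) \<odot>\<^bsub>?N\<^esub> b (insert s T)"
        using koszul_pair_high[of "insert s T" n R C i a b] s T fin idx(1)
        by (simp add: insert_commute)
      ultimately show ?thesis
        using s n bS[OF s] x[of s]
        by (simp add: nth_append ob.smult_assoc1[symmetric] m_ac)
    qed
    have g: "finsum ?N ?g ({0..<n} - T) = koszul_sign R (Suc ?c) \<odot>\<^bsub>?N\<^esub> finsum ?N ?f ({0..<n} - T)"
    proof -
      have "finsum ?N ?g ({0..<n} - T) = finsum ?N (\<lambda>s. koszul_sign R (Suc ?c) \<odot>\<^bsub>?N\<^esub> ?f s) ({0..<n} - T)"
        by (rule ob.M.finsum_cong') (use gf f in auto)
      also have "\<dots> = koszul_sign R (Suc ?c) \<odot>\<^bsub>?N\<^esub> finsum ?N ?f ({0..<n} - T)"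
        by (rule ob.finsum_smult_ldistr[symmetric]) (use f in auto)
      finally show ?thesis .
    qed
    have fs: "finsum ?N ?f ({0..<n} - T) \<in> carrier ?N" using f by simp
    have dbT: "diff C (m + 1) (b T) \<in> carrier ?N" by (rule d_up_closed[OF bT'])
    have "?L (insert n T) = finsum ?N ?g ({0..<n} - T) \<oplus>\<^bsub>?N\<^esub>
        koszul_sign R (Suc ?c) \<odot>\<^bsub>?N\<^esub> diff C (m + 1) (koszul_sign R ?c \<odot>\<^bsub>obj C (m + 1)\<^esub> b T)"
      using T T' n set
      by (simp add: koszul_diff_def Let_def card_insert_bound idx koszul_pair_high del: of_nat_Suc)
    also have "\<dots> = koszul_sign R ?c \<odot>\<^bsub>?N\<^esub> (\<ominus>\<^bsub>?N\<^esub> (finsum ?N ?f ({0..<n} - T) \<oplus>\<^bsub>?N\<^esub>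
        koszul_sign R ?c \<odot>\<^bsub>?N\<^esub> diff C (m + 1) (b T)))"
      unfolding g using fs dbT bT' d_neg[OF bT']
      by (simp add: ob.koszul_sign_smult ob.M.minus_add)
    also have "\<dots> = ?R (insert n T)"
    proof -
      have "(\<ominus>\<^bsub>koszul_obj n C (i - 1 - 1)\<^esub> koszul_diff R xs C (i - 1) b) T =
          \<ominus>\<^bsub>obj C (i - 1 - 1 - int ?c)\<^esub> (koszul_diff R xs C (i - 1) b T)"
        by (simp only: a_inv_koszul_obj[OF db] restrict_apply if_P[OF PowI[OF T]])
      moreover have "koszul_diff R xs C (i - 1) b T =
          finsum ?N ?f ({0..<n} - T) \<oplus>\<^bsub>?N\<^esub> koszul_sign R ?c \<odot>\<^bsub>?N\<^esub> diff C (m + 1) (b T)"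
        by (simp only: koszul_diff_def Let_def n restrict_apply if_P[OF PowI[OF T]] idx)
      ultimately show ?thesis by (simp only: koszul_pair_high[OF T] idx)
    qed
    finally show ?thesis .
  qed
qed

end

lemma PiE_Pow_Suc_iff:
  "u \<in> (\<Pi>\<^sub>E S\<in>Pow {0..<Suc n}. A S) \<longleftrightarrow> u \<in> extensional (Pow {0..<Suc n}) \<and>
     (\<forall>S\<subseteq>{0..<n}. u S \<in> A S) \<and> (\<forall>T\<subseteq>{0..<n}. u (insert n T) \<in> A (insert n T))"
  using ball_Pow_Suc[of n "\<lambda>S. u S \<in> A S"] by (auto simp: PiE_iff)

lemma const_fun_eq_iff: "(\<lambda>T\<in>{{} :: nat set}. x) = (\<lambda>T\<in>{{}}. y) \<longleftrightarrow> x = y"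
  by (auto simp: fun_eq_iff)

context graded_cx
begin

lemma koszul_sign_homog_iff:
  assumes "x \<in> carrier (obj C l)"
  shows "koszul_sign R p \<odot>\<^bsub>obj C l\<^esub> x \<in> hcomp (obj C l) j \<longleftrightarrow> x \<in> hcomp (obj C l) j"
  using assms ob.gr.homog_neg[of "\<ominus>\<^bsub>obj C l\<^esub> x" l j] ob.gr.homog_neg[of x l j]
  by (auto simp: ob.koszul_sign_smult)

lemma koszul_sign_inj:
  assumes "x \<in> carrier (obj C l)" "y \<in> carrier (obj C l)"
  shows "koszul_sign R p \<odot>\<^bsub>obj C l\<^esub> x = koszul_sign R p \<odot>\<^bsub>obj C l\<^esub> y \<longleftrightarrow> x = y"
  using assms ob.M.a_inv_inj[of l] by (auto simp: ob.koszul_sign_smult inj_on_def)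

lemma degree_insert_last:
  fixes n :: nat
  assumes "T \<subseteq> {0..<n}"
  shows "i - int (card (insert n T)) = i - 1 - int (card T)"
  using card_insert_bound[OF assms] by simp

lemma koszul_pair_closed:
  assumes a: "a \<in> carrier (koszul_obj n C i)" and b: "b \<in> carrier (koszul_obj n C (i - 1))"
  shows "koszul_pair R n C i a b \<in> carrier (koszul_obj (Suc n) C i)"
proof -
  have "a S \<in> carrier (obj C (i - int (card S)))" "b S \<in> carrier (obj C (i - 1 - int (card S)))"
    if "S \<subseteq> {0..<n}" for S
    using koszul_memD[OF a that] koszul_memD[OF b that] .
  then show ?thesis
    unfolding koszul_obj_simps PiE_Pow_Suc_iff
    by (simp add: koszul_pair_low koszul_pair_high degree_insert_last)
qed

lemma koszul_pair_homog:
  assumes a: "a \<in> carrier (koszul_obj n C i)" and b: "b \<in> carrier (koszul_obj n C (i - 1))"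
  shows "koszul_pair R n C i a b \<in> hcomp (koszul_obj (Suc n) C i) j \<longleftrightarrow>
    a \<in> hcomp (koszul_obj n C i) j \<and> b \<in> hcomp (koszul_obj n C (i - 1)) (j - 1)"
proof -
  have "a S \<in> carrier (obj C (i - int (card S)))" "b S \<in> carrier (obj C (i - 1 - int (card S)))"
    if "S \<subseteq> {0..<n}" for S
    using koszul_memD[OF a that] koszul_memD[OF b that] .
  moreover have "a \<in> extensional (Pow {0..<n})" "b \<in> extensional (Pow {0..<n})"
    using a b by (auto simp: PiE_iff)
  ultimately show ?thesis
    unfolding koszul_obj_simps PiE_Pow_Suc_iff
    by (simp add: koszul_pair_low koszul_pair_high degree_insert_last koszul_sign_homog_iff PiE_iff Ball_def)
qed

lemma koszul_pair_inj:
  assumes a: "a \<in> carrier (koszul_obj n C i)" and b: "b \<in> carrier (koszul_obj n C (i - 1))"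
    and a': "a' \<in> carrier (koszul_obj n C i)" and b': "b' \<in> carrier (koszul_obj n C (i - 1))"
  shows "koszul_pair R n C i a b = koszul_pair R n C i a' b' \<longleftrightarrow> a = a' \<and> b = b'"
proof
  assume eq: "koszul_pair R n C i a b = koszul_pair R n C i a' b'"
  have "a S = a' S" if "S \<in> Pow {0..<n}" for S
    using fun_cong[OF eq, of S] that by (simp add: koszul_pair_low)
  moreover have "b S = b' S" if "S \<in> Pow {0..<n}" for S
    using fun_cong[OF eq, of "insert n S"] that koszul_memD[OF b, of S] koszul_memD[OF b', of S]
    by (simp add: koszul_pair_high koszul_sign_inj)
  ultimately show "a = a' \<and> b = b'"
    by (intro conjI PiE_cong_eqI[OF a[unfolded koszul_obj_simps] a'[unfolded koszul_obj_simps]]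
        PiE_cong_eqI[OF b[unfolded koszul_obj_simps] b'[unfolded koszul_obj_simps]])
qed simp

lemma koszul_pair_add:
  assumes a: "a \<in> carrier (koszul_obj n C i)" and b: "b \<in> carrier (koszul_obj n C (i - 1))"
    and a': "a' \<in> carrier (koszul_obj n C i)" and b': "b' \<in> carrier (koszul_obj n C (i - 1))"
  shows "koszul_pair R n C i a b \<oplus>\<^bsub>koszul_obj (Suc n) C i\<^esub> koszul_pair R n C i a' b' =
    koszul_pair R n C i (a \<oplus>\<^bsub>koszul_obj n C i\<^esub> a') (b \<oplus>\<^bsub>koszul_obj n C (i - 1)\<^esub> b')"
proof (rule Pow_Suc_ext[of _ n])
  fix T assume T: "T \<subseteq> {0..<n}"
  then have T': "T \<subseteq> {0..<Suc n}" by auto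
  show "(koszul_pair R n C i a b \<oplus>\<^bsub>koszul_obj (Suc n) C i\<^esub> koszul_pair R n C i a' b') T =
    koszul_pair R n C i (a \<oplus>\<^bsub>koszul_obj n C i\<^esub> a') (b \<oplus>\<^bsub>koszul_obj n C (i - 1)\<^esub> b') T"
    using T T' by (simp add: koszul_pair_low)
  show "(koszul_pair R n C i a b \<oplus>\<^bsub>koszul_obj (Suc n) C i\<^esub> koszul_pair R n C i a' b') (insert n T) =
    koszul_pair R n C i (a \<oplus>\<^bsub>koszul_obj n C i\<^esub> a') (b \<oplus>\<^bsub>koszul_obj n C (i - 1)\<^esub> b') (insert n T)"
    using T T' koszul_memD[OF b T] koszul_memD[OF b' T]
    by (simp add: koszul_pair_high degree_insert_last ob.smult_r_distr)
qed simp_all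

lemma koszul_pair_smult:
  assumes r: "r \<in> carrier R"
    and a: "a \<in> carrier (koszul_obj n C i)" and b: "b \<in> carrier (koszul_obj n C (i - 1))"
  shows "r \<odot>\<^bsub>koszul_obj (Suc n) C i\<^esub> koszul_pair R n C i a b =
    koszul_pair R n C i (r \<odot>\<^bsub>koszul_obj n C i\<^esub> a) (r \<odot>\<^bsub>koszul_obj n C (i - 1)\<^esub> b)"
proof (rule Pow_Suc_ext[of _ n])
  fix T assume T: "T \<subseteq> {0..<n}"
  then have T': "T \<subseteq> {0..<Suc n}" by auto
  show "(r \<odot>\<^bsub>koszul_obj (Suc n) C i\<^esub> koszul_pair R n C i a b) T =
    koszul_pair R n C i (r \<odot>\<^bsub>koszul_obj n C i\<^esub> a) (r \<odot>\<^bsub>koszul_obj n C (i - 1)\<^esub> b) T"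
    using T T' by (simp add: koszul_pair_low)
  show "(r \<odot>\<^bsub>koszul_obj (Suc n) C i\<^esub> koszul_pair R n C i a b) (insert n T) =
    koszul_pair R n C i (r \<odot>\<^bsub>koszul_obj n C i\<^esub> a) (r \<odot>\<^bsub>koszul_obj n C (i - 1)\<^esub> b) (insert n T)"
    using T T' r koszul_memD[OF b T]
    by (simp add: koszul_pair_high degree_insert_last ob.koszul_sign_smult ob.smult_r_minus)
qed simp_all

lemma koszul_pair_cases:
  assumes x: "x \<in> carrier (koszul_obj (Suc n) C i)"
  shows "\<exists>a b. a \<in> carrier (koszul_obj n C i) \<and> b \<in> carrier (koszul_obj n C (i - 1)) \<and>
    x = koszul_pair R n C i a b"
proof (intro exI conjI)
  let ?a = "\<lambda>S\<in>Pow {0..<n}. x S"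
  \<comment> \<open>The sign is its own inverse, so applying it again recovers the second
    coordinate.\<close>
  let ?b = "\<lambda>T\<in>Pow {0..<n}. koszul_sign R (card T) \<odot>\<^bsub>obj C (i - 1 - int (card T))\<^esub> x (insert n T)"
  have lo: "x S \<in> carrier (obj C (i - int (card S)))"
    and hi: "x (insert n S) \<in> carrier (obj C (i - 1 - int (card S)))" if "S \<subseteq> {0..<n}" for S
    using x that unfolding koszul_obj_simps PiE_Pow_Suc_iff by (simp_all add: degree_insert_last)
  show "?a \<in> carrier (koszul_obj n C i)" using lo by auto
  show "?b \<in> carrier (koszul_obj n C (i - 1))" using hi by auto
  show "x = koszul_pair R n C i ?a ?b"
  proof (rule Pow_Suc_ext[of _ n])
    show "x \<in> extensional (Pow {0..<Suc n})" using x by (auto simp: PiE_iff)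
    show "x S = koszul_pair R n C i ?a ?b S" if "S \<subseteq> {0..<n}" for S
      using that by (simp add: koszul_pair_low)
    show "x (insert n T) = koszul_pair R n C i ?a ?b (insert n T)" if "T \<subseteq> {0..<n}" for T
      using that hi[OF that] by (simp add: koszul_pair_high ob.koszul_sign_smult)
  qed simp
qed

text \<open>The first hypothesis is the induction hypothesis of
  \<open>graded_complex_koszul\<close>: each instance of the cone locale certifies the Koszul
  complex that is longer by one.\<close>

lemma koszul_cone:
  assumes "graded_complex R G (koszul R xs C)" "set xs \<subseteq> G 1" "w \<in> G 1"
  shows "cone_cx R k G (koszul R xs C) w (koszul R (xs @ [w]) C) (koszul_pair R (length xs) C)"
proof -
  interpret K: graded_cx R k G "koszul R xs C"
    by unfold_locales (rule assms(1))
  have xs: "set xs \<subseteq> carrier R" "w \<in> carrier R" using assms(2,3) G_carrier by auto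
  show ?thesis
  proof (intro cone_cx.intro cone_cx_axioms.intro K.graded_cx_axioms,
      unfold koszul_simps length_append_singleton)
    show "w \<in> G 1" by fact
    show "graded_module R G (koszul_obj (Suc (length xs)) C i)" for i
      by (rule graded_module_koszul_obj)
    fix i a b
    assume ab: "a \<in> carrier (koszul_obj (length xs) C i)" "b \<in> carrier (koszul_obj (length xs) C (i - 1))"
    have "koszul_diff R xs C (i - 1) b \<in> carrier (koszul_obj (length xs) C (i - 1 - 1))"
      using K.d_closed[of b "i - 1"] ab(2) unfolding koszul_simps .
    from koszul_diff_pair[OF ab xs refl this]
    show "koszul_diff R (xs @ [w]) C i (koszul_pair R (length xs) C i a b) =
      koszul_pair R (length xs) C (i - 1)
       (koszul_diff R xs C i a \<oplus>\<^bsub>koszul_obj (length xs) C (i - 1)\<^esub> w \<odot>\<^bsub>koszul_obj (length xs) C (i - 1)\<^esub> b)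
       (\<ominus>\<^bsub>koszul_obj (length xs) C (i - 2)\<^esub> koszul_diff R xs C (i - 1) b)"
      by (simp only: diff_diff_eq one_add_one)
  qed (rule koszul_pair_cases koszul_pair_closed koszul_pair_homog koszul_pair_inj koszul_pair_add
      koszul_pair_smult; assumption)+
qed

section \<open>Koszul complexes: the empty sequence and induction on the length\<close>

lemma koszul_diff_Nil:
  assumes "u \<in> carrier (koszul_obj 0 C i)"
  shows "koszul_diff R [] C i u = (\<lambda>T\<in>{{}}. diff C i (u {}))"
proof (rule ext)
  fix T :: "nat set"
  have "u {} \<in> carrier (obj C i)" using koszul_memD[OF assms, of "{}"] by simp
  then have d: "diff C i (u {}) \<in> carrier (obj C (i - 1))" by (rule d_closed)
  show "koszul_diff R [] C i u T = (\<lambda>T\<in>{{}}. diff C i (u {})) T"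
  proof (cases "T = {}")
    case True
    then show ?thesis using d by (simp add: koszul_diff_def koszul_sign_def)
  qed (simp add: koszul_diff_def)
qed

text \<open>Adjoining the last variable is a cone, so the differential squares to zero without a
  computation over pairs of indices.\<close>

lemma graded_complex_koszul:
  assumes "set xs \<subseteq> G 1"
  shows "graded_complex R G (koszul R xs C)"
  using assms
proof (induction xs rule: rev_induct)
  case Nil
  have [simp]: "u \<in> (\<Pi>\<^sub>E S\<in>{{}}. A S) \<longleftrightarrow> u {} \<in> A {} \<and> u \<in> extensional {{}}" for u :: "nat set \<Rightarrow> 'b" and A
    by (auto simp: PiE_iff)
  show ?case
    unfolding graded_complex_def
  proof (intro conjI allI ballI)
    fix i
    show "graded_module R G (obj (koszul R [] C) i)"
      by (simp add: graded_module_koszul_obj)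
    show "diff (koszul R [] C) i \<in> gr_hom R (obj (koszul R [] C) i) (obj (koszul R [] C) (i - 1))"
    proof (rule gr_homI)
      fix x j assume "x \<in> hcomp (obj (koszul R [] C) i) j"
      then show "diff (koszul R [] C) i x \<in> hcomp (obj (koszul R [] C) (i - 1)) j"
        using d_homog[of "x {}" i j] ob.gr.homog_carrier[of "x {}" i j] by (simp add: koszul_diff_Nil)
    qed (auto simp: koszul_diff_Nil d_add d_smult fun_eq_iff)
    fix x assume "x \<in> carrier (obj (koszul R [] C) i)"
    then show "diff (koszul R [] C) (i - 1) (diff (koszul R [] C) i x) = \<zero>\<^bsub>obj (koszul R [] C) (i - 2)\<^esub>"
      by (simp add: koszul_diff_Nil d_d fun_eq_iff)
  qed
next
  case (snoc w xs)
  then interpret K: cone_cx R k G "koszul R xs C" w "koszul R (xs @ [w]) C" "koszul_pair R (length xs) C"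
    by (intro koszul_cone) auto
  show ?case by (rule K.graded_complex_cone)
qed

lemma hcomp_koszul_Nil:
  "hcomp (koszul_obj 0 C i) j = (\<lambda>x. \<lambda>T\<in>{{}}. x) ` hcomp (obj C i) j"
proof (intro equalityI subsetI)
  fix u assume "u \<in> hcomp (koszul_obj 0 C i) j"
  then have "u {} \<in> hcomp (obj C i) j" "u = (\<lambda>T\<in>{{}}. u {})"
    by (auto simp: PiE_iff fun_eq_iff extensional_def)
  then show "u \<in> (\<lambda>x. \<lambda>T\<in>{{}}. x) ` hcomp (obj C i) j" by (rule rev_image_eqI)
next
  fix u :: "nat set \<Rightarrow> 'm" assume "u \<in> (\<lambda>x. \<lambda>T\<in>{{}}. x) ` hcomp (obj C i) j"
  then show "u \<in> hcomp (koszul_obj 0 C i) j"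
    by (auto simp: PiE_iff split: if_splits)
qed

lemma koszul_diff_Nil_const:
  assumes "x \<in> carrier (obj C i)"
  shows "koszul_diff R [] C i (\<lambda>T\<in>{{}}. x) = (\<lambda>T\<in>{{}}. diff C i x)"
proof -
  have "(\<lambda>T\<in>{{}}. x) \<in> carrier (koszul_obj 0 C i)" using assms by simp
  then show ?thesis using koszul_diff_Nil by fastforce
qed

text \<open>There is one subset of the empty index set, so a Koszul chain is a single chain of
  \<open>C\<close>.\<close>

lemma exact_koszul_Nil: "exact_at (koszul R [] C) i j \<longleftrightarrow> exact_at C i j"
proof -
  let ?c = "\<lambda>x. \<lambda>T\<in>{{} :: nat set}. x"
  have z: "zero (koszul_obj 0 C i) = ?c \<zero>\<^bsub>obj C i\<^esub>" for i
    by (simp add: fun_eq_iff)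
  have "exact_at (koszul R [] C) i j \<longleftrightarrow> (\<forall>x\<in>hcomp (obj C i) j.
      ?c (diff C i x) = ?c \<zero>\<^bsub>obj C (i - 1)\<^esub> \<longrightarrow>
      (\<exists>u\<in>hcomp (obj C (i + 1)) j. ?c (diff C (i + 1) u) = ?c x))"
    unfolding exact_at_def koszul_simps list.size z hcomp_koszul_Nil ball_simps bex_simps
    by (intro ball_cong bex_cong refl arg_cong2[where f = "(\<longrightarrow>)"])
      (simp_all only: koszul_diff_Nil_const ob.gr.homog_carrier)
  then show ?thesis unfolding const_fun_eq_iff exact_at_def .
qed

end

section \<open>Finite length homology\<close>

context graded_cx
begin

lemma boundaries_additive_subgroup: "additive_subgroup (boundaries C i) (obj C i)"
  using submodule_boundaries by (simp add: submodule_def additive_subgroup_def)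

lemma boundaries_abelian_subgroup: "abelian_subgroup (boundaries C i) (obj C i)"
  by (rule abelian_subgroupI3[OF boundaries_additive_subgroup ob.M.abelian_group_axioms])

lemma cycles_carrier: "x \<in> cycles C i \<Longrightarrow> x \<in> carrier (obj C i)"
  by (simp add: cycles_def)

lemma homology_add:
  assumes "x \<in> cycles C i" "y \<in> cycles C i"
  shows "(boundaries C i +>\<^bsub>obj C i\<^esub> x) \<oplus>\<^bsub>homology C i\<^esub> (boundaries C i +>\<^bsub>obj C i\<^esub> y) =
    boundaries C i +>\<^bsub>obj C i\<^esub> (x \<oplus>\<^bsub>obj C i\<^esub> y)"
  unfolding homology_simps
  by (rule abelian_subgroup.a_rcos_sum[OF boundaries_abelian_subgroup])
    (use assms cycles_carrier in auto)

lemma homology_zero: "\<zero>\<^bsub>homology C i\<^esub> = boundaries C i +>\<^bsub>obj C i\<^esub> \<zero>\<^bsub>obj C i\<^esub>"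
  unfolding homology_simps
  by (rule ob.M.a_coset_add_zero[symmetric])
    (rule additive_subgroup.a_subset[OF boundaries_additive_subgroup])

text \<open>The union that defines the action in \<open>quot_gmodule\<close> is a union of equal
  cosets, because boundaries form a submodule.\<close>

lemma homology_smult:
  assumes r: "r \<in> carrier R" and x: "x \<in> cycles C i"
  shows "r \<odot>\<^bsub>homology C i\<^esub> (boundaries C i +>\<^bsub>obj C i\<^esub> x) =
    boundaries C i +>\<^bsub>obj C i\<^esub> (r \<odot>\<^bsub>obj C i\<^esub> x)"
proof -
  let ?B = "boundaries C i" and ?M = "obj C i"
  interpret B: abelian_subgroup ?B ?M by (rule boundaries_abelian_subgroup)
  have xc: "x \<in> carrier ?M" using cycles_carrier[OF x] .
  have "?B +>\<^bsub>?M\<^esub> (r \<odot>\<^bsub>?M\<^esub> y) = ?B +>\<^bsub>?M\<^esub> (r \<odot>\<^bsub>?M\<^esub> x)" if "y \<in> ?B +>\<^bsub>?M\<^esub> x" for y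
  proof -
    obtain b where b: "b \<in> ?B" "y = b \<oplus>\<^bsub>?M\<^esub> x" using \<open>y \<in> _\<close> by (auto simp: a_r_coset_def')
    have bc: "b \<in> carrier ?M" using b(1) B.a_subset by blast
    have "r \<odot>\<^bsub>?M\<^esub> b \<in> ?B"
      using submodule.smult_closed[OF submodule_boundaries r b(1)] .
    then have "r \<odot>\<^bsub>?M\<^esub> y \<in> ?B +>\<^bsub>?M\<^esub> (r \<odot>\<^bsub>?M\<^esub> x)"
      using b(2) r xc bc by (auto simp: a_r_coset_def' ob.smult_r_distr)
    then show ?thesis
      using B.a_repr_independence' r xc by simp
  qed
  moreover have "x \<in> ?B +>\<^bsub>?M\<^esub> x"
    using B.zero_closed xc by (force simp: a_r_coset_def')
  ultimately show ?thesis unfolding homology_simps by blast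
qed

lemma cycles_closed:
  shows "x \<in> cycles C i \<Longrightarrow> y \<in> cycles C i \<Longrightarrow> x \<oplus>\<^bsub>obj C i\<^esub> y \<in> cycles C i"
    and "x \<in> cycles C i \<Longrightarrow> \<ominus>\<^bsub>obj C i\<^esub> x \<in> cycles C i"
    and "\<zero>\<^bsub>obj C i\<^esub> \<in> cycles C i"
    and "r \<in> carrier R \<Longrightarrow> x \<in> cycles C i \<Longrightarrow> r \<odot>\<^bsub>obj C i\<^esub> x \<in> cycles C i"
  by (auto simp: cycles_def d_add d_neg d_smult)

text \<open>The additive structure is that of the quotient group of cycles by boundaries, whose
  multiplication is the addition here.\<close>

lemma abelian_group_homology: "abelian_group (homology C i)"
proof -
  let ?Z = "sub_gmodule (obj C i) (cycles C i)"
  interpret Z: abelian_group ?Z by (rule ob.abelian_group_sub_gmodule[OF submodule_cycles])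
  have B: "additive_subgroup (boundaries C i) ?Z"
  proof (rule Z.additive_subgroupI')
    show "\<ominus>\<^bsub>?Z\<^esub> x \<in> boundaries C i" if "x \<in> boundaries C i" for x
      using that ob.a_inv_sub_gmodule[OF submodule_cycles, of x i] boundaries_subset_cycles[of i]
        ob.submoduleE(6)[OF submodule_boundaries, of x i] by auto
  qed (use boundaries_subset_cycles ob.submoduleE(5)[OF submodule_boundaries]
      additive_subgroup.zero_closed[OF boundaries_additive_subgroup] in auto)
  interpret Q: comm_group "?Z A_Mod boundaries C i"
    by (rule abelian_subgroup.a_factorgroup_is_comm_group[OF abelian_subgroupI3[OF B Z.abelian_group_axioms]])
  have eq: "carrier (?Z A_Mod boundaries C i) = carrier (homology C i)"
    "mult (?Z A_Mod boundaries C i) = add (homology C i)"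
    "one (?Z A_Mod boundaries C i) = zero (homology C i)"
    by (simp_all add: homology_def quot_gmodule_def A_FactGroup_def FactGroup_def A_RCOSETS_def set_add_def)
  show ?thesis
    by (rule abelian_groupI)
      (use Q.m_closed Q.one_closed Q.m_assoc Q.m_comm Q.l_one Q.l_inv_ex in \<open>auto simp: eq\<close>)
qed

text \<open>Turns submodules of the chain module into submodules of homology, to be tested against
  finite length.\<close>

lemma submodule_homology:
  assumes N: "submodule N R (obj C i)"
  shows "submodule ((\<lambda>x. boundaries C i +>\<^bsub>obj C i\<^esub> x) ` (cycles C i \<inter> N)) R (homology C i)"
    (is "submodule (?c ` ?Z) R _")
proof -
  interpret H: abelian_group "homology C i" by (rule abelian_group_homology)
  note N = ob.submoduleE[OF N]
  have zero: "\<zero>\<^bsub>obj C i\<^esub> \<in> N"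
    using submodule.axioms(1)[OF assms] subgroup.one_closed by fastforce
  have "additive_subgroup (?c ` ?Z) (homology C i)"
  proof (rule H.additive_subgroupI')
    show "?c ` ?Z \<subseteq> carrier (homology C i)" unfolding homology_simps by blast
    show "\<zero>\<^bsub>homology C i\<^esub> \<in> ?c ` ?Z"
      unfolding homology_zero using cycles_closed(3) zero by blast
  next
    fix X Y assume "X \<in> ?c ` ?Z" "Y \<in> ?c ` ?Z"
    then obtain x y where "x \<in> ?Z" "y \<in> ?Z" "X = ?c x" "Y = ?c y" by blast
    then show "X \<oplus>\<^bsub>homology C i\<^esub> Y \<in> ?c ` ?Z"
      using homology_add[of x i y] cycles_closed(1)[of x i y] N(5)[of x y] by auto
  next
    fix X assume "X \<in> ?c ` ?Z"
    then obtain x where x: "x \<in> cycles C i" "x \<in> N" "X = ?c x" by blast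
    have "\<ominus>\<^bsub>homology C i\<^esub> X = ?c (\<ominus>\<^bsub>obj C i\<^esub> x)"
    proof (rule H.minus_equality)
      show "?c (\<ominus>\<^bsub>obj C i\<^esub> x) \<oplus>\<^bsub>homology C i\<^esub> X = \<zero>\<^bsub>homology C i\<^esub>"
        unfolding homology_zero x(3) homology_add[OF cycles_closed(2)[OF x(1)] x(1)]
        using cycles_carrier[OF x(1)] by (simp add: ob.M.l_neg)
    qed (use x cycles_closed(2)[OF x(1)] in \<open>auto simp: homology_simps\<close>)
    then show "\<ominus>\<^bsub>homology C i\<^esub> X \<in> ?c ` ?Z"
      using cycles_closed(2)[OF x(1)] N(6)[OF x(2)] by blast
  qed
  moreover have "r \<odot>\<^bsub>homology C i\<^esub> X \<in> ?c ` ?Z" if r: "r \<in> carrier R" and X: "X \<in> ?c ` ?Z" for r X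
  proof -
    obtain x where x: "x \<in> cycles C i" "x \<in> N" "X = ?c x" using X by blast
    then show ?thesis
      using homology_smult[OF r x(1)] cycles_closed(4)[OF r x(1)] N(4)[OF r x(2)] by auto
  qed
  ultimately show ?thesis
    by (intro submodule.intro submodule_axioms.intro) (auto simp: additive_subgroup_def)
qed

definition degree_ge :: "int \<Rightarrow> int \<Rightarrow> 'm set" where
  "degree_ge i j = {x \<in> carrier (obj C i). \<forall>l<j. hpart (obj C i) (hcomp (obj C i)) l x = \<zero>\<^bsub>obj C i\<^esub>}"

text \<open>Ring elements have no components of negative degree: the component of \<open>r x\<close>
  in degree l is a sum of multiples of components of \<open>x\<close> in degrees at most l, and
  these vanish for l < j.\<close>

lemma submodule_degree_ge: "submodule (degree_ge i j) R (obj C i)"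
proof (rule ob.submoduleI)
  let ?M = "obj C i" and ?p = "hpart (obj C i) (hcomp (obj C i))"
  fix r x assume r: "r \<in> carrier R" and x: "x \<in> degree_ge i j"
  have xc: "x \<in> carrier ?M" using x by (simp add: degree_ge_def)
  have rc: "hpart R G a r \<in> carrier R" for a using Rgr.hpart_carrier[OF r] .
  have hom: "(\<lambda>r. ?p l (r \<odot>\<^bsub>?M\<^esub> x)) \<in> add_hom R ?M" for l
    by (rule add_homI) (use xc in \<open>auto simp: ob.smult_l_distr ob.gr.hpart_add ob.gr.hpart_carrier\<close>)
  have "?p l (r \<odot>\<^bsub>?M\<^esub> x) = \<zero>\<^bsub>?M\<^esub>" if "l < j" for l
  proof -
    let ?S = "{a. hpart R G a r \<noteq> \<zero>}"
    have z: "?p l (hpart R G a r \<odot>\<^bsub>?M\<^esub> x) = \<zero>\<^bsub>?M\<^esub>" for a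
    proof -
      have "?p l (hpart R G a r \<odot>\<^bsub>?M\<^esub> x) = hpart R G a r \<odot>\<^bsub>?M\<^esub> ?p (l - int a) x"
        using ob.hpart_smult[OF Rgr.hpart_in[OF r] rc xc, of a "l - int a"] by simp
      also have "?p (l - int a) x = \<zero>\<^bsub>?M\<^esub>" using x \<open>l < j\<close> by (simp add: degree_ge_def)
      finally show ?thesis using rc by simp
    qed
    have "?p l (r \<odot>\<^bsub>?M\<^esub> x) = ?p l (finsum R (\<lambda>a. hpart R G a r) ?S \<odot>\<^bsub>?M\<^esub> x)"
      by (rule arg_cong[where f = "\<lambda>r. ?p l (r \<odot>\<^bsub>?M\<^esub> x)"]) (rule Rgr.hpart_sum[OF r])
    also have "\<dots> = finsum ?M (\<lambda>a. ?p l (hpart R G a r \<odot>\<^bsub>?M\<^esub> x)) ?S"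
      by (rule add_hom_finsum[OF is_abelian_group ob.M.abelian_group_axioms hom]) (use rc in auto)
    also have "\<dots> = \<zero>\<^bsub>?M\<^esub>" by (simp add: z)
    finally show ?thesis .
  qed
  then show "r \<odot>\<^bsub>?M\<^esub> x \<in> degree_ge i j" using r xc by (simp add: degree_ge_def)
qed (auto simp: degree_ge_def ob.gr.hpart_add ob.gr.hpart_neg)

text \<open>Homology in arbitrarily large degrees would give strict chains of every length in the
  filtration by the classes of cycles in \<open>degree_ge\<close>.\<close>

lemma exact_of_finite_length:
  assumes "finite_length R (homology C i)"
  shows "\<exists>b. \<forall>j>b. exact_at C i j"
proof (rule ccontr)
  assume "\<not> ?thesis"
  then have ne: "\<exists>j>b. \<not> exact_at C i j" for b by blast
  let ?c = "\<lambda>x. boundaries C i +>\<^bsub>obj C i\<^esub> x"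
  let ?N = "\<lambda>j. ?c ` (cycles C i \<inter> degree_ge i j)"
  interpret B: abelian_subgroup "boundaries C i" "obj C i" by (rule boundaries_abelian_subgroup)
  have "\<exists>f::nat \<Rightarrow> int. \<forall>n. \<not> exact_at C i (f n) \<and> f n < f (Suc n)"
    using ne by (intro dependent_nat_choice) auto
  then obtain f :: "nat \<Rightarrow> int" where f: "\<And>n. \<not> exact_at C i (f n)" "\<And>n. f n < f (Suc n)"
    by blast
  have strict: "?N j' \<subset> ?N j" if "j < j'" and ne_j: "\<not> exact_at C i j" for j j'
    unfolding subset_not_subset_eq
  proof
    show "?N j' \<subseteq> ?N j" using \<open>j < j'\<close> by (auto simp: degree_ge_def)
    obtain x where x: "x \<in> hcomp (obj C i) j" "diff C i x = \<zero>\<^bsub>obj C (i - 1)\<^esub>"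
      and nx: "\<not> (\<exists>u\<in>hcomp (obj C (i + 1)) j. diff C (i + 1) u = x)"
      using ne_j unfolding exact_at_def by blast
    have xc: "x \<in> carrier (obj C i)" using ob.gr.homog_carrier[OF x(1)] .
    have "?c x \<in> ?N j"
      using x xc by (intro imageI) (auto simp: cycles_def degree_ge_def ob.gr.hpart_homog)
    moreover have "?c x \<notin> ?N j'"
    proof
      assume "?c x \<in> ?N j'"
      then obtain y where y: "?c x = ?c y" "y \<in> degree_ge i j'" by blast
      have yc: "y \<in> carrier (obj C i)" using y(2) by (simp add: degree_ge_def)
      \<comment> \<open>If \<open>x\<close> and \<open>y\<close> represent one class, their
        difference is a boundary. Its component of degree \<open>j\<close> is \<open>x\<close>,
        since \<open>y\<close> starts in degree \<open>j'\<close>, and then \<open>x\<close> is the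
        boundary of a homogeneous chain.\<close>
      have "x \<in> ?c x" using B.zero_closed xc by (force simp: a_r_coset_def')
      then have "x \<oplus>\<^bsub>obj C i\<^esub> \<ominus>\<^bsub>obj C i\<^esub> y \<in> boundaries C i"
        using y(1) B.a_rcos_module_imp[OF yc] by simp
      moreover have "hpart (obj C i) (hcomp (obj C i)) j (x \<oplus>\<^bsub>obj C i\<^esub> \<ominus>\<^bsub>obj C i\<^esub> y) = x"
        using xc yc y(2) \<open>j < j'\<close> ob.gr.hpart_homog[OF x(1)]
        by (simp add: ob.gr.hpart_add ob.gr.hpart_neg degree_ge_def)
      ultimately show False using hpart_boundaries nx by metis
    qed
    ultimately show "\<not> ?N j \<subseteq> ?N j'" by blast
  qed
  obtain l where l: "\<And>N n. (\<forall>p\<le>n. submodule (N p) R (homology C i)) \<and> (\<forall>p<n. N p \<subset> N (Suc p)) \<Longrightarrow> n \<le> (l::nat)"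
    using assms unfolding finite_length_def by blast
  \<comment> \<open>\<open>finite_length\<close> tests ascending chains while the filtration
    descends, so the index is reversed.\<close>
  have "Suc l \<le> l"
  proof (rule l[of _ "\<lambda>p. ?N (f (Suc l - p))"], intro conjI allI impI)
    show "submodule (?N (f (Suc l - p))) R (homology C i)" for p
      by (rule submodule_homology[OF submodule_degree_ge])
    show "?N (f (Suc l - p)) \<subset> ?N (f (Suc l - Suc p))" if "p < Suc l" for p
      using strict[of "f (l - p)" "f (Suc l - p)"] f(1)[of "l - p"] f(2)[of "l - p"] that
      by (simp add: Suc_diff_le)
  qed
  then show False by simp
qed

end

section \<open>Bounds on the degrees of homology\<close>

definition bounded_exact :: "('r, 'm) gcomplex \<Rightarrow> bool" where
  "bounded_exact C \<longleftrightarrow> (\<forall>i. \<exists>b. \<forall>j>b. exact_at C i j)"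

text \<open>For a Koszul complex this is the inequality between \<open>kreg\<close> and
  \<open>r\<close>, in a form that can be chased through cones.\<close>

definition exact_above :: "('r, 'm) gcomplex \<Rightarrow> int \<Rightarrow> bool" where
  "exact_above C r \<longleftrightarrow> (\<forall>i j. j - i > r \<longrightarrow> exact_at C i j)"

context cone_cx
begin

text \<open>The bound may depend on i, and homological degree i of the cone involves only the
  degrees i and i - 1 of \<open>C\<close>.\<close>

lemma bounded_exact_cone:
  assumes "bounded_exact C"
  shows "bounded_exact D"
  unfolding bounded_exact_def
proof
  fix i
  obtain b c where "\<And>j. j > b \<Longrightarrow> exact_at C i j" "\<And>j. j > c \<Longrightarrow> exact_at C (i - 1) j"
    using assms unfolding bounded_exact_def by metis
  then show "\<exists>b. \<forall>j>b. exact_at D i j"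
    by (intro exI[of _ "max b (c + 1)"]) (auto intro!: exact_cone)
qed

lemma exact_above_cone: "exact_above C r \<Longrightarrow> exact_above D r"
  unfolding exact_above_def by (auto intro!: exact_cone)

text \<open>The hypothesis \<open>torsion\<close> is met in two ways: homology vanishes in large
  degrees, or \<open>w\<close> is locally nilpotent already on chains.\<close>

lemma exact_above_of_cone:
  assumes "exact_above D r"
    and torsion: "\<And>i j z. z \<in> hcomp (obj C i) j \<Longrightarrow> diff C i z = \<zero>\<^bsub>obj C (i - 1)\<^esub> \<Longrightarrow>
      \<exists>t. \<exists>c\<in>hcomp (obj C (i + 1)) (j + int t). diff C (i + 1) c = (w [^] t) \<odot>\<^bsub>obj C i\<^esub> z"
  shows "exact_above C r"
  unfolding exact_above_def exact_at_def
proof (intro allI impI ballI)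
  fix i j z
  assume ij: "r < j - i" and z: "z \<in> hcomp (obj C i) j" "diff C i z = \<zero>\<^bsub>obj C (i - 1)\<^esub>"
  obtain t where "\<exists>c\<in>hcomp (obj C (i + 1)) (j + int t). diff C (i + 1) c = (w [^] t) \<odot>\<^bsub>obj C i\<^esub> z"
    using torsion[OF z] by blast
  then show "\<exists>u\<in>hcomp (obj C (i + 1)) j. diff C (i + 1) u = z"
    using torsion_exact_of_exact_cone[OF _ z ij] assms(1) unfolding exact_above_def by blast
qed

lemma w_pow_homog:
  "x \<in> hcomp (obj C i) j \<Longrightarrow> (w [^] (t::nat)) \<odot>\<^bsub>obj C i\<^esub> x \<in> hcomp (obj C i) (j + int t)"
proof (induction t)
  case (Suc t)
  have "x \<in> carrier (obj C i)" using ob.gr.homog_carrier[OF Suc.prems] .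
  then have "(w [^] Suc t) \<odot>\<^bsub>obj C i\<^esub> x = w \<odot>\<^bsub>obj C i\<^esub> ((w [^] t) \<odot>\<^bsub>obj C i\<^esub> x)"
    by (simp add: ob.smult_assoc1[symmetric] m_comm)
  then show ?case using w_homog[OF Suc.IH[OF Suc.prems]] by (simp add: algebra_simps)
qed (use ob.gr.homog_carrier in auto)

lemma exact_above_cone_iff:
  assumes "bounded_exact C"
  shows "exact_above D r \<longleftrightarrow> exact_above C r"
proof
  show "exact_above C r" if "exact_above D r"
  proof (rule exact_above_of_cone[OF that])
    fix i j z assume z: "z \<in> hcomp (obj C i) j" "diff C i z = \<zero>\<^bsub>obj C (i - 1)\<^esub>"
    obtain b where b: "\<And>j. j > b \<Longrightarrow> exact_at C i j" using assms unfolding bounded_exact_def by blast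
    \<comment> \<open>Large enough that \<open>w [^] t\<close> moves \<open>z\<close> beyond
      \<open>b\<close>, where every cycle is a boundary.\<close>
    define t where "t = nat (b + 1 - j)"
    have "exact_at C i (j + int t)" by (rule b) (simp add: t_def)
    moreover have "diff C i ((w [^] t) \<odot>\<^bsub>obj C i\<^esub> z) = \<zero>\<^bsub>obj C (i - 1)\<^esub>"
      using z(2) ob.gr.homog_carrier[OF z(1)] by (simp add: d_smult)
    ultimately show "\<exists>t. \<exists>c\<in>hcomp (obj C (i + 1)) (j + int t).
        diff C (i + 1) c = (w [^] t) \<odot>\<^bsub>obj C i\<^esub> z"
      using w_pow_homog[OF z(1), of t] unfolding exact_at_def by blast
  qed
qed (rule exact_above_cone)

end

text \<open>An element \<open>a\<close> of one set of integers shows that \<open>a - 1\<close> does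
  not bound it, hence does not bound the other set either, which therefore has an element at least
  \<open>a\<close>. This covers finite, infinite and empty suprema alike.\<close>

lemma Sup_eq_of_bounds:
  fixes P Q :: "int \<Rightarrow> int \<Rightarrow> bool"
  assumes "\<And>r. (\<forall>i j. j - i > r \<longrightarrow> \<not> P i j) \<longleftrightarrow> (\<forall>i j. j - i > r \<longrightarrow> \<not> Q i j)"
  shows "Sup {ereal (of_int (j - i)) | i j. P i j} = Sup {ereal (of_int (j - i)) | i j. Q i j}"
proof -
  have "Sup {ereal (of_int (j - i)) | i j. P i j} \<le> Sup {ereal (of_int (j - i)) | i j. Q i j}"
    if le: "\<And>r. (\<forall>i j. j - i > r \<longrightarrow> \<not> Q i j) \<Longrightarrow> (\<forall>i j. j - i > r \<longrightarrow> \<not> P i j)" for P Q :: "int \<Rightarrow> int \<Rightarrow> bool"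
  proof (rule Sup_mono)
    fix a assume "a \<in> {ereal (of_int (j - i)) | i j. P i j}"
    then obtain i j where ij: "a = ereal (of_int (j - i))" "P i j" by blast
    obtain i' j' where "j' - i' > j - i - 1" "Q i' j'"
      using le[of "j - i - 1"] ij(2) by force
    moreover then have "a \<le> ereal (of_int (j' - i'))"
      unfolding ij(1) ereal_less_eq of_int_le_iff by linarith
    ultimately show "\<exists>b\<in>{ereal (of_int (j - i)) | i j. Q i j}. a \<le> b" by blast
  qed
  from this[of Q P] this[of P Q] assms show ?thesis by (intro antisym) auto
qed

lemma (in graded_cx) kreg_eqI:
  assumes "set xs \<subseteq> G 1" "graded_cx R k G C'" "set ys \<subseteq> G 1"
    and "\<And>r. exact_above (koszul R xs C) r \<longleftrightarrow> exact_above (koszul R ys C') r"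
  shows "kreg R xs C = kreg R ys C'"
proof -
  interpret K: graded_cx R k G "koszul R xs C"
    by unfold_locales (rule graded_complex_koszul[OF assms(1)])
  interpret K': graded_cx R k G "koszul R ys C'"
    by (rule graded_cx.intro[OF standard_graded_algebra_axioms])
      (rule graded_cx_axioms.intro, rule graded_cx.graded_complex_koszul[OF assms(2,3)])
  show ?thesis
    unfolding kreg_def
    by (rule Sup_eq_of_bounds)
      (use assms(4) in \<open>simp add: K.homology_nonzero_iff K'.homology_nonzero_iff exact_above_def\<close>)
qed

text \<open>The first conclusion restores the hypothesis that the second needs for the next
  form.\<close>

lemma (in graded_cx) bounded_exact_snoc:
  assumes "set xs \<subseteq> G 1" "w \<in> G 1" "bounded_exact (koszul R xs C)"
  shows "bounded_exact (koszul R (xs @ [w]) C)"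
    and "exact_above (koszul R (xs @ [w]) C) r \<longleftrightarrow> exact_above (koszul R xs C) r"
proof -
  interpret K: cone_cx R k G "koszul R xs C" w "koszul R (xs @ [w]) C" "koszul_pair R (length xs) C"
    by (rule koszul_cone[OF graded_complex_koszul]) fact+
  show "bounded_exact (koszul R (xs @ [w]) C)" by (rule K.bounded_exact_cone) fact
  show "exact_above (koszul R (xs @ [w]) C) r \<longleftrightarrow> exact_above (koszul R xs C) r"
    by (rule K.exact_above_cone_iff) fact
qed

section \<open>Quasi-isomorphisms\<close>

text \<open>Acyclicity of the mapping cone of \<open>\<phi>\<close>, spelled out degree by degree.\<close>

definition acyclic_map ::
  "('r, 'm) gcomplex \<Rightarrow> ('r, 'n) gcomplex \<Rightarrow> (int \<Rightarrow> 'm \<Rightarrow> 'n) \<Rightarrow> bool" where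
  "acyclic_map C D \<phi> \<longleftrightarrow> (\<forall>i j. \<forall>x\<in>hcomp (obj C i) j. \<forall>y\<in>hcomp (obj D (i + 1)) j.
     diff C i x = \<zero>\<^bsub>obj C (i - 1)\<^esub> \<longrightarrow> \<phi> i x = diff D (i + 1) y \<longrightarrow>
     (\<exists>u\<in>hcomp (obj C (i + 1)) j. \<exists>v\<in>hcomp (obj D (i + 2)) j.
        diff C (i + 1) u = x \<and> y = \<phi> (i + 1) u \<oplus>\<^bsub>obj D (i + 1)\<^esub> diff D (i + 2) v))"

lemma acyclic_mapD:
  assumes "acyclic_map C D \<phi>" "x \<in> hcomp (obj C i) j" "y \<in> hcomp (obj D (i + 1)) j"
    "diff C i x = \<zero>\<^bsub>obj C (i - 1)\<^esub>" "\<phi> i x = diff D (i + 1) y"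
  obtains u v where "u \<in> hcomp (obj C (i + 1)) j" "v \<in> hcomp (obj D (i + 2)) j"
    "diff C (i + 1) u = x" "y = \<phi> (i + 1) u \<oplus>\<^bsub>obj D (i + 1)\<^esub> diff D (i + 2) v"
  using assms unfolding acyclic_map_def by blast

section \<open>Chain maps with acyclic cone\<close>

locale gcx_map = C: graded_cx R k G C + C': graded_cx R k G C'
  for R :: "'r ring" (structure) and k G and C :: "('r, 'm) gcomplex" and C' :: "('r, 'n) gcomplex" +
  fixes \<phi> :: "int \<Rightarrow> 'm \<Rightarrow> 'n"
  assumes map: "chain_map R C C' \<phi>"
begin

lemma map_hom: "\<phi> i \<in> gr_hom R (obj C i) (obj C' i)"
  using map by (simp add: chain_map_def)

lemma map_d: "x \<in> carrier (obj C i) \<Longrightarrow> \<phi> (i - 1) (diff C i x) = diff C' i (\<phi> i x)"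
  using map by (simp add: chain_map_def)

lemma map_d_up: "x \<in> carrier (obj C (i + 1)) \<Longrightarrow> \<phi> i (diff C (i + 1) x) = diff C' (i + 1) (\<phi> (i + 1) x)"
  using map_d[of x "i + 1"] by simp

lemmas map_closed [simp, intro] = gr_hom_closed[OF map_hom]
lemmas map_add = gr_hom_add[OF map_hom]
lemmas map_smult = gr_hom_smult[OF map_hom]
lemmas map_homog = gr_hom_homog[OF map_hom]
lemmas map_hpart = gr_hom_hpart[OF C.obj_gm C'.obj_gm map_hom]

lemmas map_zero [simp] = add_hom_zero[OF C.ob.M.abelian_group_axioms C'.ob.M.abelian_group_axioms
    gr_hom_add_hom[OF map_hom]]
lemmas map_neg = add_hom_neg[OF C.ob.M.abelian_group_axioms C'.ob.M.abelian_group_axioms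
    gr_hom_add_hom[OF map_hom]]

text \<open>Cycles of the cone of \<phi> are pairs. A cycle \<open>x\<close> of \<open>C\<close>
  whose image bounds is paired with a chain bounding the image; a cycle \<open>y\<close> of
  \<open>C'\<close> is paired with the zero of \<open>C\<close> one degree lower.\<close>

lemma exact_at_iff:
  assumes "acyclic_map C C' \<phi>"
  shows "exact_at C i j \<longleftrightarrow> exact_at C' i j"
proof
  assume e: "exact_at C' i j"
  show "exact_at C i j"
    unfolding exact_at_def
  proof (intro ballI impI)
    fix x assume x: "x \<in> hcomp (obj C i) j" "diff C i x = \<zero>\<^bsub>obj C (i - 1)\<^esub>"
    have xc: "x \<in> carrier (obj C i)" using C.ob.gr.homog_carrier[OF x(1)] .
    have "diff C' i (\<phi> i x) = \<zero>\<^bsub>obj C' (i - 1)\<^esub>" using map_d[OF xc] x(2) by simp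
    then obtain y where "y \<in> hcomp (obj C' (i + 1)) j" "diff C' (i + 1) y = \<phi> i x"
      using e map_homog[OF x(1)] unfolding exact_at_def by blast
    then show "\<exists>u\<in>hcomp (obj C (i + 1)) j. diff C (i + 1) u = x"
      using acyclic_mapD[OF assms x(1) _ x(2)] by metis
  qed
next
  assume e: "exact_at C i j"
  show "exact_at C' i j"
    unfolding exact_at_def
  proof (intro ballI impI)
    fix y assume y: "y \<in> hcomp (obj C' i) j" "diff C' i y = \<zero>\<^bsub>obj C' (i - 1)\<^esub>"
    have idx: "i - 1 + 1 = i" "i - 1 + 2 = i + 1" by simp_all
    obtain u v where u: "u \<in> hcomp (obj C i) j" and v: "v \<in> hcomp (obj C' (i + 1)) j"
      and du: "diff C i u = \<zero>\<^bsub>obj C (i - 1)\<^esub>" and dv: "y = \<phi> i u \<oplus>\<^bsub>obj C' i\<^esub> diff C' (i + 1) v"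
      by (rule acyclic_mapD[OF assms, of "\<zero>\<^bsub>obj C (i - 1)\<^esub>" "i - 1" j y, unfolded idx])
        (use y in auto)
    obtain u' where u': "u' \<in> hcomp (obj C (i + 1)) j" "diff C (i + 1) u' = u"
      using e u du unfolding exact_at_def by blast
    have c: "u' \<in> carrier (obj C (i + 1))" "v \<in> carrier (obj C' (i + 1))"
      using C.ob.gr.homog_carrier[OF u'(1)] C'.ob.gr.homog_carrier[OF v] .
    have "diff C' (i + 1) (\<phi> (i + 1) u' \<oplus>\<^bsub>obj C' (i + 1)\<^esub> v) = y"
      using c u'(2) dv C'.d_add[of "\<phi> (i + 1) u'" "i + 1" v] map_d_up[OF c(1)] by simp
    then show "\<exists>u\<in>hcomp (obj C' (i + 1)) j. diff C' (i + 1) u = y"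
      using C'.ob.gr.homog_add[OF map_homog[OF u'(1)] v] by blast
  qed
qed

text \<open>Boundaries go to boundaries under \<phi>, so the union in \<open>homology_map\<close> is
  a union of equal cosets.\<close>

lemma homology_map_coset:
  assumes x: "x \<in> cycles C i"
  shows "homology_map C' \<phi> i (boundaries C i +>\<^bsub>obj C i\<^esub> x) = boundaries C' i +>\<^bsub>obj C' i\<^esub> \<phi> i x"
proof -
  let ?B = "boundaries C i" and ?M = "obj C i" and ?B' = "boundaries C' i" and ?M' = "obj C' i"
  interpret B': abelian_subgroup ?B' ?M' by (rule C'.boundaries_abelian_subgroup)
  interpret B: abelian_subgroup ?B ?M by (rule C.boundaries_abelian_subgroup)
  have xc: "x \<in> carrier ?M" using C.cycles_carrier[OF x] .
  have "?B' +>\<^bsub>?M'\<^esub> \<phi> i y = ?B' +>\<^bsub>?M'\<^esub> \<phi> i x" if y: "y \<in> ?B +>\<^bsub>?M\<^esub> x" for y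
  proof -
    obtain u where u: "u \<in> carrier (obj C (i + 1))" "y = diff C (i + 1) u \<oplus>\<^bsub>?M\<^esub> x"
      using y by (auto simp: a_r_coset_def' boundaries_def)
    have uc: "diff C (i + 1) u \<in> carrier ?M" using C.d_up_closed[OF u(1)] .
    have "\<phi> i (diff C (i + 1) u) \<in> ?B'"
      using map_d_up[OF u(1)] C'.boundariesI map_closed[OF u(1)] by simp
    then have "\<phi> i y \<in> ?B' +>\<^bsub>?M'\<^esub> \<phi> i x"
      using u(2) xc uc by (auto simp: a_r_coset_def' map_add)
    then show ?thesis using B'.a_repr_independence' xc by simp
  qed
  moreover have "x \<in> ?B +>\<^bsub>?M\<^esub> x"
    using B.zero_closed xc by (force simp: a_r_coset_def')
  ultimately show ?thesis unfolding homology_map_def by blast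
qed

text \<open>Injectivity on H_i makes \<open>x\<close> the boundary of some \<open>u0\<close>. Then
  \<open>y - \<phi> u0\<close> is a cycle, and surjectivity on H_(i+1) writes it as the image of a
  cycle \<open>c\<close> plus a boundary.\<close>

lemma acyclic_map_of_quasi_iso:
  assumes q: "quasi_iso R C C' \<phi>"
  shows "acyclic_map C C' \<phi>"
  unfolding acyclic_map_def
proof (intro allI ballI impI)
  fix i j x y
  assume x: "x \<in> hcomp (obj C i) j" and y: "y \<in> hcomp (obj C' (i + 1)) j"
    and dx: "diff C i x = \<zero>\<^bsub>obj C (i - 1)\<^esub>" and xy: "\<phi> i x = diff C' (i + 1) y"
  have bij: "bij_betw (homology_map C' \<phi> i) (carrier (homology C i)) (carrier (homology C' i))" for i
    using q by (simp add: quasi_iso_def)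
  let ?c = "\<lambda>i x. boundaries C i +>\<^bsub>obj C i\<^esub> x" and ?c' = "\<lambda>i x. boundaries C' i +>\<^bsub>obj C' i\<^esub> x"
  have xc: "x \<in> carrier (obj C i)" and yc: "y \<in> carrier (obj C' (i + 1))"
    using C.ob.gr.homog_carrier[OF x] C'.ob.gr.homog_carrier[OF y] .
  have xz: "x \<in> cycles C i" using xc dx by (simp add: cycles_def)
  have "\<phi> i x \<in> boundaries C' i" using xy C'.boundariesI[OF yc] by simp
  then have "?c' i (\<phi> i x) = boundaries C' i"
    using C'.ob.M.coset_eq_iff[OF C'.boundaries_additive_subgroup] map_closed[OF xc] by blast
  also have "\<dots> = ?c' i (\<phi> i \<zero>\<^bsub>obj C i\<^esub>)"
    using C'.homology_zero[of i] by (simp add: homology_simps)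
  finally have "homology_map C' \<phi> i (?c i x) = homology_map C' \<phi> i (?c i \<zero>\<^bsub>obj C i\<^esub>)"
    by (simp add: homology_map_coset xz C.cycles_closed(3))
  then have "?c i x = ?c i \<zero>\<^bsub>obj C i\<^esub>"
    by (rule inj_onD[OF bij_betw_imp_inj_on[OF bij]])
      (use xz C.cycles_closed(3) in \<open>auto simp: homology_simps\<close>)
  then have "?c i x = boundaries C i"
    using C.homology_zero[of i] by (simp add: homology_simps)
  then have "x \<in> boundaries C i"
    using C.ob.M.coset_eq_iff[OF C.boundaries_additive_subgroup xc] by simp
  then obtain u0 where u0: "u0 \<in> hcomp (obj C (i + 1)) j" "diff C (i + 1) u0 = x"
    using C.hpart_boundaries[of x i j] C.ob.gr.hpart_homog[OF x] by auto
  have u0c: "u0 \<in> carrier (obj C (i + 1))" using C.ob.gr.homog_carrier[OF u0(1)] .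
  let ?M' = "obj C' (i + 1)"
  let ?z = "y \<oplus>\<^bsub>?M'\<^esub> \<ominus>\<^bsub>?M'\<^esub> \<phi> (i + 1) u0"
  have zc: "?z \<in> carrier ?M'" using yc u0c by simp
  have zh: "?z \<in> hcomp ?M' j"
    using C'.ob.gr.homog_add[OF y C'.ob.gr.homog_neg[OF map_homog[OF u0(1)]]] .
  have "diff C' (i + 1) ?z = diff C' (i + 1) y \<oplus>\<^bsub>obj C' i\<^esub> \<ominus>\<^bsub>obj C' i\<^esub> diff C' (i + 1) (\<phi> (i + 1) u0)"
    using yc u0c C'.d_add[of y "i + 1"] C'.d_neg[of "\<phi> (i + 1) u0" "i + 1"] by simp
  also have "\<dots> = \<zero>\<^bsub>obj C' i\<^esub>"
    using xy map_d_up[OF u0c] u0(2) xc map_closed[OF xc] by (simp add: C'.ob.M.r_neg)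
  finally have "?z \<in> cycles C' (i + 1)" using zc by (simp add: cycles_def)
  then have "?c' (i + 1) ?z \<in> carrier (homology C' (i + 1))"
    unfolding homology_simps by (rule imageI)
  then have "?c' (i + 1) ?z \<in> homology_map C' \<phi> (i + 1) ` carrier (homology C (i + 1))"
    unfolding bij_betw_imp_surj_on[OF bij] .
  then obtain c where c: "c \<in> cycles C (i + 1)" "?c' (i + 1) ?z = ?c' (i + 1) (\<phi> (i + 1) c)"
    using homology_map_coset unfolding homology_simps by fastforce
  have cc: "c \<in> carrier (obj C (i + 1))" using C.cycles_carrier[OF c(1)] .
  interpret B': abelian_subgroup "boundaries C' (i + 1)" ?M' by (rule C'.boundaries_abelian_subgroup)
  have "?z \<in> ?c' (i + 1) ?z"
    using B'.zero_closed zc by (force simp: a_r_coset_def')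
  then have "?z \<oplus>\<^bsub>?M'\<^esub> \<ominus>\<^bsub>?M'\<^esub> \<phi> (i + 1) c \<in> boundaries C' (i + 1)"
    using c(2) B'.a_rcos_module_imp[of "\<phi> (i + 1) c" ?z] cc by simp
  then obtain v where v: "v \<in> hcomp (obj C' (i + 2)) j"
    "diff C' (i + 2) v = hpart ?M' (hcomp ?M') j (?z \<oplus>\<^bsub>?M'\<^esub> \<ominus>\<^bsub>?M'\<^esub> \<phi> (i + 1) c)"
    using C'.hpart_boundaries[of _ "i + 1" j] by (auto simp: add.assoc)
  \<comment> \<open>The cycle \<open>c\<close> need not be homogeneous; as \<phi> and the
    differentials commute with components, its component of degree \<open>j\<close> serves as
    well.\<close>
  let ?cj = "hpart (obj C (i + 1)) (hcomp (obj C (i + 1))) j c"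
  have cj: "?cj \<in> hcomp (obj C (i + 1)) j" "?cj \<in> carrier (obj C (i + 1))"
    using C.ob.gr.hpart_in[OF cc] C.ob.gr.hpart_carrier[OF cc] .
  have dcj: "diff C (i + 1) ?cj = \<zero>\<^bsub>obj C i\<^esub>"
    using C.d_hpart[OF cc, of j] c(1) by (simp add: cycles_def)
  have dv: "diff C' (i + 2) v = ?z \<oplus>\<^bsub>?M'\<^esub> \<ominus>\<^bsub>?M'\<^esub> \<phi> (i + 1) ?cj"
    using v(2) zc cc C'.ob.gr.hpart_homog[OF zh] map_hpart[OF cc, of j]
    by (simp add: C'.ob.gr.hpart_add C'.ob.gr.hpart_neg)
  show "\<exists>u\<in>hcomp (obj C (i + 1)) j. \<exists>v\<in>hcomp (obj C' (i + 2)) j.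
      diff C (i + 1) u = x \<and> y = \<phi> (i + 1) u \<oplus>\<^bsub>?M'\<^esub> diff C' (i + 2) v"
  proof (intro bexI conjI)
    show "u0 \<oplus>\<^bsub>obj C (i + 1)\<^esub> ?cj \<in> hcomp (obj C (i + 1)) j" "v \<in> hcomp (obj C' (i + 2)) j"
      using C.ob.gr.homog_add[OF u0(1) cj(1)] v(1) .
    show "diff C (i + 1) (u0 \<oplus>\<^bsub>obj C (i + 1)\<^esub> ?cj) = x"
      using C.d_add[OF u0c cj(2)] dcj u0(2) xc by simp
    have "\<phi> (i + 1) u0 \<in> carrier ?M'" "\<phi> (i + 1) ?cj \<in> carrier ?M'" using u0c cj(2) by auto
    then show "y = \<phi> (i + 1) (u0 \<oplus>\<^bsub>obj C (i + 1)\<^esub> ?cj) \<oplus>\<^bsub>?M'\<^esub> diff C' (i + 2) v"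
      using yc map_add[OF u0c cj(2)] dv
      by (simp add: C'.ob.M.a_ac C'.ob.M.r_neg1 C'.ob.M.r_neg2 C'.ob.M.r_neg)
  qed
qed

end

section \<open>Maps between mapping cones\<close>

locale cone_map = gcx_map R k G C C' \<phi>
    + X: cone_cx R k G C w D pr + X': cone_cx R k G C' w D' pr'
  for R :: "'r ring" (structure) and k G and C :: "('r, 'm) gcomplex" and C' :: "('r, 'n) gcomplex"
    and \<phi> w and D :: "('r, 'p) gcomplex" and pr and D' :: "('r, 'q) gcomplex" and pr' +
  fixes \<psi> :: "int \<Rightarrow> 'p \<Rightarrow> 'q"
  assumes \<psi>_pr: "a \<in> carrier (obj C i) \<Longrightarrow> b \<in> carrier (obj C (i - 1)) \<Longrightarrow>
    \<psi> i (pr i a b) = pr' i (\<phi> i a) (\<phi> (i - 1) b)"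
begin

lemma chain_map_cone: "chain_map R D D' \<psi>"
  unfolding chain_map_def
proof (intro conjI allI ballI)
  fix i
  show "\<psi> i \<in> gr_hom R (obj D i) (obj D' i)"
  proof (rule gr_homI)
    fix x assume "x \<in> carrier (obj D i)"
    then obtain a b where ab: "a \<in> carrier (obj C i)" "b \<in> carrier (obj C (i - 1))" "x = pr i a b"
      using X.pr_cases by blast
    show "\<psi> i x \<in> carrier (obj D' i)"
      unfolding ab(3) \<psi>_pr[OF ab(1,2)] using ab by (intro X'.pr_closed) auto
    show "\<psi> i (r \<odot>\<^bsub>obj D i\<^esub> x) = r \<odot>\<^bsub>obj D' i\<^esub> \<psi> i x" if "r \<in> carrier R" for r
      using that ab by (simp add: X.pr_smult X'.pr_smult \<psi>_pr map_smult)
    fix y assume "y \<in> carrier (obj D i)"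
    then obtain a' b' where ab': "a' \<in> carrier (obj C i)" "b' \<in> carrier (obj C (i - 1))" "y = pr i a' b'"
      using X.pr_cases by blast
    show "\<psi> i (x \<oplus>\<^bsub>obj D i\<^esub> y) = \<psi> i x \<oplus>\<^bsub>obj D' i\<^esub> \<psi> i y"
      using ab ab' by (simp add: X.pr_add X'.pr_add \<psi>_pr map_add)
  next
    fix x j assume x: "x \<in> hcomp (obj D i) j"
    interpret D: graded_module R G "obj D i" by (rule X.D_gm)
    obtain a b where ab: "a \<in> carrier (obj C i)" "b \<in> carrier (obj C (i - 1))" "x = pr i a b"
      using X.pr_cases D.gr.homog_carrier[OF x] by blast
    show "\<psi> i x \<in> hcomp (obj D' i) j"
      using x ab map_homog[of a i j] map_homog[of b "i - 1" "j - 1"]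
      by (simp add: X.pr_homog X'.pr_homog \<psi>_pr)
  qed
  fix x assume "x \<in> carrier (obj D i)"
  then obtain a b where ab: "a \<in> carrier (obj C i)" "b \<in> carrier (obj C (i - 1))" "x = pr i a b"
    using X.pr_cases by blast
  note cl = X.cone_diff_closed[OF ab(1,2)]
  have "\<psi> (i - 1) (diff D i x) = pr' (i - 1)
      (\<phi> (i - 1) (diff C i a \<oplus>\<^bsub>obj C (i - 1)\<^esub> w \<odot>\<^bsub>obj C (i - 1)\<^esub> b))
      (\<phi> (i - 1 - 1) (\<ominus>\<^bsub>obj C (i - 2)\<^esub> diff C (i - 1) b))"
    unfolding ab(3) X.pr_diff[OF ab(1,2)] by (rule \<psi>_pr) (use cl in auto)
  also have "\<dots> = diff D' i (\<psi> i x)"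
    using ab cl X.d_closed2[OF ab(2)] map_d[OF ab(2)] map_d[OF ab(1)]
    by (simp add: \<psi>_pr X'.pr_diff map_add map_neg map_smult)
  finally show "\<psi> (i - 1) (diff D i x) = diff D' i (\<psi> i x)" .
qed

lemma pr_homogE:
  assumes "x \<in> hcomp (obj D i) j"
  obtains a b where "a \<in> hcomp (obj C i) j" "b \<in> hcomp (obj C (i - 1)) (j - 1)"
    "a \<in> carrier (obj C i)" "b \<in> carrier (obj C (i - 1))" "x = pr i a b"
proof -
  interpret D: graded_module R G "obj D i" by (rule X.D_gm)
  obtain a b where ab: "a \<in> carrier (obj C i)" "b \<in> carrier (obj C (i - 1))" "x = pr i a b"
    using X.pr_cases D.gr.homog_carrier[OF assms] by blast
  then show thesis using that X.pr_homog assms by blast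
qed

lemma pr_homogE':
  assumes "x \<in> hcomp (obj D' i) j"
  obtains a b where "a \<in> hcomp (obj C' i) j" "b \<in> hcomp (obj C' (i - 1)) (j - 1)"
    "a \<in> carrier (obj C' i)" "b \<in> carrier (obj C' (i - 1))" "x = pr' i a b"
proof -
  interpret D: graded_module R G "obj D' i" by (rule X'.D_gm)
  obtain a b where ab: "a \<in> carrier (obj C' i)" "b \<in> carrier (obj C' (i - 1))" "x = pr' i a b"
    using X'.pr_cases D.gr.homog_carrier[OF assms] by blast
  then show thesis using that X'.pr_homog assms by blast
qed

text \<open>Reads the filling problem for \<psi> in cone coordinates, so that each of the two
  criteria below only has to solve four equations between chains of \<open>C\<close> and
  \<open>C'\<close>.\<close>

lemma acyclic_map_coneI:
  assumes fill: "\<And>i j x0 x1 y0 y1.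
    x0 \<in> hcomp (obj C i) j \<Longrightarrow> x1 \<in> hcomp (obj C (i - 1)) (j - 1) \<Longrightarrow>
    y0 \<in> hcomp (obj C' (i + 1)) j \<Longrightarrow> y1 \<in> hcomp (obj C' i) (j - 1) \<Longrightarrow>
    diff C i x0 \<oplus>\<^bsub>obj C (i - 1)\<^esub> w \<odot>\<^bsub>obj C (i - 1)\<^esub> x1 = \<zero>\<^bsub>obj C (i - 1)\<^esub> \<Longrightarrow>
    diff C (i - 1) x1 = \<zero>\<^bsub>obj C (i - 1 - 1)\<^esub> \<Longrightarrow>
    \<phi> i x0 = diff C' (i + 1) y0 \<oplus>\<^bsub>obj C' i\<^esub> w \<odot>\<^bsub>obj C' i\<^esub> y1 \<Longrightarrow>
    \<phi> (i - 1) x1 = \<ominus>\<^bsub>obj C' (i - 1)\<^esub> diff C' i y1 \<Longrightarrow>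
    \<exists>u0\<in>hcomp (obj C (i + 1)) j. \<exists>u1\<in>hcomp (obj C i) (j - 1).
      \<exists>v0\<in>hcomp (obj C' (i + 2)) j. \<exists>v1\<in>hcomp (obj C' (i + 1)) (j - 1).
        diff C (i + 1) u0 \<oplus>\<^bsub>obj C i\<^esub> w \<odot>\<^bsub>obj C i\<^esub> u1 = x0 \<and>
        \<ominus>\<^bsub>obj C (i - 1)\<^esub> diff C i u1 = x1 \<and>
        y0 = \<phi> (i + 1) u0 \<oplus>\<^bsub>obj C' (i + 1)\<^esub>
          (diff C' (i + 2) v0 \<oplus>\<^bsub>obj C' (i + 1)\<^esub> w \<odot>\<^bsub>obj C' (i + 1)\<^esub> v1) \<and>
        y1 = \<phi> i u1 \<oplus>\<^bsub>obj C' i\<^esub> \<ominus>\<^bsub>obj C' i\<^esub> diff C' (i + 1) v1"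
  shows "acyclic_map D D' \<psi>"
  unfolding acyclic_map_def
proof (intro allI ballI impI)
  fix i j x y
  assume x: "x \<in> hcomp (obj D i) j" and y: "y \<in> hcomp (obj D' (i + 1)) j"
    and dx: "diff D i x = \<zero>\<^bsub>obj D (i - 1)\<^esub>" and xy: "\<psi> i x = diff D' (i + 1) y"
  have idx: "i + 1 - 1 = i" "i + 1 - 2 = i - 1" "i + 2 - 1 = i + 1" "i + 2 - 2 = i" by simp_all
  obtain x0 x1 where x01: "x0 \<in> hcomp (obj C i) j" "x1 \<in> hcomp (obj C (i - 1)) (j - 1)"
    and xc: "x0 \<in> carrier (obj C i)" "x1 \<in> carrier (obj C (i - 1))" and x_eq: "x = pr i x0 x1"
    using pr_homogE[OF x] .
  obtain y0 y1 where y01: "y0 \<in> hcomp (obj C' (i + 1)) j" "y1 \<in> hcomp (obj C' i) (j - 1)"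
    and yc: "y0 \<in> carrier (obj C' (i + 1))" "y1 \<in> carrier (obj C' i)" and y_eq: "y = pr' (i + 1) y0 y1"
    using pr_homogE'[OF y, unfolded idx] .
  note clx = X.cone_diff_closed[OF xc]
  note cly = X'.cone_diff_closed[of y0 "i + 1" y1, unfolded idx, OF yc]
  have "diff C i x0 \<oplus>\<^bsub>obj C (i - 1)\<^esub> w \<odot>\<^bsub>obj C (i - 1)\<^esub> x1 = \<zero>\<^bsub>obj C (i - 1)\<^esub> \<and>
      \<ominus>\<^bsub>obj C (i - 2)\<^esub> diff C (i - 1) x1 = \<zero>\<^bsub>obj C (i - 2)\<^esub>"
    using dx clx X.pr_inj[of _ "i - 1"] unfolding x_eq X.pr_diff[OF xc] X.pr_zero by auto
  then have dx0: "diff C i x0 \<oplus>\<^bsub>obj C (i - 1)\<^esub> w \<odot>\<^bsub>obj C (i - 1)\<^esub> x1 = \<zero>\<^bsub>obj C (i - 1)\<^esub>"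
    and dx1: "diff C (i - 1) x1 = \<zero>\<^bsub>obj C (i - 1 - 1)\<^esub>"
    using C.ob.M.add.inv_eq_1_iff[OF X.d_closed2[OF xc(2)]] by auto
  have "pr' i (\<phi> i x0) (\<phi> (i - 1) x1) = pr' i (diff C' (i + 1) y0 \<oplus>\<^bsub>obj C' i\<^esub> w \<odot>\<^bsub>obj C' i\<^esub> y1)
      (\<ominus>\<^bsub>obj C' (i - 1)\<^esub> diff C' i y1)"
    using xy X'.pr_diff[of y0 "i + 1" y1, unfolded idx, OF yc] unfolding x_eq \<psi>_pr[OF xc] y_eq by simp
  then have "\<phi> i x0 = diff C' (i + 1) y0 \<oplus>\<^bsub>obj C' i\<^esub> w \<odot>\<^bsub>obj C' i\<^esub> y1"
    and "\<phi> (i - 1) x1 = \<ominus>\<^bsub>obj C' (i - 1)\<^esub> diff C' i y1"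
    using X'.pr_inj[of "\<phi> i x0" i "\<phi> (i - 1) x1"] cly map_closed[OF xc(1)] map_closed[OF xc(2)] by auto
  from fill[OF x01 y01 dx0 dx1 this] obtain u0 u1 v0 v1 where
    u: "u0 \<in> hcomp (obj C (i + 1)) j" "u1 \<in> hcomp (obj C i) (j - 1)"
    and v: "v0 \<in> hcomp (obj C' (i + 2)) j" "v1 \<in> hcomp (obj C' (i + 1)) (j - 1)"
    and du: "diff C (i + 1) u0 \<oplus>\<^bsub>obj C i\<^esub> w \<odot>\<^bsub>obj C i\<^esub> u1 = x0" "\<ominus>\<^bsub>obj C (i - 1)\<^esub> diff C i u1 = x1"
    and uv: "y0 = \<phi> (i + 1) u0 \<oplus>\<^bsub>obj C' (i + 1)\<^esub>
          (diff C' (i + 2) v0 \<oplus>\<^bsub>obj C' (i + 1)\<^esub> w \<odot>\<^bsub>obj C' (i + 1)\<^esub> v1)"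
      "y1 = \<phi> i u1 \<oplus>\<^bsub>obj C' i\<^esub> \<ominus>\<^bsub>obj C' i\<^esub> diff C' (i + 1) v1"
    by blast
  note uc = C.ob.gr.homog_carrier[OF u(1)] C.ob.gr.homog_carrier[OF u(2)]
    and vc = C'.ob.gr.homog_carrier[OF v(1)] C'.ob.gr.homog_carrier[OF v(2)]
  show "\<exists>u\<in>hcomp (obj D (i + 1)) j. \<exists>v\<in>hcomp (obj D' (i + 2)) j.
      diff D (i + 1) u = x \<and> y = \<psi> (i + 1) u \<oplus>\<^bsub>obj D' (i + 1)\<^esub> diff D' (i + 2) v"
  proof (intro bexI conjI)
    show "pr (i + 1) u0 u1 \<in> hcomp (obj D (i + 1)) j"
      using X.pr_homog[of u0 "i + 1" u1 j, unfolded idx, OF uc] u by simp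
    show "pr' (i + 2) v0 v1 \<in> hcomp (obj D' (i + 2)) j"
      using X'.pr_homog[of v0 "i + 2" v1 j, unfolded idx, OF vc] v by simp
    show "diff D (i + 1) (pr (i + 1) u0 u1) = x"
      unfolding X.pr_diff[of u0 "i + 1" u1, unfolded idx, OF uc] du x_eq ..
    have "\<psi> (i + 1) (pr (i + 1) u0 u1) \<oplus>\<^bsub>obj D' (i + 1)\<^esub> diff D' (i + 2) (pr' (i + 2) v0 v1) =
        pr' (i + 1) y0 y1"
      unfolding uv \<psi>_pr[of u0 "i + 1" u1, unfolded idx, OF uc]
        X'.pr_diff[of v0 "i + 2" v1, unfolded idx, OF vc]
      by (rule X'.pr_add[of _ "i + 1", unfolded idx])
        (use uc vc C'.d_closed[OF vc(1), unfolded idx] C'.d_up_closed[OF vc(2)] in auto)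
    then show "y = \<psi> (i + 1) (pr (i + 1) u0 u1) \<oplus>\<^bsub>obj D' (i + 1)\<^esub> diff D' (i + 2) (pr' (i + 2) v0 v1)"
      unfolding y_eq by (rule sym)
  qed
qed

text \<open>Acyclicity of \<phi> is used twice: first for the second coordinates, which yields
  \<open>u1\<close> and \<open>v1\<close>, then for the first coordinates after these have been
  corrected by \<open>w u1\<close> and \<open>w v1\<close>.\<close>

lemma acyclic_map_cone:
  assumes ac: "acyclic_map C C' \<phi>"
  shows "acyclic_map D D' \<psi>"
proof (rule acyclic_map_coneI)
  fix i j x0 x1 y0 y1
  let ?X = "obj C i" and ?Y = "obj C' i" and ?Y1 = "obj C' (i + 1)"
  assume x01: "x0 \<in> hcomp ?X j" "x1 \<in> hcomp (obj C (i - 1)) (j - 1)"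
    and y01: "y0 \<in> hcomp ?Y1 j" "y1 \<in> hcomp ?Y (j - 1)"
    and dx0: "diff C i x0 \<oplus>\<^bsub>obj C (i - 1)\<^esub> w \<odot>\<^bsub>obj C (i - 1)\<^esub> x1 = \<zero>\<^bsub>obj C (i - 1)\<^esub>"
    and dx1: "diff C (i - 1) x1 = \<zero>\<^bsub>obj C (i - 1 - 1)\<^esub>"
    and px0: "\<phi> i x0 = diff C' (i + 1) y0 \<oplus>\<^bsub>?Y\<^esub> w \<odot>\<^bsub>?Y\<^esub> y1"
    and px1: "\<phi> (i - 1) x1 = \<ominus>\<^bsub>obj C' (i - 1)\<^esub> diff C' i y1"
  note xc = C.ob.gr.homog_carrier[OF x01(1)] C.ob.gr.homog_carrier[OF x01(2)]
    and yc = C'.ob.gr.homog_carrier[OF y01(1)] C'.ob.gr.homog_carrier[OF y01(2)]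
  have idx: "i - 1 + 1 = i" "i - 1 + 2 = i + 1" "i + 2 - 1 = i + 1" by simp_all
  have "\<phi> (i - 1) x1 = diff C' i (\<ominus>\<^bsub>?Y\<^esub> y1)"
    using px1 C'.d_neg[OF yc(2)] by simp
  then obtain u1 v1 where uv1: "u1 \<in> hcomp ?X (j - 1)" "v1 \<in> hcomp ?Y1 (j - 1)"
    and du1: "diff C i u1 = x1" and y1: "\<ominus>\<^bsub>?Y\<^esub> y1 = \<phi> i u1 \<oplus>\<^bsub>?Y\<^esub> diff C' (i + 1) v1"
    using acyclic_mapD[OF ac x01(2) _ dx1, unfolded idx, OF C'.ob.gr.homog_neg[OF y01(2)]] by blast
  note uv1c = C.ob.gr.homog_carrier[OF uv1(1)] C'.ob.gr.homog_carrier[OF uv1(2)]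
  have dv1c: "diff C' (i + 1) v1 \<in> carrier ?Y" by (rule C'.d_up_closed[OF uv1c(2)])
  have dy0c: "diff C' (i + 1) y0 \<in> carrier ?Y" by (rule C'.d_up_closed[OF yc(1)])
  \<comment> \<open>Chosen so that \<open>?a\<close> is a cycle and \<open>?b\<close> bounds its
    image under \<phi>.\<close>
  let ?a = "x0 \<oplus>\<^bsub>?X\<^esub> w \<odot>\<^bsub>?X\<^esub> u1" and ?b = "y0 \<oplus>\<^bsub>?Y1\<^esub> \<ominus>\<^bsub>?Y1\<^esub> (w \<odot>\<^bsub>?Y1\<^esub> v1)"
  have ah: "?a \<in> hcomp ?X j"
    using C.ob.gr.homog_add[OF x01(1)] X.w_homog[OF uv1(1)] by simp
  have bh: "?b \<in> hcomp ?Y1 j"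
    using C'.ob.gr.homog_add[OF y01(1) C'.ob.gr.homog_neg] X'.w_homog[OF uv1(2)] by simp
  have da: "diff C i ?a = \<zero>\<^bsub>obj C (i - 1)\<^esub>"
    using dx0 du1 xc uv1c by (simp add: C.d_add C.d_smult)
  have y1': "y1 = \<ominus>\<^bsub>?Y\<^esub> (\<phi> i u1 \<oplus>\<^bsub>?Y\<^esub> diff C' (i + 1) v1)"
    using y1 yc(2) by (metis C'.ob.M.minus_minus)
  have "\<phi> i ?a = (diff C' (i + 1) y0 \<oplus>\<^bsub>?Y\<^esub> w \<odot>\<^bsub>?Y\<^esub> y1) \<oplus>\<^bsub>?Y\<^esub> w \<odot>\<^bsub>?Y\<^esub> \<phi> i u1"
    using xc uv1c px0 by (simp add: map_add map_smult)
  also have "\<dots> = diff C' (i + 1) y0 \<oplus>\<^bsub>?Y\<^esub> w \<odot>\<^bsub>?Y\<^esub> (y1 \<oplus>\<^bsub>?Y\<^esub> \<phi> i u1)"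
    using dy0c yc(2) uv1c by (simp add: C'.ob.smult_r_distr C'.ob.M.a_assoc)
  also have "y1 \<oplus>\<^bsub>?Y\<^esub> \<phi> i u1 = \<ominus>\<^bsub>?Y\<^esub> diff C' (i + 1) v1"
    unfolding y1' using uv1c dv1c
    by (simp add: C'.ob.M.minus_add C'.ob.M.a_ac C'.ob.M.r_neg C'.ob.M.r_neg1 C'.ob.M.r_neg2)
  also have "diff C' (i + 1) y0 \<oplus>\<^bsub>?Y\<^esub> w \<odot>\<^bsub>?Y\<^esub> (\<ominus>\<^bsub>?Y\<^esub> diff C' (i + 1) v1) = diff C' (i + 1) ?b"
    using yc uv1c dv1c C'.d_add[of y0 "i + 1"] C'.d_neg[of "w \<odot>\<^bsub>?Y1\<^esub> v1" "i + 1"]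
      C'.d_smult[OF X.w_carrier uv1c(2)] by (simp add: C'.ob.smult_r_minus)
  finally obtain u0 v0 where uv0: "u0 \<in> hcomp (obj C (i + 1)) j" "v0 \<in> hcomp (obj C' (i + 2)) j"
    and du0: "diff C (i + 1) u0 = ?a" and b: "?b = \<phi> (i + 1) u0 \<oplus>\<^bsub>?Y1\<^esub> diff C' (i + 2) v0"
    using acyclic_mapD[OF ac ah bh da] by metis
  note uv0c = C.ob.gr.homog_carrier[OF uv0(1)] C'.ob.gr.homog_carrier[OF uv0(2)]
  have "y0 = ?b \<oplus>\<^bsub>?Y1\<^esub> w \<odot>\<^bsub>?Y1\<^esub> v1" using yc uv1c by (simp add: C'.ob.M.neg_add_cancel)
  also have "\<dots> = \<phi> (i + 1) u0 \<oplus>\<^bsub>?Y1\<^esub> (diff C' (i + 2) v0 \<oplus>\<^bsub>?Y1\<^esub> w \<odot>\<^bsub>?Y1\<^esub> v1)"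
    unfolding b using uv0c uv1c C'.d_closed[OF uv0c(2), unfolded idx] by (simp add: C'.ob.M.a_assoc)
  finally have y0: "y0 = \<phi> (i + 1) u0 \<oplus>\<^bsub>?Y1\<^esub> (diff C' (i + 2) v0 \<oplus>\<^bsub>?Y1\<^esub> w \<odot>\<^bsub>?Y1\<^esub> v1)" .
  \<comment> \<open>The cone differential negates the second coordinate, so the filler uses
    \<open>- u1\<close>.\<close>
  have "diff C (i + 1) u0 \<oplus>\<^bsub>?X\<^esub> w \<odot>\<^bsub>?X\<^esub> (\<ominus>\<^bsub>?X\<^esub> u1) = x0"
    "\<ominus>\<^bsub>obj C (i - 1)\<^esub> diff C i (\<ominus>\<^bsub>?X\<^esub> u1) = x1"
    unfolding du0 using xc uv1c du1 C.d_neg[OF uv1c(1)]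
    by (simp_all add: C.ob.smult_r_minus C.ob.M.add_neg_cancel)
  moreover have "y1 = \<phi> i (\<ominus>\<^bsub>?X\<^esub> u1) \<oplus>\<^bsub>?Y\<^esub> \<ominus>\<^bsub>?Y\<^esub> diff C' (i + 1) v1"
    using y1' uv1c dv1c by (simp add: map_neg C'.ob.M.minus_add)
  ultimately show "\<exists>u0\<in>hcomp (obj C (i + 1)) j. \<exists>u1\<in>hcomp ?X (j - 1).
      \<exists>v0\<in>hcomp (obj C' (i + 2)) j. \<exists>v1\<in>hcomp ?Y1 (j - 1).
        diff C (i + 1) u0 \<oplus>\<^bsub>?X\<^esub> w \<odot>\<^bsub>?X\<^esub> u1 = x0 \<and> \<ominus>\<^bsub>obj C (i - 1)\<^esub> diff C i u1 = x1 \<and>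
        y0 = \<phi> (i + 1) u0 \<oplus>\<^bsub>?Y1\<^esub> (diff C' (i + 2) v0 \<oplus>\<^bsub>?Y1\<^esub> w \<odot>\<^bsub>?Y1\<^esub> v1) \<and>
        y1 = \<phi> i u1 \<oplus>\<^bsub>?Y\<^esub> \<ominus>\<^bsub>?Y\<^esub> diff C' (i + 1) v1"
    using uv0 C.ob.gr.homog_neg[OF uv1(1)] uv1(2) y0 by blast
qed

text \<open>If \<open>w\<close> acts bijectively on the cokernel of \<open>\<phi>\<close>, then the cone of \<open>w\<close> on this cokernel is
  contractible.\<close>

lemma acyclic_map_cone_of_bijective:
  assumes inj: "\<And>i. inj_on (\<phi> i) (carrier (obj C i))"
    and surj: "\<And>i j y. y \<in> hcomp (obj C' i) j \<Longrightarrow>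
      \<exists>v\<in>hcomp (obj C' i) (j - 1). \<exists>x\<in>hcomp (obj C i) j. w \<odot>\<^bsub>obj C' i\<^esub> v = y \<oplus>\<^bsub>obj C' i\<^esub> \<phi> i x"
    and reg: "\<And>i j y. y \<in> hcomp (obj C' i) j \<Longrightarrow>
      w \<odot>\<^bsub>obj C' i\<^esub> y \<in> \<phi> i ` hcomp (obj C i) (j + 1) \<Longrightarrow> y \<in> \<phi> i ` hcomp (obj C i) j"
  shows "acyclic_map D D' \<psi>"
proof (rule acyclic_map_coneI)
  fix i j x0 x1 y0 y1
  let ?X = "obj C i" and ?X1 = "obj C (i + 1)" and ?Y = "obj C' i" and ?Y1 = "obj C' (i + 1)"
  assume x01: "x0 \<in> hcomp ?X j" "x1 \<in> hcomp (obj C (i - 1)) (j - 1)"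
    and y01: "y0 \<in> hcomp ?Y1 j" "y1 \<in> hcomp ?Y (j - 1)"
    and px0: "\<phi> i x0 = diff C' (i + 1) y0 \<oplus>\<^bsub>?Y\<^esub> w \<odot>\<^bsub>?Y\<^esub> y1"
    and px1: "\<phi> (i - 1) x1 = \<ominus>\<^bsub>obj C' (i - 1)\<^esub> diff C' i y1"
  note xc = C.ob.gr.homog_carrier[OF x01(1)] C.ob.gr.homog_carrier[OF x01(2)]
    and yc = C'.ob.gr.homog_carrier[OF y01(1)] C'.ob.gr.homog_carrier[OF y01(2)]
  have idx: "i + 2 - 1 = i + 1" by simp
  obtain v1 p where v1: "v1 \<in> hcomp ?Y1 (j - 1)" and p: "p \<in> hcomp ?X1 j"
    and wv1: "w \<odot>\<^bsub>?Y1\<^esub> v1 = y0 \<oplus>\<^bsub>?Y1\<^esub> \<phi> (i + 1) p"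
    using surj[OF y01(1)] by blast
  have v1c: "v1 \<in> carrier ?Y1" and pc: "p \<in> carrier ?X1"
    using C.ob.gr.homog_carrier[OF p] C'.ob.gr.homog_carrier[OF v1] by auto
  have dv1c: "diff C' (i + 1) v1 \<in> carrier ?Y" by (rule C'.d_up_closed[OF v1c])
  have dy0c: "diff C' (i + 1) y0 \<in> carrier ?Y" by (rule C'.d_up_closed[OF yc(1)])
  have dpc: "diff C (i + 1) p \<in> carrier ?X" by (rule C.d_up_closed[OF pc])
  \<comment> \<open>\<open>w\<close> times this correction of \<open>y1\<close> lies in the image of
    \<phi>, so by \<open>reg\<close> the correction itself does.\<close>
  let ?q = "y1 \<oplus>\<^bsub>?Y\<^esub> diff C' (i + 1) v1"
  have qh: "?q \<in> hcomp ?Y (j - 1)"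
    by (rule C'.ob.gr.homog_add[OF y01(2) C'.d_up_homog[OF v1]])
  have "w \<odot>\<^bsub>?Y\<^esub> diff C' (i + 1) v1 = diff C' (i + 1) (w \<odot>\<^bsub>?Y1\<^esub> v1)"
    using C'.d_smult[OF X.w_carrier v1c] by simp
  also have "\<dots> = diff C' (i + 1) y0 \<oplus>\<^bsub>?Y\<^esub> \<phi> i (diff C (i + 1) p)"
    unfolding wv1 map_d_up[OF pc] using C'.d_add[OF yc(1) map_closed[OF pc]] by simp
  finally have "w \<odot>\<^bsub>?Y\<^esub> ?q = \<phi> i x0 \<oplus>\<^bsub>?Y\<^esub> \<phi> i (diff C (i + 1) p)"
    unfolding px0 using yc dv1c dy0c map_closed[OF dpc]
    by (simp add: C'.ob.smult_r_distr C'.ob.M.a_ac)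
  then have wq: "w \<odot>\<^bsub>?Y\<^esub> ?q = \<phi> i (x0 \<oplus>\<^bsub>?X\<^esub> diff C (i + 1) p)"
    using map_add[OF xc(1) dpc] by simp
  then have "w \<odot>\<^bsub>?Y\<^esub> ?q \<in> \<phi> i ` hcomp ?X (j - 1 + 1)"
    using C.ob.gr.homog_add[OF x01(1) C.d_up_homog[OF p]] by simp
  then obtain q where q: "q \<in> hcomp ?X (j - 1)" "?q = \<phi> i q"
    using reg[OF qh] by blast
  have qc: "q \<in> carrier ?X" using C.ob.gr.homog_carrier[OF q(1)] .
  have "w \<odot>\<^bsub>?X\<^esub> q = x0 \<oplus>\<^bsub>?X\<^esub> diff C (i + 1) p"
    by (rule inj_onD[OF inj[of i]]) (use wq q(2) qc xc dpc in \<open>simp_all add: map_smult\<close>)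
  then have e1: "diff C (i + 1) (\<ominus>\<^bsub>?X1\<^esub> p) \<oplus>\<^bsub>?X\<^esub> w \<odot>\<^bsub>?X\<^esub> q = x0"
    using C.d_neg[OF pc] xc dpc by (simp add: C.ob.M.a_ac C.ob.M.r_neg2 C.ob.M.r_neg1 C.ob.M.l_neg C.ob.M.r_neg)
  have "\<phi> (i - 1) (\<ominus>\<^bsub>obj C (i - 1)\<^esub> diff C i q) = \<ominus>\<^bsub>obj C' (i - 1)\<^esub> diff C' i ?q"
    unfolding q(2) using qc by (simp add: map_neg map_d)
  also have "\<dots> = \<phi> (i - 1) x1"
    unfolding px1 using yc dv1c C'.d_d_up[OF v1c] by (simp add: C'.d_add)
  finally have e2: "\<ominus>\<^bsub>obj C (i - 1)\<^esub> diff C i q = x1"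
    by (rule inj_onD[OF inj[of "i - 1"]]) (use qc xc in auto)
  \<comment> \<open>As \<open>w v1\<close> equals \<open>y0\<close> modulo the image of \<phi>,
    nothing is left for \<open>v0\<close>, and zero will do.\<close>
  have e3: "y0 = \<phi> (i + 1) (\<ominus>\<^bsub>?X1\<^esub> p) \<oplus>\<^bsub>?Y1\<^esub>
      (diff C' (i + 2) \<zero>\<^bsub>obj C' (i + 2)\<^esub> \<oplus>\<^bsub>?Y1\<^esub> w \<odot>\<^bsub>?Y1\<^esub> v1)"
    using C'.d_zero[of "i + 2", unfolded idx] yc pc
    by (simp add: wv1 map_neg C'.ob.M.a_ac C'.ob.M.r_neg2 C'.ob.M.r_neg1 C'.ob.M.r_neg C'.ob.M.l_neg)
  have e4: "y1 = \<phi> i q \<oplus>\<^bsub>?Y\<^esub> \<ominus>\<^bsub>?Y\<^esub> diff C' (i + 1) v1"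
    unfolding q(2)[symmetric] using yc dv1c by (simp add: C'.ob.M.add_neg_cancel)
  show "\<exists>u0\<in>hcomp ?X1 j. \<exists>u1\<in>hcomp ?X (j - 1).
      \<exists>v0\<in>hcomp (obj C' (i + 2)) j. \<exists>v1\<in>hcomp ?Y1 (j - 1).
        diff C (i + 1) u0 \<oplus>\<^bsub>?X\<^esub> w \<odot>\<^bsub>?X\<^esub> u1 = x0 \<and> \<ominus>\<^bsub>obj C (i - 1)\<^esub> diff C i u1 = x1 \<and>
        y0 = \<phi> (i + 1) u0 \<oplus>\<^bsub>?Y1\<^esub> (diff C' (i + 2) v0 \<oplus>\<^bsub>?Y1\<^esub> w \<odot>\<^bsub>?Y1\<^esub> v1) \<and>
        y1 = \<phi> i u1 \<oplus>\<^bsub>?Y\<^esub> \<ominus>\<^bsub>?Y\<^esub> diff C' (i + 1) v1"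
    using C.ob.gr.homog_neg[OF p] q(1) C'.ob.gr.homog_zero v1 e1 e2 e3 e4 by blast
qed

end

section \<open>Koszul complexes and chain maps\<close>

definition koszul_map :: "nat \<Rightarrow> (int \<Rightarrow> 'm \<Rightarrow> 'n) \<Rightarrow> int \<Rightarrow> (nat set \<Rightarrow> 'm) \<Rightarrow> nat set \<Rightarrow> 'n" where
  "koszul_map n \<phi> i u = (\<lambda>S\<in>Pow {0..<n}. \<phi> (i - int (card S)) (u S))"

context gcx_map
begin

lemma koszul_map_hom: "koszul_map n \<phi> i \<in> gr_hom R (koszul_obj n C i) (koszul_obj n C' i)"
proof (rule gr_homI)
  fix x j assume "x \<in> hcomp (koszul_obj n C i) j"
  then show "koszul_map n \<phi> i x \<in> hcomp (koszul_obj n C' i) j"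
    using map_homog by (auto simp: koszul_map_def PiE_iff)
qed (auto simp: koszul_map_def fun_eq_iff map_add map_smult PiE_iff)

lemma koszul_map_pair:
  assumes "b \<in> carrier (koszul_obj n C (i - 1))"
  shows "koszul_map (Suc n) \<phi> i (koszul_pair R n C i a b) =
    koszul_pair R n C' i (koszul_map n \<phi> i a) (koszul_map n \<phi> (i - 1) b)"
proof (rule Pow_Suc_ext[of _ n])
  show "koszul_map (Suc n) \<phi> i (koszul_pair R n C i a b) \<in> extensional (Pow {0..<Suc n})"
    by (simp add: koszul_map_def)
  fix T assume T: "T \<subseteq> {0..<n}"
  then have T': "T \<subseteq> {0..<Suc n}" by auto
  show "koszul_map (Suc n) \<phi> i (koszul_pair R n C i a b) T =
      koszul_pair R n C' i (koszul_map n \<phi> i a) (koszul_map n \<phi> (i - 1) b) T"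
    using T T' by (simp add: koszul_map_def koszul_pair_low)
  show "koszul_map (Suc n) \<phi> i (koszul_pair R n C i a b) (insert n T) =
      koszul_pair R n C' i (koszul_map n \<phi> i a) (koszul_map n \<phi> (i - 1) b) (insert n T)"
    using T T' C.koszul_memD[OF assms T]
    by (simp add: koszul_map_def koszul_pair_high map_smult C.degree_insert_last)
qed simp

lemma koszul_map_Nil_const:
  "koszul_map 0 \<phi> i (\<lambda>T\<in>{{}}. x) = (\<lambda>T\<in>{{}}. \<phi> i x)"
  by (auto simp: koszul_map_def fun_eq_iff)

lemma chain_map_koszul_Nil:
  "chain_map R (koszul R [] C) (koszul R [] C') (koszul_map 0 \<phi>)"
  unfolding chain_map_def
proof (intro conjI allI ballI)
  show "koszul_map 0 \<phi> i \<in> gr_hom R (obj (koszul R [] C) i) (obj (koszul R [] C') i)" for i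
    using koszul_map_hom[of 0 i] by simp
  fix i x assume "x \<in> carrier (obj (koszul R [] C) i)"
  then have x: "x = (\<lambda>T\<in>{{}}. x {})" "x {} \<in> carrier (obj C i)"
    by (auto simp: PiE_iff fun_eq_iff extensional_def)
  show "koszul_map 0 \<phi> (i - 1) (diff (koszul R [] C) i x) = diff (koszul R [] C') i (koszul_map 0 \<phi> i x)"
    apply (subst (1 2) x(1))
    using x(2) C.koszul_diff_Nil_const[OF x(2)] C'.koszul_diff_Nil_const[OF map_closed[OF x(2)]]
      map_d[OF x(2)]
    by (simp add: koszul_map_Nil_const)
qed

lemma acyclic_map_koszul_Nil:
  assumes "acyclic_map C C' \<phi>"
  shows "acyclic_map (koszul R [] C) (koszul R [] C') (koszul_map 0 \<phi>)"
proof -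
  let ?c = "\<lambda>x. \<lambda>T\<in>{{} :: nat set}. x"
  have z: "zero (koszul_obj 0 C i) = ?c \<zero>\<^bsub>obj C i\<^esub>" for i by (simp add: fun_eq_iff)
  have add: "?c x \<oplus>\<^bsub>koszul_obj 0 C' i\<^esub> ?c y = ?c (x \<oplus>\<^bsub>obj C' i\<^esub> y)" for x y i
    by (simp add: fun_eq_iff)
  show ?thesis
    unfolding acyclic_map_def koszul_simps list.size C.hcomp_koszul_Nil C'.hcomp_koszul_Nil z
  proof (intro allI ballI impI)
    fix i j x y
    assume "x \<in> ?c ` hcomp (obj C i) j" "y \<in> ?c ` hcomp (obj C' (i + 1)) j"
    then obtain x' y' where x: "x' \<in> hcomp (obj C i) j" "x = ?c x'"
      and y: "y' \<in> hcomp (obj C' (i + 1)) j" "y = ?c y'" by blast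
    assume dx: "koszul_diff R [] C i x = ?c \<zero>\<^bsub>obj C (i - 1)\<^esub>"
      and xy: "koszul_map 0 \<phi> i x = koszul_diff R [] C' (i + 1) y"
    have "diff C i x' = \<zero>\<^bsub>obj C (i - 1)\<^esub>" "\<phi> i x' = diff C' (i + 1) y'"
      using dx xy C.koszul_diff_Nil_const[OF C.ob.gr.homog_carrier[OF x(1)]]
        C'.koszul_diff_Nil_const[OF C'.ob.gr.homog_carrier[OF y(1)]]
      unfolding x(2) y(2) koszul_map_Nil_const by (simp_all only: const_fun_eq_iff)
    then obtain u v where uv: "u \<in> hcomp (obj C (i + 1)) j" "v \<in> hcomp (obj C' (i + 2)) j"
      "diff C (i + 1) u = x'" "y' = \<phi> (i + 1) u \<oplus>\<^bsub>obj C' (i + 1)\<^esub> diff C' (i + 2) v"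
      using acyclic_mapD[OF assms x(1) y(1)] by metis
    show "\<exists>u\<in>?c ` hcomp (obj C (i + 1)) j. \<exists>v\<in>?c ` hcomp (obj C' (i + 2)) j.
        koszul_diff R [] C (i + 1) u = x \<and>
        y = koszul_map 0 \<phi> (i + 1) u \<oplus>\<^bsub>koszul_obj 0 C' (i + 1)\<^esub> koszul_diff R [] C' (i + 2) v"
    proof (intro bexI conjI)
      show "?c u \<in> ?c ` hcomp (obj C (i + 1)) j" "?c v \<in> ?c ` hcomp (obj C' (i + 2)) j"
        using uv(1,2) by simp_all
      show "koszul_diff R [] C (i + 1) (?c u) = x"
        unfolding x(2) C.koszul_diff_Nil_const[OF C.ob.gr.homog_carrier[OF uv(1)]] uv(3) ..
      show "y = koszul_map 0 \<phi> (i + 1) (?c u) \<oplus>\<^bsub>koszul_obj 0 C' (i + 1)\<^esub>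
          koszul_diff R [] C' (i + 2) (?c v)"
        unfolding y(2) koszul_map_Nil_const
          C'.koszul_diff_Nil_const[OF C'.ob.gr.homog_carrier[OF uv(2)]] add uv(4) ..
    qed
  qed
qed

text \<open>In cone coordinates the Koszul map on one more variable is the shorter Koszul map on
  each coordinate, which opens the cone lemmas to induction on the sequence.\<close>

lemma koszul_cone_map:
  assumes xs: "set xs \<subseteq> G 1" "w \<in> G 1"
    and cm: "chain_map R (koszul R xs C) (koszul R xs C') (koszul_map (length xs) \<phi>)"
  shows "cone_map R k G (koszul R xs C) (koszul R xs C') (koszul_map (length xs) \<phi>) w
    (koszul R (xs @ [w]) C) (koszul_pair R (length xs) C)
    (koszul R (xs @ [w]) C') (koszul_pair R (length xs) C') (koszul_map (length (xs @ [w])) \<phi>)"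
proof -
  note X = C.koszul_cone[OF C.graded_complex_koszul[OF xs(1)] xs]
    and X' = C'.koszul_cone[OF C'.graded_complex_koszul[OF xs(1)] xs]
  show ?thesis
  proof (intro cone_map.intro gcx_map.intro gcx_map_axioms.intro cone_map_axioms.intro X X' cm
      cone_cx.axioms(1)[OF X] cone_cx.axioms(1)[OF X'])
    fix i a b
    assume "b \<in> carrier (obj (koszul R xs C) (i - 1))"
    then show "koszul_map (length (xs @ [w])) \<phi> i (koszul_pair R (length xs) C i a b) =
        koszul_pair R (length xs) C' i (koszul_map (length xs) \<phi> i a) (koszul_map (length xs) \<phi> (i - 1) b)"
      using koszul_map_pair[of b "length xs" i a] by (simp del: koszul_obj_simps)
  qed
qed

lemma chain_map_koszul:
  "set xs \<subseteq> G 1 \<Longrightarrow> chain_map R (koszul R xs C) (koszul R xs C') (koszul_map (length xs) \<phi>)"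
proof (induction xs rule: rev_induct)
  case Nil
  show ?case using chain_map_koszul_Nil by simp
next
  case (snoc w xs)
  then show ?case
    by (intro cone_map.chain_map_cone[OF koszul_cone_map]) auto
qed

text \<open>Each form adds a cone, and cones preserve acyclicity. Hence Koszul homology may be
  computed on an injective resolution.\<close>

lemma acyclic_map_koszul:
  assumes "acyclic_map C C' \<phi>"
  shows "set xs \<subseteq> G 1 \<Longrightarrow> acyclic_map (koszul R xs C) (koszul R xs C') (koszul_map (length xs) \<phi>)"
proof (induction xs rule: rev_induct)
  case Nil
  show ?case using acyclic_map_koszul_Nil[OF assms] by simp
next
  case (snoc w xs)
  then show ?case
    by (intro cone_map.acyclic_map_cone[OF koszul_cone_map] chain_map_koszul) auto
qed

text \<open>A Koszul chain on \<open>xs\<close> is a finite family of chains in shifted degrees, so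
  the three hypotheses on \<phi> pass to the induced map coordinate by coordinate, and the last
  variable \<open>w\<close> plays the role of \<open>w\<close> in
  \<open>acyclic_map_cone_of_bijective\<close>.\<close>

lemma acyclic_map_koszul_of_bijective:
  assumes xs: "set xs \<subseteq> G 1" "w \<in> G 1"
    and inj: "\<And>i. inj_on (\<phi> i) (carrier (obj C i))"
    and surj: "\<And>i j y. y \<in> hcomp (obj C' i) j \<Longrightarrow>
      \<exists>v\<in>hcomp (obj C' i) (j - 1). \<exists>x\<in>hcomp (obj C i) j. w \<odot>\<^bsub>obj C' i\<^esub> v = y \<oplus>\<^bsub>obj C' i\<^esub> \<phi> i x"
    and reg: "\<And>i j y. y \<in> hcomp (obj C' i) j \<Longrightarrow>
      w \<odot>\<^bsub>obj C' i\<^esub> y \<in> \<phi> i ` hcomp (obj C i) (j + 1) \<Longrightarrow> y \<in> \<phi> i ` hcomp (obj C i) j"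
  shows "acyclic_map (koszul R (xs @ [w]) C) (koszul R (xs @ [w]) C') (koszul_map (length (xs @ [w])) \<phi>)"
proof (rule cone_map.acyclic_map_cone_of_bijective[OF koszul_cone_map[OF xs chain_map_koszul[OF xs(1)]]],
    unfold koszul_simps)
  let ?n = "length xs"
  fix i j
  show "inj_on (koszul_map ?n \<phi> i) (carrier (koszul_obj ?n C i))"
  proof (rule inj_onI)
    fix x y assume xy: "x \<in> carrier (koszul_obj ?n C i)" "y \<in> carrier (koszul_obj ?n C i)"
      and eq: "koszul_map ?n \<phi> i x = koszul_map ?n \<phi> i y"
    show "x = y"
    proof (rule PiE_cong_eqI[OF xy[unfolded koszul_obj_simps]])
      fix S assume S: "S \<in> Pow {0..<?n}"
      then show "x S = y S"
        using fun_cong[OF eq, of S] inj_onD[OF inj] C.koszul_memD[OF xy(1)] C.koszul_memD[OF xy(2)]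
        by (simp add: koszul_map_def)
    qed
  qed
  fix y assume y: "y \<in> hcomp (koszul_obj ?n C' i) j"
  then have yS: "y S \<in> hcomp (obj C' (i - int (card S))) (j - int (card S))" if "S \<in> Pow {0..<?n}" for S
    using that by (auto simp: PiE_iff)
  have ye: "y \<in> extensional (Pow {0..<?n})" using y by (simp add: PiE_iff)
  have comm: "j - 1 - int c = j - int c - 1" "j + 1 - int c = j - int c + 1" for c :: nat by simp_all
  {
    have "\<forall>S\<in>Pow {0..<?n}. \<exists>v x. v \<in> hcomp (obj C' (i - int (card S))) (j - int (card S) - 1) \<and>
        x \<in> hcomp (obj C (i - int (card S))) (j - int (card S)) \<and>
        w \<odot>\<^bsub>obj C' (i - int (card S))\<^esub> v = y S \<oplus>\<^bsub>obj C' (i - int (card S))\<^esub> \<phi> (i - int (card S)) x"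
      using surj[OF yS] by blast
    then obtain v x where vx: "\<And>S. S \<in> Pow {0..<?n} \<Longrightarrow>
        v S \<in> hcomp (obj C' (i - int (card S))) (j - int (card S) - 1) \<and>
        x S \<in> hcomp (obj C (i - int (card S))) (j - int (card S)) \<and>
        w \<odot>\<^bsub>obj C' (i - int (card S))\<^esub> v S = y S \<oplus>\<^bsub>obj C' (i - int (card S))\<^esub> \<phi> (i - int (card S)) (x S)"
      by metis
    show "\<exists>v\<in>hcomp (koszul_obj ?n C' i) (j - 1). \<exists>x\<in>hcomp (koszul_obj ?n C i) j.
        w \<odot>\<^bsub>koszul_obj ?n C' i\<^esub> v = y \<oplus>\<^bsub>koszul_obj ?n C' i\<^esub> koszul_map ?n \<phi> i x"
    proof (intro bexI)
      show "restrict v (Pow {0..<?n}) \<in> hcomp (koszul_obj ?n C' i) (j - 1)"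
        "restrict x (Pow {0..<?n}) \<in> hcomp (koszul_obj ?n C i) j"
        using vx by (auto simp: comm)
      show "w \<odot>\<^bsub>koszul_obj ?n C' i\<^esub> restrict v (Pow {0..<?n}) =
          y \<oplus>\<^bsub>koszul_obj ?n C' i\<^esub> koszul_map ?n \<phi> i (restrict x (Pow {0..<?n}))"
        using vx by (auto simp: koszul_map_def fun_eq_iff)
    qed
  }
  assume "w \<odot>\<^bsub>koszul_obj ?n C' i\<^esub> y \<in> koszul_map ?n \<phi> i ` hcomp (koszul_obj ?n C i) (j + 1)"
  then obtain x where x: "x \<in> hcomp (koszul_obj ?n C i) (j + 1)"
    "w \<odot>\<^bsub>koszul_obj ?n C' i\<^esub> y = koszul_map ?n \<phi> i x" by blast
  have "\<forall>S\<in>Pow {0..<?n}. \<exists>q. q \<in> hcomp (obj C (i - int (card S))) (j - int (card S)) \<and>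
      y S = \<phi> (i - int (card S)) q"
  proof
    fix S assume S: "S \<in> Pow {0..<?n}"
    have "w \<odot>\<^bsub>obj C' (i - int (card S))\<^esub> y S = \<phi> (i - int (card S)) (x S)"
      using fun_cong[OF x(2), of S] S by (simp add: koszul_map_def)
    moreover have "x S \<in> hcomp (obj C (i - int (card S))) (j - int (card S) + 1)"
      using x(1) S by (auto simp: PiE_iff comm)
    ultimately show "\<exists>q. q \<in> hcomp (obj C (i - int (card S))) (j - int (card S)) \<and>
        y S = \<phi> (i - int (card S)) q"
      using reg[OF yS[OF S]] by blast
  qed
  then obtain q where q: "\<And>S. S \<in> Pow {0..<?n} \<Longrightarrow>
      q S \<in> hcomp (obj C (i - int (card S))) (j - int (card S)) \<and> y S = \<phi> (i - int (card S)) (q S)"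
    by metis
  show "y \<in> koszul_map ?n \<phi> i ` hcomp (koszul_obj ?n C i) j"
  proof
    show "y = koszul_map ?n \<phi> i (restrict q (Pow {0..<?n}))"
      using q ye by (auto simp: koszul_map_def fun_eq_iff extensional_def)
    show "restrict q (Pow {0..<?n}) \<in> hcomp (koszul_obj ?n C i) j"
      using q by auto
  qed
qed

end

section \<open>The ascending chain condition\<close>

context cring
begin

text \<open>Ideals are taken relative to a subset because the induction on generators runs through
  subrings of one fixed ring. For a subring \<open>A\<close>, negatives come from
  \<open>\<ominus> \<one> \<in> A\<close>, see \<open>sub_ideal_neg\<close>.\<close>

definition sub_ideal :: "'a set \<Rightarrow> 'a set \<Rightarrow> bool" where
  "sub_ideal A I \<longleftrightarrow> I \<subseteq> A \<and> \<zero> \<in> I \<and> (\<forall>x\<in>I. \<forall>y\<in>I. x \<oplus> y \<in> I) \<and> (\<forall>a\<in>A. \<forall>x\<in>I. a \<otimes> x \<in> I)"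

definition chain_condition :: "'a set \<Rightarrow> bool" where
  "chain_condition A \<longleftrightarrow> (\<forall>F :: nat \<Rightarrow> 'a set. (\<forall>n. sub_ideal A (F n)) \<and> (\<forall>n. F n \<subseteq> F (Suc n)) \<longrightarrow>
     (\<exists>N. \<forall>n\<ge>N. F n = F N))"

text \<open>Hilbert's basis theorem for \<open>A[x]\<close>, where \<open>x\<close> need not be transcendental over \<open>A\<close>: degrees and
  leading coefficients refer to some way of writing an element as a polynomial in \<open>x\<close>.\<close>

primrec polys_below :: "'a set \<Rightarrow> 'a \<Rightarrow> nat \<Rightarrow> 'a set" where
  "polys_below A x 0 = {\<zero>}"
| "polys_below A x (Suc d) = {p \<oplus> a \<otimes> x [^] d | p a. p \<in> polys_below A x d \<and> a \<in> A}"

definition adjoin :: "'a set \<Rightarrow> 'a \<Rightarrow> 'a set" where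
  "adjoin A x = (\<Union>d. polys_below A x d)"

definition leading_coeffs :: "'a set \<Rightarrow> 'a \<Rightarrow> nat \<Rightarrow> 'a set \<Rightarrow> 'a set" where
  "leading_coeffs A x d I = {a \<in> A. \<exists>p\<in>polys_below A x d. p \<oplus> a \<otimes> x [^] d \<in> I}"

lemma sub_ideal_neg:
  assumes "subring A R" "sub_ideal A I" "x \<in> I"
  shows "\<ominus> x \<in> I"
proof -
  have "\<ominus> \<one> \<in> A" using subringE(3,5)[OF assms(1)] by blast
  then have "\<ominus> \<one> \<otimes> x \<in> I" using assms(2,3) unfolding sub_ideal_def by blast
  moreover have "x \<in> carrier R"
    using assms subringE(1)[OF assms(1)] unfolding sub_ideal_def by blast
  ultimately show ?thesis by (simp add: l_minus)
qed

context
  fixes A x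
  assumes A: "subring A R" and x: "x \<in> carrier R"
begin

lemma A_carrier: "a \<in> A \<Longrightarrow> a \<in> carrier R"
  using subringE(1)[OF A] by blast

lemma polys_below_carrier: "p \<in> polys_below A x d \<Longrightarrow> p \<in> carrier R"
  using x A_carrier by (induction d arbitrary: p) auto

lemma polys_below_zero: "\<zero> \<in> polys_below A x d"
proof (induction d)
  case (Suc d)
  have "\<zero> = \<zero> \<oplus> \<zero> \<otimes> x [^] d" using x by simp
  then show ?case using Suc subringE(2)[OF A] by auto
qed simp

lemma polys_below_mono: "p \<in> polys_below A x d \<Longrightarrow> p \<in> polys_below A x (Suc d)"
proof -
  assume p: "p \<in> polys_below A x d"
  have "p = p \<oplus> \<zero> \<otimes> x [^] d" using x polys_below_carrier[OF p] by simp
  then show ?thesis using p subringE(2)[OF A] by auto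
qed

lemma polys_below_mono_le: "d \<le> e \<Longrightarrow> polys_below A x d \<subseteq> polys_below A x e"
  by (rule lift_Suc_mono_le[of "polys_below A x"]) (use polys_below_mono in blast)+

lemma polys_below_add:
  "p \<in> polys_below A x d \<Longrightarrow> q \<in> polys_below A x d \<Longrightarrow> p \<oplus> q \<in> polys_below A x d"
proof (induction d arbitrary: p q)
  case (Suc d)
  then obtain p' a q' b where p: "p = p' \<oplus> a \<otimes> x [^] d" "p' \<in> polys_below A x d" "a \<in> A"
    and q: "q = q' \<oplus> b \<otimes> x [^] d" "q' \<in> polys_below A x d" "b \<in> A" by auto
  have "p \<oplus> q = (p' \<oplus> q') \<oplus> (a \<oplus> b) \<otimes> x [^] d"
    using p q x polys_below_carrier A_carrier by (simp add: l_distr a_ac)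
  then show ?case using Suc.IH[OF p(2) q(2)] subringE(7)[OF A p(3) q(3)] by auto
qed simp

lemma polys_below_smult:
  "a \<in> A \<Longrightarrow> p \<in> polys_below A x d \<Longrightarrow> a \<otimes> p \<in> polys_below A x d"
proof (induction d arbitrary: p)
  case (Suc d)
  then obtain p' b where p: "p = p' \<oplus> b \<otimes> x [^] d" "p' \<in> polys_below A x d" "b \<in> A" by auto
  have "a \<otimes> p = a \<otimes> p' \<oplus> (a \<otimes> b) \<otimes> x [^] d"
    using p x polys_below_carrier A_carrier Suc.prems(1) by (simp add: r_distr m_assoc)
  then show ?case using Suc.IH[OF Suc.prems(1) p(2)] subringE(6)[OF A Suc.prems(1) p(3)] by auto
qed (use A_carrier in simp)

lemma polys_below_neg: "p \<in> polys_below A x d \<Longrightarrow> \<ominus> p \<in> polys_below A x d"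
proof -
  assume p: "p \<in> polys_below A x d"
  have "\<ominus> \<one> \<in> A" using subringE(3,5)[OF A] by blast
  then show ?thesis using polys_below_smult[of "\<ominus> \<one>" p d] p polys_below_carrier[OF p]
    by (simp add: l_minus)
qed

lemma polys_below_shift: "p \<in> polys_below A x d \<Longrightarrow> x \<otimes> p \<in> polys_below A x (Suc d)"
proof (induction d arbitrary: p)
  case 0
  then show ?case using x polys_below_zero[of "Suc 0"] by simp
next
  case (Suc d)
  then obtain p' a where p: "p = p' \<oplus> a \<otimes> x [^] d" "p' \<in> polys_below A x d" "a \<in> A" by auto
  have "x \<otimes> p = x \<otimes> p' \<oplus> a \<otimes> x [^] Suc d"
    using p x polys_below_carrier A_carrier by (simp add: r_distr m_ac)
  moreover have "x \<otimes> p' \<in> polys_below A x (Suc d)" by (rule Suc.IH[OF p(2)])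
  ultimately show ?case using p(3) by (subst polys_below.simps(2)) blast
qed

lemma polys_below_shift_pow: "p \<in> polys_below A x d \<Longrightarrow> x [^] e \<otimes> p \<in> polys_below A x (d + e)"
proof (induction e)
  case (Suc e)
  then have "x \<otimes> (x [^] e \<otimes> p) \<in> polys_below A x (Suc (d + e))"
    using polys_below_shift by blast
  then show ?case using x polys_below_carrier[OF Suc.prems] by (simp add: m_ac)
qed (use polys_below_carrier in simp)

lemma polys_below_mult:
  "p \<in> polys_below A x d \<Longrightarrow> q \<in> polys_below A x e \<Longrightarrow> p \<otimes> q \<in> polys_below A x (d + e)"
proof (induction e arbitrary: q)
  case 0
  then show ?case using polys_below_zero polys_below_carrier by simp
next
  case (Suc e)
  then obtain q' b where q: "q = q' \<oplus> b \<otimes> x [^] e" "q' \<in> polys_below A x e" "b \<in> A" by auto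
  have "p \<otimes> q = p \<otimes> q' \<oplus> x [^] e \<otimes> (b \<otimes> p)"
    using q x polys_below_carrier polys_below_carrier[OF Suc.prems(1)] A_carrier
    by (simp add: r_distr m_ac)
  moreover have "p \<otimes> q' \<in> polys_below A x (d + Suc e)"
    using Suc.IH[OF Suc.prems(1) q(2)] polys_below_mono by simp
  moreover have "x [^] e \<otimes> (b \<otimes> p) \<in> polys_below A x (d + Suc e)"
    using polys_below_shift_pow[OF polys_below_smult[OF q(3) Suc.prems(1)], of e] polys_below_mono by simp
  ultimately show ?case using polys_below_add[of "p \<otimes> q'" "d + Suc e"] by (simp only:)
qed

lemma base_subset_adjoin: "A \<subseteq> adjoin A x"
proof
  fix a assume "a \<in> A"
  then have "\<zero> \<oplus> a \<otimes> x [^] (0::nat) \<in> polys_below A x (Suc 0)" by auto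
  moreover have "\<zero> \<oplus> a \<otimes> x [^] (0::nat) = a" using A_carrier[OF \<open>a \<in> A\<close>] by simp
  ultimately show "a \<in> adjoin A x" unfolding adjoin_def by (metis UN_I UNIV_I)
qed

lemma generator_in_adjoin: "x \<in> adjoin A x"
proof -
  have "\<one> \<in> polys_below A x (Suc 0)"
    using subringE(3)[OF A] by (auto intro!: exI[of _ \<one>])
  from polys_below_shift[OF this] have "x \<in> polys_below A x (Suc (Suc 0))"
    using x by (simp del: polys_below.simps)
  then show ?thesis unfolding adjoin_def by blast
qed

lemma subring_adjoin: "subring (adjoin A x) R"
proof (rule subringI)
  show "adjoin A x \<subseteq> carrier R" using polys_below_carrier unfolding adjoin_def by blast
  show "\<one> \<in> adjoin A x" using base_subset_adjoin subringE(3)[OF A] by blast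
  show "\<ominus> h \<in> adjoin A x" if "h \<in> adjoin A x" for h
    using that polys_below_neg unfolding adjoin_def by blast
  fix h1 h2 assume "h1 \<in> adjoin A x" "h2 \<in> adjoin A x"
  then obtain d e where h: "h1 \<in> polys_below A x d" "h2 \<in> polys_below A x e" unfolding adjoin_def by blast
  show "h1 \<otimes> h2 \<in> adjoin A x" using polys_below_mult[OF h] unfolding adjoin_def by blast
  have "h1 \<in> polys_below A x (max d e)" "h2 \<in> polys_below A x (max d e)"
    using h polys_below_mono_le[of d "max d e"] polys_below_mono_le[of e "max d e"] by auto
  then show "h1 \<oplus> h2 \<in> adjoin A x" using polys_below_add unfolding adjoin_def by blast
qed

lemma sub_ideal_leading_coeffs:
  assumes I: "sub_ideal (adjoin A x) I"
  shows "sub_ideal A (leading_coeffs A x d I)"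
  unfolding sub_ideal_def
proof (intro conjI ballI)
  have I': "\<zero> \<in> I" "\<And>u v. u \<in> I \<Longrightarrow> v \<in> I \<Longrightarrow> u \<oplus> v \<in> I" "\<And>u v. u \<in> adjoin A x \<Longrightarrow> v \<in> I \<Longrightarrow> u \<otimes> v \<in> I"
    using I unfolding sub_ideal_def by auto
  show "leading_coeffs A x d I \<subseteq> A" by (auto simp: leading_coeffs_def)
  have "\<zero> \<oplus> \<zero> \<otimes> x [^] d = \<zero>" using x by simp
  then show "\<zero> \<in> leading_coeffs A x d I"
    using I'(1) polys_below_zero subringE(2)[OF A] unfolding leading_coeffs_def by force
  fix a assume "a \<in> leading_coeffs A x d I"
  then obtain p where p: "p \<in> polys_below A x d" "a \<in> A" "p \<oplus> a \<otimes> x [^] d \<in> I"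
    unfolding leading_coeffs_def by blast
  {
    fix b assume "b \<in> leading_coeffs A x d I"
    then obtain q where q: "q \<in> polys_below A x d" "b \<in> A" "q \<oplus> b \<otimes> x [^] d \<in> I"
      unfolding leading_coeffs_def by blast
    have "(p \<oplus> q) \<oplus> (a \<oplus> b) \<otimes> x [^] d = (p \<oplus> a \<otimes> x [^] d) \<oplus> (q \<oplus> b \<otimes> x [^] d)"
      using p q x polys_below_carrier A_carrier by (simp add: l_distr a_ac)
    also have "\<dots> \<in> I" using p q I' by blast
    finally show "a \<oplus> b \<in> leading_coeffs A x d I"
      using polys_below_add[OF p(1) q(1)] subringE(7)[OF A p(2) q(2)] unfolding leading_coeffs_def by blast
  next
    fix b assume b: "b \<in> A"
    have "b \<otimes> p \<oplus> (b \<otimes> a) \<otimes> x [^] d = b \<otimes> (p \<oplus> a \<otimes> x [^] d)"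
      using p b x polys_below_carrier A_carrier by (simp add: r_distr m_assoc)
    also have "\<dots> \<in> I" using p b I' base_subset_adjoin by blast
    finally show "b \<otimes> a \<in> leading_coeffs A x d I"
      using polys_below_smult[OF b p(1)] subringE(6)[OF A b p(2)] unfolding leading_coeffs_def by blast
  }
qed

lemma leading_coeffs_mono: "I \<subseteq> J \<Longrightarrow> leading_coeffs A x d I \<subseteq> leading_coeffs A x d J"
  unfolding leading_coeffs_def by blast

text \<open>Multiplication by \<open>x\<close> stays in the ideal, raises the degree and keeps the
  leading coefficient.\<close>

lemma leading_coeffs_Suc:
  assumes I: "sub_ideal (adjoin A x) I"
  shows "leading_coeffs A x d I \<subseteq> leading_coeffs A x (Suc d) I"
proof
  fix a assume "a \<in> leading_coeffs A x d I"
  then obtain p where p: "p \<in> polys_below A x d" "a \<in> A" "p \<oplus> a \<otimes> x [^] d \<in> I"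
    unfolding leading_coeffs_def by blast
  have "x \<otimes> p \<oplus> a \<otimes> x [^] Suc d = x \<otimes> (p \<oplus> a \<otimes> x [^] d)"
    using p x polys_below_carrier A_carrier by (simp add: r_distr m_ac)
  also have "\<dots> \<in> I" using p(3) I generator_in_adjoin unfolding sub_ideal_def by blast
  finally show "a \<in> leading_coeffs A x (Suc d) I"
    using polys_below_shift[OF p(1)] p(2) unfolding leading_coeffs_def by blast
qed

text \<open>Induction on the degree bound: an element of \<open>J\<close> loses its leading term
  when an element of \<open>I\<close> with the same leading coefficient is subtracted, and the
  difference is still in \<open>J\<close>.\<close>

lemma sub_ideal_eqI:
  assumes I: "sub_ideal (adjoin A x) I" and J: "sub_ideal (adjoin A x) J" and "I \<subseteq> J"
    and lc: "\<And>d. leading_coeffs A x d J \<subseteq> leading_coeffs A x d I"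
  shows "J \<subseteq> I"
proof
  have "f \<in> I" if "f \<in> polys_below A x d" "f \<in> J" for f d
    using that
  proof (induction d arbitrary: f)
    case 0
    then show ?case using I by (simp add: sub_ideal_def)
  next
    case (Suc d)
    then obtain p a where f: "f = p \<oplus> a \<otimes> x [^] d" "p \<in> polys_below A x d" "a \<in> A" by auto
    then have "a \<in> leading_coeffs A x d I"
      using Suc.prems(2) lc[of d] unfolding leading_coeffs_def by blast
    then obtain q where q: "q \<in> polys_below A x d" "q \<oplus> a \<otimes> x [^] d \<in> I"
      unfolding leading_coeffs_def by blast
    let ?g = "q \<oplus> a \<otimes> x [^] d"
    have c: "p \<in> carrier R" "q \<in> carrier R" "a \<otimes> x [^] d \<in> carrier R"
      using f q x polys_below_carrier A_carrier by auto
    have diff: "f \<oplus> \<ominus> ?g = p \<oplus> \<ominus> q"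
      unfolding f(1) using c by (simp add: minus_add a_ac r_neg1 r_neg2 r_neg)
    have "f \<oplus> \<ominus> ?g \<in> J"
      using Suc.prems(2) q(2) \<open>I \<subseteq> J\<close> sub_ideal_neg[OF subring_adjoin J] J
      unfolding sub_ideal_def by blast
    then have "f \<oplus> \<ominus> ?g \<in> I"
      using Suc.IH[of "f \<oplus> \<ominus> ?g"] polys_below_add[OF f(2) polys_below_neg[OF q(1)]] unfolding diff by blast
    then have "(f \<oplus> \<ominus> ?g) \<oplus> ?g \<in> I" using q(2) I unfolding sub_ideal_def by blast
    moreover have "(f \<oplus> \<ominus> ?g) \<oplus> ?g = f" unfolding f(1) using c by (intro neg_add_cancel) auto
    ultimately show ?case by simp
  qed
  then show "f \<in> I" if "f \<in> J" for f
    using that J unfolding sub_ideal_def adjoin_def by blast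
qed

text \<open>The ideals \<open>?L d (F n)\<close> grow in both indices. The diagonal is stationary
  from \<open>N\<close> on, which settles all \<open>d \<ge> N\<close> by a squeeze; the finitely
  many \<open>d\<close> below \<open>N\<close> are settled one at a time.\<close>

lemma chain_condition_adjoin:
  assumes cc: "chain_condition A"
  shows "chain_condition (adjoin A x)"
  unfolding chain_condition_def
proof (intro allI impI)
  fix F :: "nat \<Rightarrow> 'a set"
  assume "(\<forall>n. sub_ideal (adjoin A x) (F n)) \<and> (\<forall>n. F n \<subseteq> F (Suc n))"
  then have F: "\<And>n. sub_ideal (adjoin A x) (F n)" and mono: "\<And>n. F n \<subseteq> F (Suc n)" by auto
  have Fmono: "m \<le> n \<Longrightarrow> F m \<subseteq> F n" for m n
    by (rule lift_Suc_mono_le[of F, OF mono])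
  let ?L = "leading_coeffs A x"
  have Ld: "d \<le> e \<Longrightarrow> ?L d (F n) \<subseteq> ?L e (F n)" for d e n
    by (rule lift_Suc_mono_le[of "\<lambda>d. ?L d (F n)", OF leading_coeffs_Suc[OF F]])
  have stab: "\<exists>N. \<forall>n\<ge>N. H n = H N" if "\<And>n. sub_ideal A (H n)" "\<And>n. H n \<subseteq> H (Suc n)" for H :: "nat \<Rightarrow> 'a set"
    using cc that unfolding chain_condition_def by blast
  have "?L n (F n) \<subseteq> ?L (Suc n) (F (Suc n))" for n
    using leading_coeffs_Suc[OF F, of n n] leading_coeffs_mono[OF mono, of "Suc n" n] by blast
  then obtain N where N: "\<And>n. n \<ge> N \<Longrightarrow> ?L n (F n) = ?L N (F N)"
    using stab[of "\<lambda>n. ?L n (F n)"] sub_ideal_leading_coeffs[OF F] by blast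
  have "\<exists>M. \<forall>n\<ge>M. ?L d (F n) = ?L d (F M)" for d
    by (rule stab) (use sub_ideal_leading_coeffs[OF F] leading_coeffs_mono[OF mono] in auto)
  then obtain M where M: "\<And>d n. n \<ge> M d \<Longrightarrow> ?L d (F n) = ?L d (F (M d))" by metis
  \<comment> \<open>Dominates \<open>N\<close> and the stages \<open>M d\<close> of the finitely
    many rows below \<open>N\<close>.\<close>
  define K where "K = Max (insert N (M ` {..<N}))"
  have K: "K \<ge> N" "\<And>d. d < N \<Longrightarrow> K \<ge> M d" by (auto simp: K_def intro: Max_ge)
  have "F n = F K" if "n \<ge> K" for n
  proof
    show "F K \<subseteq> F n" using Fmono[OF that] .
    show "F n \<subseteq> F K"
    proof (rule sub_ideal_eqI[OF F F Fmono[OF that]])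
      fix d
      show "?L d (F n) \<subseteq> ?L d (F K)"
      proof (cases "d < N")
        case True
        then show ?thesis using M[of d n] M[of d K] K(2)[OF True] that by simp
      next
        case False
        \<comment> \<open>From row \<open>d\<close> climb to the diagonal, follow it back to
          \<open>N\<close>, where it takes the same value, and return to row
          \<open>d\<close>.\<close>
        have "?L d (F n) \<subseteq> ?L (max d n) (F (max d n))"
          using Ld[of d "max d n" n] leading_coeffs_mono[OF Fmono[of n "max d n"], of "max d n"] by auto
        also have "\<dots> = ?L N (F N)" using N[of "max d n"] False by simp
        also have "\<dots> \<subseteq> ?L d (F K)"
          using Ld[of N d N] leading_coeffs_mono[OF Fmono[OF K(1)], of d] False by auto
        finally show ?thesis .
      qed
    qed
  qed
  then show "\<exists>N. \<forall>n\<ge>N. F n = F N" by blast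
qed

end

text \<open>A nonzero element of an ideal is invertible in \<open>k\<close>, so a chain jumps at
  most once, from zero to \<open>k\<close>.\<close>

lemma chain_condition_subfield:
  assumes "subfield k R"
  shows "chain_condition k"
  unfolding chain_condition_def
proof (intro allI impI)
  fix F :: "nat \<Rightarrow> 'a set"
  assume "(\<forall>n. sub_ideal k (F n)) \<and> (\<forall>n. F n \<subseteq> F (Suc n))"
  then have F: "\<And>n. sub_ideal k (F n)" and mono: "\<And>n. F n \<subseteq> F (Suc n)" by auto
  have Fmono: "m \<le> n \<Longrightarrow> F m \<subseteq> F n" for m n
    by (rule lift_Suc_mono_le[of F, OF mono])
  have full: "F n = k" if a: "a \<in> F n" "a \<noteq> \<zero>" for a n
  proof -
    have ak: "a \<in> k - {\<zero>}" using a F unfolding sub_ideal_def by blast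
    have "c \<in> F n" if c: "c \<in> k" for c
    proof -
      have "(c \<otimes> inv a) \<otimes> a \<in> F n"
        using F a(1) c subfield_m_inv(1)[OF assms ak] subringE(6)[OF subfieldE(1)[OF assms], of c "inv a"]
        unfolding sub_ideal_def by blast
      moreover have "(c \<otimes> inv a) \<otimes> a = c"
        using c ak subfield_m_inv[OF assms ak] subfieldE(3)[OF assms] by (simp add: m_assoc subset_iff)
      ultimately show ?thesis by simp
    qed
    then show ?thesis using F unfolding sub_ideal_def by blast
  qed
  show "\<exists>N. \<forall>n\<ge>N. F n = F N"
  proof (cases "\<exists>N. \<exists>a\<in>F N. a \<noteq> \<zero>")
    case True
    then obtain N a where a: "a \<in> F N" "a \<noteq> \<zero>" by blast
    then have "\<forall>n\<ge>N. F n = F N" using full[OF a] full[of a] Fmono[of N] by blast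
    then show ?thesis by blast
  next
    case False
    then have "F n = {\<zero>}" for n using F[of n] unfolding sub_ideal_def by blast
    then show ?thesis by simp
  qed
qed

text \<open>Containment of the generators is enough: when they generate the whole ring,
  \<open>A\<close> has to be the whole ring.\<close>

lemma chain_condition_generated:
  assumes k: "subfield k R" and S: "finite S" "S \<subseteq> carrier R"
  shows "\<exists>A. subring A R \<and> k \<union> S \<subseteq> A \<and> chain_condition A"
  using S
proof (induction S)
  case empty
  then show ?case using subfieldE(1)[OF k] chain_condition_subfield[OF k] by auto
next
  case (insert x S)
  then obtain A where A: "subring A R" "k \<union> S \<subseteq> A" "chain_condition A" by auto
  have x: "x \<in> carrier R" using insert by simp
  show ?case
    using subring_adjoin[OF A(1) x] base_subset_adjoin[OF A(1) x] generator_in_adjoin[OF A(1) x]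
      chain_condition_adjoin[OF A(1) x A(3)] A(2)
    by (intro exI[of _ "adjoin A x"]) blast
qed

end

lemma (in standard_graded_algebra) chain_condition_carrier: "chain_condition (carrier R)"
proof -
  obtain S where S: "finite S" "S \<subseteq> G 1" "carrier R = generate_ring R (k \<union> S)"
    using generated by blast
  have SR: "S \<subseteq> carrier R" using S(2) Rgr.homog_carrier by blast
  have kR: "k \<subseteq> carrier R" using subfieldE(3)[OF base_field] .
  obtain A where A: "subring A R" "k \<union> S \<subseteq> A" "chain_condition A"
    using chain_condition_generated[OF base_field S(1) SR] by blast
  have "carrier R \<subseteq> A"
    unfolding S(3) by (rule generate_ring_min_subring1) (use A SR kR in auto)
  then have "A = carrier R" using subringE(1)[OF A(1)] by blast
  then show ?thesis using A(3) by simp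
qed

section \<open>Torsion in injective modules\<close>

text \<open>The free graded module on one generator of degree \<open>s\<close>. Its elements have
  the type of those of \<open>R\<close>, so it is a permitted test object for
  \<open>gr_injective\<close>.\<close>

definition shifted_ring :: "'r ring \<Rightarrow> (nat \<Rightarrow> 'r set) \<Rightarrow> int \<Rightarrow> ('r, 'r) gmodule" where
  "shifted_ring R G s =
     \<lparr>carrier = carrier R, mult = undefined, one = undefined, zero = \<zero>\<^bsub>R\<^esub>, add = add R,
      smult = mult R, hcomp = (\<lambda>l. if s \<le> l then G (nat (l - s)) else {\<zero>\<^bsub>R\<^esub>})\<rparr>"

lemma shifted_ring_simps [simp]:
  "carrier (shifted_ring R G s) = carrier R" "zero (shifted_ring R G s) = \<zero>\<^bsub>R\<^esub>"
  "add (shifted_ring R G s) = add R" "smult (shifted_ring R G s) = mult R"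
  "hcomp (shifted_ring R G s) l = (if s \<le> l then G (nat (l - s)) else {\<zero>\<^bsub>R\<^esub>})"
  by (simp_all add: shifted_ring_def)

lemma gr_injectiveD:
  fixes A B :: "('r, 'r) gmodule"
  assumes "gr_injective R G E" "graded_module R G A" "graded_module R G B"
    and "\<iota> \<in> gr_hom R A B" "inj_on \<iota> (carrier A)" "f \<in> gr_hom R A E"
  shows "\<exists>g\<in>gr_hom R B E. \<forall>a\<in>carrier A. g (\<iota> a) = f a"
  using assms unfolding gr_injective_def by blast

context standard_graded_algebra
begin

lemma abelian_group_shifted_ring: "abelian_group (shifted_ring R G s)"
  by (rule abelian_groupI) (use l_neg in \<open>auto simp: a_ac\<close>)

lemma a_inv_shifted_ring:
  assumes "x \<in> carrier R"
  shows "\<ominus>\<^bsub>shifted_ring R G s\<^esub> x = \<ominus> x"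
proof -
  interpret S: abelian_group "shifted_ring R G s" by (rule abelian_group_shifted_ring)
  show ?thesis by (rule S.minus_equality) (use assms in \<open>simp_all add: l_neg\<close>)
qed

lemma graded_module_shifted_ring: "graded_module R G (shifted_ring R G s)"
proof -
  let ?B = "shifted_ring R G s"
  interpret S: abelian_group ?B by (rule abelian_group_shifted_ring)
  let ?p = "\<lambda>l. if s \<le> l then hpart R G (nat (l - s)) else (\<lambda>x. \<zero>)"
  have dd: "direct_decomp ?B (hcomp ?B)"
  proof (rule direct_decompI[where p = ?p])
    show "abelian_group ?B" by (rule S.abelian_group_axioms)
    show "additive_subgroup (hcomp ?B l) ?B" for l
      by (rule S.additive_subgroupI')
        (auto simp: a_inv_shifted_ring Rgr.homog_carrier Rgr.homog_add Rgr.homog_neg split: if_splits)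
    show "?p l \<in> add_hom ?B ?B" for l
      by (rule add_homI) (auto simp: Rgr.hpart_carrier Rgr.hpart_add)
    show "?p l x \<in> hcomp ?B l" if "x \<in> carrier ?B" for l x
      using that Rgr.hpart_in by auto
    show "?p l x = (if l = l' then x else \<zero>\<^bsub>?B\<^esub>)" if "x \<in> hcomp ?B l'" for l l' x
      using that Rgr.hpart_homog[of x "nat (l' - s)" "nat (l - s)"]
      by (auto split: if_splits)
    fix x assume x: "x \<in> carrier ?B"
    show "finite {l. ?p l x \<noteq> \<zero>\<^bsub>?B\<^esub>}"
    proof (rule finite_subset)
      show "{l. ?p l x \<noteq> \<zero>\<^bsub>?B\<^esub>} \<subseteq> (\<lambda>a. int a + s) ` {a. hpart R G a x \<noteq> \<zero>}"
        by (auto intro!: image_eqI[of _ _ "nat (_ - s)"] split: if_splits)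
    qed (use x Rgr.hpart_finite in simp)
    show "x = \<zero>\<^bsub>?B\<^esub>" if z: "\<And>l. ?p l x = \<zero>\<^bsub>?B\<^esub>"
    proof -
      have "hpart R G a x = \<zero>" for a using z[of "int a + s"] by simp
      then show ?thesis using Rgr.hpart_all_zero[of x] x by simp
    qed
  qed
  have mod: "module R ?B"
    by (rule moduleI[OF is_cring S.abelian_group_axioms]) (auto simp: l_distr r_distr m_assoc)
  have deg: "r \<odot>\<^bsub>?B\<^esub> x \<in> hcomp ?B (int a + j)" if "r \<in> G a" "x \<in> hcomp ?B j" for r a x j
  proof (cases "s \<le> j")
    case True
    then have "nat (int a + j - s) = a + nat (j - s)" by simp
    then show ?thesis using that True mult_degree[of r a x "nat (j - s)"] by simp
  next
    case False
    then have "x = \<zero>" using that(2) by simp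
    then show ?thesis using Rgr.homog_carrier[OF that(1)] by simp
  qed
  show ?thesis by (intro graded_module.intro mod graded_module_axioms.intro dd deg)
qed

text \<open>Naturality of components for the identity map, with degrees moved by
  \<open>s\<close>.\<close>

lemma hpart_shifted_ring:
  assumes "x \<in> carrier R"
  shows "hpart (shifted_ring R G s) (hcomp (shifted_ring R G s)) l x =
    (if s \<le> l then hpart R G (nat (l - s)) x else \<zero>)"
proof -
  interpret B: graded_module R G "shifted_ring R G s" by (rule graded_module_shifted_ring)
  have id: "(\<lambda>x. x) \<in> add_hom R (shifted_ring R G s)" by (rule add_homI) auto
  have inj: "inj (\<lambda>a. int a + s)" by (auto simp: inj_def)
  note nat = hpart_naturality[OF Rgr.graded_group_axioms B.gr.graded_group_axioms id inj _ assms]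
  show ?thesis
  proof (cases "s \<le> l")
    case True
    then show ?thesis using nat(1)[of "nat (l - s)"] by simp
  next
    case False
    then have "l \<notin> range (\<lambda>a. int a + s)" by auto
    then show ?thesis using nat(2)[of l] False by simp
  qed
qed

text \<open>Naturality for multiplication by \<open>w\<close>; the degrees below \<open>c\<close>
  lie outside the range of the shift.\<close>

lemma hpart_mult:
  assumes "w \<in> G c" "x \<in> carrier R"
  shows "hpart R G a (w \<otimes> x) = (if c \<le> a then w \<otimes> hpart R G (a - c) x else \<zero>)"
proof -
  have w: "w \<in> carrier R" using Rgr.homog_carrier[OF assms(1)] .
  have hom: "(\<lambda>x. w \<otimes> x) \<in> add_hom R R" using w by (auto intro!: add_homI simp: r_distr)
  note nat = hpart_naturality[OF Rgr.graded_group_axioms Rgr.graded_group_axioms hom, of "\<lambda>i. c + i",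
      OF _ mult_degree[OF assms(1)] assms(2)]
  show ?thesis
  proof (cases "c \<le> a")
    case True
    then show ?thesis using nat(1)[of "a - c"] by (simp add: inj_def)
  next
    case False
    then have "a \<notin> range (\<lambda>i. c + i)" by auto
    then show ?thesis using nat(2)[of a] False by (simp add: inj_def)
  qed
qed

lemma one_degree: "\<one> \<in> G 0"
  using subringE(3)[OF subfieldE(1)[OF base_field]] degree_zero by simp

lemma pow_degree: "w \<in> G 1 \<Longrightarrow> w [^] (t::nat) \<in> G t"
proof (induction t)
  case (Suc t)
  then show ?case using mult_degree[of "w [^] t" t w 1] by simp
qed (simp add: one_degree)

text \<open>The colon ideals of \<open>I\<close> by the powers of \<open>w\<close> ascend, so the
  chain condition makes them stationary.\<close>

lemma colon_stabilizes:
  assumes I: "sub_ideal (carrier R) I" and w: "w \<in> carrier R"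
  shows "\<exists>t::nat. \<forall>r\<in>carrier R. w [^] Suc t \<otimes> r \<in> I \<longrightarrow> w [^] t \<otimes> r \<in> I"
proof -
  let ?F = "\<lambda>t::nat. {r \<in> carrier R. w [^] t \<otimes> r \<in> I}"
  have I': "I \<subseteq> carrier R" "\<zero> \<in> I" "\<And>x y. x \<in> I \<Longrightarrow> y \<in> I \<Longrightarrow> x \<oplus> y \<in> I"
    "\<And>a x. a \<in> carrier R \<Longrightarrow> x \<in> I \<Longrightarrow> a \<otimes> x \<in> I"
    using I unfolding sub_ideal_def by auto
  have "sub_ideal (carrier R) (?F t)" for t
    unfolding sub_ideal_def
  proof (intro conjI ballI)
    fix a r assume "a \<in> carrier R" "r \<in> ?F t"
    moreover then have "w [^] t \<otimes> (a \<otimes> r) = a \<otimes> (w [^] t \<otimes> r)" using w by (simp add: m_ac)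
    ultimately show "a \<otimes> r \<in> ?F t" using I'(4) by auto
  next
    fix r r' assume "r \<in> ?F t" "r' \<in> ?F t"
    then show "r \<oplus> r' \<in> ?F t" using w I'(3) by (simp add: r_distr)
  next
    show "\<zero> \<in> ?F t" using w I'(2) by simp
  qed blast
  moreover have "?F t \<subseteq> ?F (Suc t)" for t
  proof
    fix r assume r: "r \<in> ?F t"
    then have "w [^] Suc t \<otimes> r = w \<otimes> (w [^] t \<otimes> r)" using w by (simp add: m_ac)
    then show "r \<in> ?F (Suc t)" using r I'(4)[OF w] by auto
  qed
  ultimately have "\<exists>N. \<forall>n\<ge>N. ?F n = ?F N"
    by (intro chain_condition_carrier[unfolded chain_condition_def, rule_format, of ?F]) auto
  then obtain N where "\<forall>n\<ge>N. ?F n = ?F N" by blast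
  then have "?F (Suc N) = ?F N" by (rule allE[of _ "Suc N"]) simp
  then show ?thesis by blast
qed

text \<open>By the chain condition, \<open>w\<^sup>(\<^sup>t\<^sup>+\<^sup>1\<^sup>) r + q \<mapsto> w\<^sup>t r e\<close>, with \<open>q\<close> in the annihilator of \<open>e\<close>, is well defined for large \<open>t\<close>;
  \<open>e'\<close> is the image of \<open>1\<close> under an extension of this map to \<open>R\<close>.\<close>

lemma injective_divisible:
  assumes inj: "gr_injective R G E" and w: "w \<in> G 1" and e: "e \<in> hcomp E j"
  shows "\<exists>t. \<exists>e'\<in>hcomp E (j - 1). w [^] Suc t \<odot>\<^bsub>E\<^esub> e' = w [^] t \<odot>\<^bsub>E\<^esub> e \<and>
    (\<forall>r\<in>carrier R. r \<odot>\<^bsub>E\<^esub> e = \<zero>\<^bsub>E\<^esub> \<longrightarrow> r \<odot>\<^bsub>E\<^esub> e' = \<zero>\<^bsub>E\<^esub>)"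
proof -
  interpret E: graded_module R G E using inj by (simp add: gr_injective_def)
  have ec: "e \<in> carrier E" using E.gr.homog_carrier[OF e] .
  have wc: "w \<in> carrier R" using Rgr.homog_carrier[OF w] .
  define I where "I = {r \<in> carrier R. r \<odot>\<^bsub>E\<^esub> e = \<zero>\<^bsub>E\<^esub>}"
  have I: "sub_ideal (carrier R) I"
    using ec by (auto simp: sub_ideal_def I_def E.smult_l_distr E.smult_assoc1)
  have Ic: "q \<in> carrier R" if "q \<in> I" for q using that by (simp add: I_def)
  have I_add: "q \<oplus> q' \<in> I" if "q \<in> I" "q' \<in> I" for q q'
    using I that by (simp add: sub_ideal_def)
  have I_mult: "r \<otimes> q \<in> I" if "r \<in> carrier R" "q \<in> I" for r q
    using I that by (simp add: sub_ideal_def)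
  have I_neg: "\<ominus> q \<in> I" if "q \<in> I" for q
    using that ec by (simp add: I_def E.smult_l_minus)
  have I_zero: "\<zero> \<in> I" using I by (simp add: sub_ideal_def)
  have act: "(\<lambda>r. r \<odot>\<^bsub>E\<^esub> e) \<in> add_hom R E"
    by (rule add_homI) (use ec in \<open>auto simp: E.smult_l_distr\<close>)
  have I_hpart: "hpart R G a q \<in> I" if "q \<in> I" for a q
  proof -
    have "hpart R G a q \<odot>\<^bsub>E\<^esub> e = hpart E (hcomp E) (int a + j) (q \<odot>\<^bsub>E\<^esub> e)"
      by (rule hpart_natural[OF Rgr.graded_group_axioms E.gr.graded_group_axioms act,
            of "\<lambda>a. int a + j", symmetric])
        (use E.smult_degree e Ic[OF that] in \<open>auto simp: inj_def\<close>)
    also have "\<dots> = \<zero>\<^bsub>E\<^esub>" using that by (simp add: I_def)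
    finally show ?thesis using Rgr.hpart_carrier[OF Ic[OF that]] by (simp add: I_def)
  qed
  obtain t where t: "\<And>r. r \<in> carrier R \<Longrightarrow> w [^] Suc t \<otimes> r \<in> I \<Longrightarrow> w [^] t \<otimes> r \<in> I"
    using colon_stabilizes[OF I wc] by blast
  define W where "W = w [^] Suc t"
  define V where "V = w [^] t"
  have WG: "W \<in> G (Suc t)" and VG: "V \<in> G t" unfolding W_def V_def by (rule pow_degree[OF w])+
  have Wc: "W \<in> carrier R" and Vc: "V \<in> carrier R" using wc by (auto simp: W_def V_def)
  have t: "V \<otimes> r \<in> I" if "r \<in> carrier R" "W \<otimes> r \<in> I" for r
    using t that by (simp add: W_def V_def)
  \<comment> \<open>With the generator in degree \<open>j - 1\<close>, the element \<open>W\<close>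
    has degree \<open>j + t\<close>, which is the degree of \<open>V e\<close>; so the map to be
    extended preserves degrees.\<close>
  let ?B = "shifted_ring R G (j - 1)"
  interpret B: graded_module R G ?B by (rule graded_module_shifted_ring)
  \<comment> \<open>The annihilator of \<open>e\<close> is put into the domain, with value zero, so
    that whatever kills \<open>e\<close> also kills the image of \<open>1\<close> under an
    extension.\<close>
  define N where "N = {W \<otimes> r \<oplus> q | r q. r \<in> carrier R \<and> q \<in> I}"
  have NI: "W \<otimes> r \<oplus> q \<in> N" if "r \<in> carrier R" "q \<in> I" for r q
    using that by (auto simp: N_def)
  have Nc: "x \<in> carrier R" if "x \<in> N" for x using that Wc Ic by (auto simp: N_def)
  have W_hpart: "hpart R G a (W \<otimes> r \<oplus> q) =
      W \<otimes> (if Suc t \<le> a then hpart R G (a - Suc t) r else \<zero>) \<oplus> hpart R G a q"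
    if "r \<in> carrier R" "q \<in> I" for a r q
    using that Wc Ic hpart_mult[OF WG] by (simp add: Rgr.hpart_add)
  have subm: "submodule N R ?B"
  proof (rule B.submoduleI)
    show "\<zero>\<^bsub>?B\<^esub> \<in> N" using NI[OF zero_closed I_zero] Wc by simp
    fix x assume "x \<in> N"
    then obtain r q where x: "x = W \<otimes> r \<oplus> q" "r \<in> carrier R" "q \<in> I" by (auto simp: N_def)
    have "\<ominus> x = W \<otimes> (\<ominus> r) \<oplus> \<ominus> q" using x Wc Ic by (simp add: minus_add r_minus)
    then show "\<ominus>\<^bsub>?B\<^esub> x \<in> N" using NI[of "\<ominus> r" "\<ominus> q"] x I_neg Nc[OF \<open>x \<in> N\<close>] by (simp add: a_inv_shifted_ring)
    show "a \<odot>\<^bsub>?B\<^esub> x \<in> N" if a: "a \<in> carrier R" for a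
    proof -
      have "a \<otimes> x = W \<otimes> (a \<otimes> r) \<oplus> a \<otimes> q" using a x Wc Ic by (simp add: r_distr m_ac)
      then show ?thesis using NI[of "a \<otimes> r" "a \<otimes> q"] x a I_mult by simp
    qed
    fix y assume "y \<in> N"
    then obtain r' q' where y: "y = W \<otimes> r' \<oplus> q'" "r' \<in> carrier R" "q' \<in> I" by (auto simp: N_def)
    have "x \<oplus> y = W \<otimes> (r \<oplus> r') \<oplus> (q \<oplus> q')" using x y Wc Ic by (simp add: r_distr a_ac)
    then show "x \<oplus>\<^bsub>?B\<^esub> y \<in> N" using NI[of "r \<oplus> r'" "q \<oplus> q'"] x y I_add by simp
  qed (use Nc in auto)
  have closed: "hpart ?B (hcomp ?B) l x \<in> N" if xN: "x \<in> N" for x l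
  proof -
    obtain r q where x: "x = W \<otimes> r \<oplus> q" "r \<in> carrier R" "q \<in> I" using xN by (auto simp: N_def)
    have "hpart R G a x \<in> N" for a
      unfolding x(1) W_hpart[OF x(2,3)]
      by (rule NI) (use x Rgr.hpart_carrier I_hpart in auto)
    then show ?thesis
      using hpart_shifted_ring[OF Nc[OF that]] NI[OF zero_closed I_zero] Wc by simp
  qed
  have A: "graded_module R G (sub_gmodule ?B N)"
    by (rule B.graded_module_sub_gmodule[OF subm _ closed]) (use Rgr.homog_carrier in auto)
  \<comment> \<open>The value is computed from some presentation of \<open>x\<close>; by the choice
    of \<open>t\<close> it does not depend on which one.\<close>
  define f where "f x = (V \<otimes> (SOME r. r \<in> carrier R \<and> (\<exists>q\<in>I. x = W \<otimes> r \<oplus> q))) \<odot>\<^bsub>E\<^esub> e" for x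
  have f: "f (W \<otimes> r \<oplus> q) = (V \<otimes> r) \<odot>\<^bsub>E\<^esub> e" if r: "r \<in> carrier R" and q: "q \<in> I" for r q
  proof -
    let ?r = "SOME r'. r' \<in> carrier R \<and> (\<exists>q'\<in>I. W \<otimes> r \<oplus> q = W \<otimes> r' \<oplus> q')"
    have "?r \<in> carrier R \<and> (\<exists>q'\<in>I. W \<otimes> r \<oplus> q = W \<otimes> ?r \<oplus> q')"
      by (rule someI[of "\<lambda>r'. r' \<in> carrier R \<and> (\<exists>q'\<in>I. W \<otimes> r \<oplus> q = W \<otimes> r' \<oplus> q')" r]) (use that in blast)
    then obtain q' where r': "?r \<in> carrier R" and q': "q' \<in> I" "W \<otimes> r \<oplus> q = W \<otimes> ?r \<oplus> q'" by blast
    have c: "W \<otimes> r \<in> carrier R" "W \<otimes> ?r \<in> carrier R" "q \<in> carrier R" "q' \<in> carrier R"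
      using r r' Wc Ic q q'(1) by auto
    have "W \<otimes> (?r \<oplus> \<ominus> r) = (W \<otimes> ?r \<oplus> q') \<oplus> (\<ominus> q' \<oplus> \<ominus> (W \<otimes> r))"
      using c r r' Wc by (simp add: r_distr r_minus a_assoc r_neg2)
    also have "\<dots> = q \<oplus> \<ominus> q'"
      unfolding q'(2)[symmetric] using c by (simp add: a_ac r_neg1 r_neg2 r_neg)
    also have "\<dots> \<in> I" using q q'(1) I_neg I_add by simp
    finally have "V \<otimes> (?r \<oplus> \<ominus> r) \<in> I" using t r r' by simp
    then have "(V \<otimes> ?r) \<odot>\<^bsub>E\<^esub> e \<oplus>\<^bsub>E\<^esub> \<ominus>\<^bsub>E\<^esub> ((V \<otimes> r) \<odot>\<^bsub>E\<^esub> e) = \<zero>\<^bsub>E\<^esub>"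
      using r r' Vc ec by (simp add: I_def r_distr r_minus E.smult_l_distr E.smult_l_minus)
    then have "(V \<otimes> ?r) \<odot>\<^bsub>E\<^esub> e = (V \<otimes> r) \<odot>\<^bsub>E\<^esub> e"
      using r r' Vc ec E.M.neg_add_cancel[of "(V \<otimes> ?r) \<odot>\<^bsub>E\<^esub> e" "(V \<otimes> r) \<odot>\<^bsub>E\<^esub> e"] by simp
    then show ?thesis unfolding f_def .
  qed
  have f_hom: "f \<in> gr_hom R (sub_gmodule ?B N) E"
  proof (rule gr_homI)
    fix x assume "x \<in> carrier (sub_gmodule ?B N)"
    then obtain r q where x: "x = W \<otimes> r \<oplus> q" "r \<in> carrier R" "q \<in> I" by (auto simp: N_def)
    show "f x \<in> carrier E" unfolding x(1) f[OF x(2,3)] using x Vc ec by simp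
    show "f (a \<odot>\<^bsub>sub_gmodule ?B N\<^esub> x) = a \<odot>\<^bsub>E\<^esub> f x" if a: "a \<in> carrier R" for a
    proof -
      have "a \<otimes> x = W \<otimes> (a \<otimes> r) \<oplus> a \<otimes> q" using a x Wc Ic by (simp add: r_distr m_ac)
      then have "f (a \<odot>\<^bsub>sub_gmodule ?B N\<^esub> x) = (V \<otimes> (a \<otimes> r)) \<odot>\<^bsub>E\<^esub> e"
        using f[of "a \<otimes> r" "a \<otimes> q"] a x I_mult by simp
      also have "V \<otimes> (a \<otimes> r) = a \<otimes> (V \<otimes> r)" using a x Vc by (simp add: m_ac)
      finally show ?thesis unfolding x(1) f[OF x(2,3)] using a x Vc ec by (simp add: E.smult_assoc1)
    qed
    fix y assume "y \<in> carrier (sub_gmodule ?B N)"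
    then obtain r' q' where y: "y = W \<otimes> r' \<oplus> q'" "r' \<in> carrier R" "q' \<in> I" by (auto simp: N_def)
    have "x \<oplus> y = W \<otimes> (r \<oplus> r') \<oplus> (q \<oplus> q')" using x y Wc Ic by (simp add: r_distr a_ac)
    then have "f (x \<oplus>\<^bsub>sub_gmodule ?B N\<^esub> y) = (V \<otimes> (r \<oplus> r')) \<odot>\<^bsub>E\<^esub> e"
      using f[of "r \<oplus> r'" "q \<oplus> q'"] x y I_add by simp
    then show "f (x \<oplus>\<^bsub>sub_gmodule ?B N\<^esub> y) = f x \<oplus>\<^bsub>E\<^esub> f y"
      unfolding x(1) y(1) f[OF x(2,3)] f[OF y(2,3)] using x y Vc ec
      by (simp add: r_distr E.smult_l_distr)
  next
    fix x l assume "x \<in> hcomp (sub_gmodule ?B N) l"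
    then have x: "x \<in> hcomp ?B l" "x \<in> N" by auto
    have f0: "f \<zero> = \<zero>\<^bsub>E\<^esub>" using f[OF zero_closed I_zero] Wc Vc ec by simp
    show "f x \<in> hcomp E l"
    proof (cases "j - 1 \<le> l")
      case True
      define a where "a = nat (l - (j - 1))"
      have xa: "x \<in> G a" using x(1) True by (simp add: a_def)
      obtain r q where rq: "x = W \<otimes> r \<oplus> q" "r \<in> carrier R" "q \<in> I" using x(2) by (auto simp: N_def)
      let ?r = "if Suc t \<le> a then hpart R G (a - Suc t) r else \<zero>"
      have rc: "?r \<in> carrier R" using Rgr.hpart_carrier[OF rq(2)] by simp
      have "x = hpart R G a x" using Rgr.hpart_homog[OF xa, of a] by simp
      also have "\<dots> = W \<otimes> ?r \<oplus> hpart R G a q"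
        unfolding rq(1) by (rule W_hpart[OF rq(2,3)])
      finally have fx: "f x = (V \<otimes> ?r) \<odot>\<^bsub>E\<^esub> e" using f[OF rc I_hpart[OF rq(3)]] by simp
      show ?thesis
      proof (cases "Suc t \<le> a")
        case True': True
        have "V \<otimes> ?r \<in> G (t + (a - Suc t))"
          unfolding if_P[OF True'] by (rule mult_degree[OF VG Rgr.hpart_in[OF rq(2)]])
        moreover have "int (t + (a - Suc t)) + j = l" using True True' by (simp add: a_def)
        ultimately show ?thesis using E.smult_degree[OF _ e] unfolding fx by metis
      next
        \<comment> \<open>Below degree \<open>t + 1\<close> of \<open>R\<close> the multiple of
          \<open>W\<close> contributes nothing, so \<open>x\<close> lies in the annihilator.\<close>
        case False
        then have "f x = \<zero>\<^bsub>E\<^esub>" unfolding fx using Vc ec by simp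
        then show ?thesis by simp
      qed
    next
      case False
      then have "x = \<zero>" using x(1) by simp
      then show ?thesis using f0 by simp
    qed
  qed
  have id: "(\<lambda>x. x) \<in> gr_hom R (sub_gmodule ?B N) ?B"
    by (rule gr_homI) (use Nc in auto)
  have "\<exists>g\<in>gr_hom R ?B E. \<forall>a\<in>carrier (sub_gmodule ?B N). g a = f a"
    by (rule gr_injectiveD[OF inj A graded_module_shifted_ring id _ f_hom]) simp
  then obtain g where g: "g \<in> gr_hom R ?B E" and gf: "\<And>a. a \<in> N \<Longrightarrow> g a = f a" by auto
  let ?e = "g \<one>"
  have g_mult: "r \<odot>\<^bsub>E\<^esub> ?e = g r" if "r \<in> carrier R" for r
    using gr_hom_smult[OF g, of r \<one>] that by simp
  have "?e \<in> hcomp E (j - 1)"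
    by (rule gr_hom_homog[OF g]) (simp add: one_degree)
  moreover have "W \<odot>\<^bsub>E\<^esub> ?e = V \<odot>\<^bsub>E\<^esub> e"
    using g_mult[OF Wc] gf[of W] f[OF one_closed I_zero] NI[OF one_closed I_zero] Wc Vc by simp
  moreover have "r \<odot>\<^bsub>E\<^esub> ?e = \<zero>\<^bsub>E\<^esub>" if "r \<in> carrier R" "r \<odot>\<^bsub>E\<^esub> e = \<zero>\<^bsub>E\<^esub>" for r
  proof -
    have r: "r \<in> I" using that by (simp add: I_def)
    show ?thesis
      using g_mult[OF that(1)] gf[of r] f[OF zero_closed r] NI[OF zero_closed r] Wc Vc ec that(1) by simp
  qed
  ultimately show ?thesis unfolding W_def V_def by blast
qed

end

section \<open>The irrelevant ideal and its generators\<close>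

context standard_graded_algebra
begin

definition positive_part :: "'r set" where
  "positive_part = {x \<in> carrier R. hpart R G 0 x = \<zero>}"

text \<open>Only the degree zero component of a multiplier can reach degree zero, and there it meets
  the vanishing component of \<open>x\<close>.\<close>

lemma ideal_positive_part: "ideal positive_part R"
proof (rule idealI)
  show "ring R" by (rule ring_axioms)
  show "subgroup positive_part (add_monoid R)"
    using additive_subgroupI'[of positive_part]
    by (auto simp: positive_part_def Rgr.hpart_add Rgr.hpart_neg additive_subgroup_def)
  have *: "r \<otimes> x \<in> positive_part" if x: "x \<in> positive_part" and r: "r \<in> carrier R" for x r
  proof -
    have xc: "x \<in> carrier R" using x by (simp add: positive_part_def)
    have hom: "(\<lambda>r. hpart R G 0 (r \<otimes> x)) \<in> add_hom R R"
      by (rule add_homI) (use xc in \<open>auto simp: l_distr Rgr.hpart_add Rgr.hpart_carrier\<close>)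
    let ?S = "{a. hpart R G a r \<noteq> \<zero>}"
    have z: "hpart R G 0 (hpart R G a r \<otimes> x) = \<zero>" for a
      using hpart_mult[OF Rgr.hpart_in[OF r] xc, of 0 a] x Rgr.hpart_carrier[OF r]
      by (simp add: positive_part_def)
    have "hpart R G 0 (r \<otimes> x) = hpart R G 0 (finsum R (\<lambda>a. hpart R G a r) ?S \<otimes> x)"
      by (rule arg_cong[where f = "\<lambda>r. hpart R G 0 (r \<otimes> x)"]) (rule Rgr.hpart_sum[OF r])
    also have "\<dots> = finsum R (\<lambda>a. hpart R G 0 (hpart R G a r \<otimes> x)) ?S"
      by (rule add_hom_finsum[OF is_abelian_group is_abelian_group hom])
        (use Rgr.hpart_carrier[OF r] in auto)
    also have "\<dots> = \<zero>" by (simp add: z)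
    finally show ?thesis using r xc by (simp add: positive_part_def)
  qed
  show "x \<otimes> a \<in> positive_part" "a \<otimes> x \<in> positive_part"
    if "a \<in> positive_part" "x \<in> carrier R" for a x
    using *[OF that] that by (auto simp: m_comm positive_part_def)
qed

text \<open>The sums of an element of \<open>k\<close> and one of the ideal form a subring
  containing the generators, hence all of \<open>R\<close>. In such a sum for \<open>r\<close>, the
  element of \<open>k\<close> is the degree zero component, which vanishes as
  \<open>a \<ge> 1\<close>.\<close>

lemma positive_degree_in_genideal:
  assumes S: "S \<subseteq> G 1" "carrier R = generate_ring R (k \<union> S)" and r: "r \<in> G a" "a \<ge> 1"
  shows "r \<in> genideal R S"
proof -
  let ?I = "genideal R S"
  have SR: "S \<subseteq> carrier R" using S(1) Rgr.homog_carrier by blast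
  interpret I: ideal ?I R by (rule genideal_ideal[OF SR])
  have k: "subring k R" by (rule subfieldE(1)[OF base_field])
  have kR: "c \<in> carrier R" if "c \<in> k" for c using that subringE(1)[OF k] by blast
  let ?T = "{c \<oplus> q | c q. c \<in> k \<and> q \<in> ?I}"
  have TI: "c \<oplus> q \<in> ?T" if "c \<in> k" "q \<in> ?I" for c q using that by blast
  have "subring ?T R"
  proof (rule subringI)
    show "?T \<subseteq> carrier R" using kR by auto
    have "\<one> = \<one> \<oplus> \<zero>" by simp
    then show "\<one> \<in> ?T" using TI[OF subringE(3)[OF k] I.zero_closed] by simp
    fix x assume "x \<in> ?T"
    then obtain c q where x: "x = c \<oplus> q" "c \<in> k" "q \<in> ?I" by blast
    have "\<ominus> x = \<ominus> c \<oplus> \<ominus> q" using x kR by (simp add: minus_add)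
    then show "\<ominus> x \<in> ?T" using TI[OF subringE(5)[OF k x(2)] I.a_inv_closed[OF x(3)]] by simp
    fix y assume "y \<in> ?T"
    then obtain c' q' where y: "y = c' \<oplus> q'" "c' \<in> k" "q' \<in> ?I" by blast
    have c: "c \<in> carrier R" "c' \<in> carrier R" "q \<in> carrier R" "q' \<in> carrier R"
      using x y kR by auto
    have "x \<oplus> y = (c \<oplus> c') \<oplus> (q \<oplus> q')" using x(1) y(1) c by (simp add: a_ac)
    then show "x \<oplus> y \<in> ?T" using TI[OF subringE(7)[OF k x(2) y(2)] I.a_closed[OF x(3) y(3)]] by simp
    have "x \<otimes> y = c \<otimes> c' \<oplus> (c \<otimes> q' \<oplus> q \<otimes> (c' \<oplus> q'))"
      using x(1) y(1) c by (simp add: l_distr r_distr a_ac)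
    moreover have "c \<otimes> q' \<oplus> q \<otimes> (c' \<oplus> q') \<in> ?I"
      using I.I_l_closed[OF y(3) c(1)] I.I_r_closed[OF x(3), of "c' \<oplus> q'"] c by simp
    ultimately show "x \<otimes> y \<in> ?T" using TI[OF subringE(6)[OF k x(2) y(2)]] by simp
  qed
  moreover have "k \<union> S \<subseteq> ?T"
  proof
    fix x assume "x \<in> k \<union> S"
    then show "x \<in> ?T"
    proof
      assume "x \<in> k"
      then show ?thesis using TI[OF _ I.zero_closed, of x] kR by simp
    next
      assume "x \<in> S"
      then show ?thesis using TI[OF subringE(2)[OF k], of x] genideal_self[OF SR] SR by auto
    qed
  qed
  ultimately have "carrier R \<subseteq> ?T"
    unfolding S(2) by (intro generate_ring_min_subring1) (use SR kR in auto)
  then obtain c q where cq: "r = c \<oplus> q" "c \<in> k" "q \<in> ?I" using Rgr.homog_carrier[OF r(1)] by blast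
  \<comment> \<open>Linear forms have no component of degree zero, hence neither has
    \<open>q\<close>.\<close>
  have "S \<subseteq> positive_part"
    using S(1) SR Rgr.hpart_homog[of _ 1 0] by (auto simp: positive_part_def)
  then have "q \<in> positive_part"
    using genideal_minimal[OF ideal_positive_part] cq(3) by blast
  then have "hpart R G 0 r = c"
    using cq kR degree_zero Rgr.hpart_homog[of c 0 0] Rgr.hpart_add[of c q 0]
    by (simp add: positive_part_def)
  then have "c = \<zero>" using Rgr.hpart_homog[OF r(1), of 0] r(2) by simp
  then show ?thesis using cq kR by simp
qed

lemma irrelevant_ideal_eq:
  assumes "S \<subseteq> G 1" "carrier R = generate_ring R (k \<union> S)"
  shows "irrelevant_ideal R G = genideal R S"
proof
  have SR: "S \<subseteq> carrier R" using assms(1) Rgr.homog_carrier by blast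
  have GR: "(\<Union>a\<in>{1..}. G a) \<subseteq> carrier R" using Rgr.homog_carrier by blast
  show "irrelevant_ideal R G \<subseteq> genideal R S"
    unfolding irrelevant_ideal_def
    by (rule genideal_minimal[OF genideal_ideal[OF SR]]) (use positive_degree_in_genideal[OF assms] in auto)
  show "genideal R S \<subseteq> irrelevant_ideal R G"
    unfolding irrelevant_ideal_def
    by (rule genideal_minimal[OF genideal_ideal[OF GR]]) (use assms(1) genideal_self[OF GR] in auto)
qed

end

text \<open>Each form in \<open>Z\<close> has its own exponent. In contrast to torsion for an ideal,
  this can be imposed one form at a time; for generating linear forms the two agree by
  \<open>torsion_eq_power_torsion\<close>.\<close>

definition power_torsion :: "'r ring \<Rightarrow> 'r set \<Rightarrow> ('r, 'm) gmodule \<Rightarrow> 'm set" where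
  "power_torsion R Z M = {x \<in> carrier M. \<forall>z\<in>Z. \<exists>t::nat. (z [^]\<^bsub>R\<^esub> t) \<odot>\<^bsub>M\<^esub> x = \<zero>\<^bsub>M\<^esub>}"

context module
begin

lemma pow_smult_eq_zero_mono:
  assumes "z \<in> carrier R" "x \<in> carrier M" "(z [^] (t::nat)) \<odot>\<^bsub>M\<^esub> x = \<zero>\<^bsub>M\<^esub>" "t \<le> s"
  shows "(z [^] s) \<odot>\<^bsub>M\<^esub> x = \<zero>\<^bsub>M\<^esub>"
proof -
  have "z [^] s = z [^] (s - t) \<otimes> z [^] t" using assms(1,4) by (simp add: nat_pow_mult)
  then show ?thesis using assms by (simp add: smult_assoc1)
qed

end

lemma (in standard_graded_algebra) ideal_ideal_power:
  "ideal I R \<Longrightarrow> ideal (ideal_power R I t) R"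
  by (induction t) (auto intro: oneideal ideal_prod_is_ideal)

lemma (in standard_graded_algebra) pow_in_ideal_power:
  assumes "ideal I R" "z \<in> I"
  shows "z [^] t \<in> ideal_power R I t"
proof (induction t)
  case (Suc t)
  have "z \<otimes> z [^] t \<in> ideal_prod R I (ideal_power R I t)"
    by (rule ideal_prod.prod[OF assms(2) Suc])
  then show ?case using ideal.Icarr[OF assms] by (simp add: m_comm)
qed simp

locale gmod = standard_graded_algebra R k G + graded_module R G M
  for R :: "'r ring" (structure) and k G and M :: "('r, 'm) gmodule" (structure)
begin

lemma submodule_power_torsion:
  assumes "Z \<subseteq> G 1"
  shows "submodule (power_torsion R Z M) R M"
proof (rule submoduleI)
  have Zc: "z \<in> carrier R" if "z \<in> Z" for z using that assms Rgr.homog_carrier by blast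
  show "power_torsion R Z M \<subseteq> carrier M" by (auto simp: power_torsion_def)
  show "\<zero>\<^bsub>M\<^esub> \<in> power_torsion R Z M" using Zc by (auto simp: power_torsion_def)
  fix x assume "x \<in> power_torsion R Z M"
  then have x: "x \<in> carrier M" "\<And>z. z \<in> Z \<Longrightarrow> \<exists>t::nat. (z [^] t) \<odot>\<^bsub>M\<^esub> x = \<zero>\<^bsub>M\<^esub>"
    by (auto simp: power_torsion_def)
  show "\<ominus>\<^bsub>M\<^esub> x \<in> power_torsion R Z M"
    unfolding power_torsion_def
  proof (intro CollectI conjI ballI)
    fix z assume z: "z \<in> Z"
    then obtain t :: nat where "(z [^] t) \<odot>\<^bsub>M\<^esub> x = \<zero>\<^bsub>M\<^esub>" using x(2) by blast
    then have "(z [^] t) \<odot>\<^bsub>M\<^esub> (\<ominus>\<^bsub>M\<^esub> x) = \<zero>\<^bsub>M\<^esub>" using x(1) Zc[OF z] by (simp add: smult_r_minus)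
    then show "\<exists>t::nat. (z [^] t) \<odot>\<^bsub>M\<^esub> (\<ominus>\<^bsub>M\<^esub> x) = \<zero>\<^bsub>M\<^esub>" by blast
  qed (use x(1) in simp)
  show "a \<odot>\<^bsub>M\<^esub> x \<in> power_torsion R Z M" if a: "a \<in> carrier R" for a
    unfolding power_torsion_def
  proof (intro CollectI conjI ballI)
    fix z assume z: "z \<in> Z"
    then obtain t :: nat where t: "(z [^] t) \<odot>\<^bsub>M\<^esub> x = \<zero>\<^bsub>M\<^esub>" using x(2) by blast
    have "(z [^] t) \<odot>\<^bsub>M\<^esub> (a \<odot>\<^bsub>M\<^esub> x) = a \<odot>\<^bsub>M\<^esub> ((z [^] t) \<odot>\<^bsub>M\<^esub> x)"
      using x(1) a Zc[OF z] by (simp add: smult_assoc1[symmetric] m_comm)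
    then have "(z [^] t) \<odot>\<^bsub>M\<^esub> (a \<odot>\<^bsub>M\<^esub> x) = \<zero>\<^bsub>M\<^esub>" using t a by simp
    then show "\<exists>t::nat. (z [^] t) \<odot>\<^bsub>M\<^esub> (a \<odot>\<^bsub>M\<^esub> x) = \<zero>\<^bsub>M\<^esub>" by blast
  qed (use x(1) a in simp)
  fix y assume "y \<in> power_torsion R Z M"
  then have y: "y \<in> carrier M" "\<And>z. z \<in> Z \<Longrightarrow> \<exists>t::nat. (z [^] t) \<odot>\<^bsub>M\<^esub> y = \<zero>\<^bsub>M\<^esub>"
    by (auto simp: power_torsion_def)
  show "x \<oplus>\<^bsub>M\<^esub> y \<in> power_torsion R Z M"
    unfolding power_torsion_def
  proof (intro CollectI conjI ballI)
    fix z assume z: "z \<in> Z"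
    obtain t s :: nat where t: "(z [^] t) \<odot>\<^bsub>M\<^esub> x = \<zero>\<^bsub>M\<^esub>" and s: "(z [^] s) \<odot>\<^bsub>M\<^esub> y = \<zero>\<^bsub>M\<^esub>"
      using x(2)[OF z] y(2)[OF z] by blast
    have "(z [^] max t s) \<odot>\<^bsub>M\<^esub> (x \<oplus>\<^bsub>M\<^esub> y) = \<zero>\<^bsub>M\<^esub>"
      using pow_smult_eq_zero_mono[OF Zc[OF z] x(1) t, of "max t s"]
        pow_smult_eq_zero_mono[OF Zc[OF z] y(1) s, of "max t s"] x(1) y(1) Zc[OF z]
      by (simp add: smult_r_distr)
    then show "\<exists>t::nat. (z [^] t) \<odot>\<^bsub>M\<^esub> (x \<oplus>\<^bsub>M\<^esub> y) = \<zero>\<^bsub>M\<^esub>" by blast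
  qed (use x(1) y(1) in simp)
qed

lemma hpart_power_torsion:
  assumes "Z \<subseteq> G 1" "x \<in> power_torsion R Z M"
  shows "hpart M (hcomp M) j x \<in> power_torsion R Z M"
  unfolding power_torsion_def
proof (intro CollectI conjI ballI)
  have x: "x \<in> carrier M" using assms(2) by (simp add: power_torsion_def)
  then show "hpart M (hcomp M) j x \<in> carrier M" by (rule gr.hpart_carrier)
  fix z assume z: "z \<in> Z"
  then obtain t :: nat where t: "(z [^] t) \<odot>\<^bsub>M\<^esub> x = \<zero>\<^bsub>M\<^esub>"
    using assms(2) by (auto simp: power_torsion_def)
  have "z [^] t \<in> G t" using pow_degree z assms(1) by blast
  then have "(z [^] t) \<odot>\<^bsub>M\<^esub> hpart M (hcomp M) j x = hpart M (hcomp M) (int t + j) ((z [^] t) \<odot>\<^bsub>M\<^esub> x)"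
    using hpart_smult[OF _ _ x] Rgr.homog_carrier by simp
  then show "\<exists>t::nat. (z [^] t) \<odot>\<^bsub>M\<^esub> hpart M (hcomp M) j x = \<zero>\<^bsub>M\<^esub>" using t by auto
qed

text \<open>If exponents \<open>e z\<close> killing \<open>x\<close> have sum \<open>N\<close>, then
  the power \<open>N + 1\<close> of the ideal kills \<open>x\<close>: multiplication by a generator
  \<open>z\<close> lowers one exponent, and induction applies to \<open>z x\<close>. Conversely
  \<open>z [^] t\<close> lies in the power \<open>t\<close> of the ideal.\<close>

lemma torsion_eq_power_torsion:
  assumes S: "finite S" "S \<subseteq> G 1" "carrier R = generate_ring R (k \<union> S)"
  shows "torsion R (irrelevant_ideal R G) M = power_torsion R S M"
proof -
  have SR: "S \<subseteq> carrier R" using S(2) Rgr.homog_carrier by blast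
  let ?I = "genideal R S"
  have I: "ideal ?I R" by (rule genideal_ideal[OF SR])
  note P = ideal_ideal_power[OF I]
  have Pc: "r \<in> carrier R" if "r \<in> ideal_power R ?I t" for r t using ideal.Icarr[OF P that] .
  \<comment> \<open>The elements \<open>a\<close> such that \<open>a b\<close> kills
    \<open>x\<close> for all \<open>b\<close> in the power \<open>t\<close> form an ideal. It
    contains \<open>S\<close>, hence the ideal generated by \<open>S\<close>.\<close>
  have step: "r \<odot>\<^bsub>M\<^esub> x = \<zero>\<^bsub>M\<^esub>"
    if x: "x \<in> carrier M" and zx: "\<And>z b. z \<in> S \<Longrightarrow> b \<in> ideal_power R ?I t \<Longrightarrow> b \<odot>\<^bsub>M\<^esub> (z \<odot>\<^bsub>M\<^esub> x) = \<zero>\<^bsub>M\<^esub>"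
      and r: "r \<in> ideal_power R ?I (Suc t)" for x t r
  proof -
    let ?J = "{a \<in> carrier R. \<forall>b\<in>ideal_power R ?I t. (a \<otimes> b) \<odot>\<^bsub>M\<^esub> x = \<zero>\<^bsub>M\<^esub>}"
    have mult: "(c \<otimes> a) \<otimes> b \<odot>\<^bsub>M\<^esub> x = \<zero>\<^bsub>M\<^esub>"
      if "a \<in> ?J" "c \<in> carrier R" "b \<in> ideal_power R ?I t" for a b c
      using that Pc[of b t] x by (simp add: m_assoc smult_assoc1[of c])
    have "ideal ?J R"
    proof (rule idealI)
      show "ring R" by (rule ring_axioms)
      show "subgroup ?J (add_monoid R)"
        using abelian_group.additive_subgroupI'[OF is_abelian_group, of ?J] x Pc
        by (auto simp: additive_subgroup_def l_distr l_minus smult_l_distr smult_l_minus)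
      fix a c assume a: "a \<in> ?J" and c: "c \<in> carrier R"
      show "c \<otimes> a \<in> ?J" using mult[OF a c] a c by simp
      then show "a \<otimes> c \<in> ?J" using a c by (simp add: m_comm)
    qed
    moreover have "S \<subseteq> ?J"
    proof
      fix z assume z: "z \<in> S"
      have "(z \<otimes> b) \<odot>\<^bsub>M\<^esub> x = \<zero>\<^bsub>M\<^esub>" if b: "b \<in> ideal_power R ?I t" for b
        using zx[OF z b] Pc[OF b] z SR x by (simp add: m_comm[of z b] smult_assoc1 subset_iff)
      then show "z \<in> ?J" using z SR by blast
    qed
    ultimately have "?I \<subseteq> ?J" by (rule genideal_minimal)
    then have prod: "(a \<otimes> b) \<odot>\<^bsub>M\<^esub> x = \<zero>\<^bsub>M\<^esub>" if "a \<in> ?I" "b \<in> ideal_power R ?I t" for a b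
      using that by blast
    have "r \<in> carrier R \<and> r \<odot>\<^bsub>M\<^esub> x = \<zero>\<^bsub>M\<^esub>"
      using r unfolding ideal_power.simps
    proof (induction r)
      case (prod a b)
      then show ?case using \<open>\<And>a b. a \<in> ?I \<Longrightarrow> b \<in> ideal_power R ?I t \<Longrightarrow> (a \<otimes> b) \<odot>\<^bsub>M\<^esub> x = \<zero>\<^bsub>M\<^esub>\<close>
          ideal.Icarr[OF I, of a] Pc[of b t] by simp
    next
      case (sum s1 s2)
      then show ?case using x by (simp add: smult_l_distr)
    qed
    then show ?thesis by blast
  qed
  have kill: "\<forall>r\<in>ideal_power R ?I (Suc N). r \<odot>\<^bsub>M\<^esub> x = \<zero>\<^bsub>M\<^esub>"
    if "x \<in> carrier M" "\<And>z. z \<in> S \<Longrightarrow> (z [^] (e z :: nat)) \<odot>\<^bsub>M\<^esub> x = \<zero>\<^bsub>M\<^esub>" "N = (\<Sum>z\<in>S. e z)" for x e N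
    using that
  proof (induction N arbitrary: x e)
    \<comment> \<open>All exponents are zero, so \<open>x\<close> is zero as soon as
      \<open>S\<close> has an element; otherwise the premise of \<open>step\<close> is
      vacuous.\<close>
    case 0
    have "x = \<zero>\<^bsub>M\<^esub>" if "z \<in> S" for z
      using 0(2)[OF that] 0(1,3) S(1) that by simp
    show ?case
    proof
      fix r assume "r \<in> ideal_power R ?I (Suc 0)"
      then show "r \<odot>\<^bsub>M\<^esub> x = \<zero>\<^bsub>M\<^esub>"
      proof (rule step[OF 0(1), rotated])
        fix z b assume "z \<in> S" "b \<in> ideal_power R ?I 0"
        then show "b \<odot>\<^bsub>M\<^esub> (z \<odot>\<^bsub>M\<^esub> x) = \<zero>\<^bsub>M\<^esub>"
          using \<open>\<And>z. z \<in> S \<Longrightarrow> x = \<zero>\<^bsub>M\<^esub>\<close>[of z] SR Pc[of b 0] by auto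
      qed
    qed
  next
    case (Suc N)
    show ?case
    proof
      fix r assume "r \<in> ideal_power R ?I (Suc (Suc N))"
      then show "r \<odot>\<^bsub>M\<^esub> x = \<zero>\<^bsub>M\<^esub>"
      proof (rule step[OF Suc.prems(1), rotated])
        fix z b assume z: "z \<in> S" and b: "b \<in> ideal_power R ?I (Suc N)"
        have zc: "z \<in> carrier R" using z SR by blast
        show "b \<odot>\<^bsub>M\<^esub> (z \<odot>\<^bsub>M\<^esub> x) = \<zero>\<^bsub>M\<^esub>"
        proof (cases "e z")
          case 0
          then have "x = \<zero>\<^bsub>M\<^esub>" using Suc.prems(1) Suc.prems(2)[OF z] by simp
          then show ?thesis using zc Pc[OF b] by simp
        next
          case (Suc m)
          have "\<forall>r\<in>ideal_power R ?I (Suc N). r \<odot>\<^bsub>M\<^esub> (z \<odot>\<^bsub>M\<^esub> x) = \<zero>\<^bsub>M\<^esub>"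
          proof (rule Suc.IH[where e = "e(z := m)"])
            show "z \<odot>\<^bsub>M\<^esub> x \<in> carrier M" using zc Suc.prems(1) by simp
            show "(z' [^] (e(z := m)) z') \<odot>\<^bsub>M\<^esub> (z \<odot>\<^bsub>M\<^esub> x) = \<zero>\<^bsub>M\<^esub>" if z': "z' \<in> S" for z'
            proof (cases "z' = z")
              case True
              then show ?thesis
                using Suc.prems(1) Suc.prems(2)[OF z] zc \<open>e z = Suc m\<close> by (simp add: smult_assoc1[symmetric])
            next
              case False
              have "z' \<in> carrier R" using z' SR by blast
              then have "(z' [^] e z') \<odot>\<^bsub>M\<^esub> (z \<odot>\<^bsub>M\<^esub> x) = z \<odot>\<^bsub>M\<^esub> ((z' [^] e z') \<odot>\<^bsub>M\<^esub> x)"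
                using zc Suc.prems(1) by (simp add: smult_assoc1[symmetric] m_comm)
              then show ?thesis using False Suc.prems(2)[OF z'] zc by simp
            qed
            have "(\<Sum>y\<in>S - {z}. (e(z := m)) y) = (\<Sum>y\<in>S - {z}. e y)"
              by (rule sum.cong) auto
            then show "N = (\<Sum>y\<in>S. (e(z := m)) y)"
              using Suc.prems(3) \<open>e z = Suc m\<close> sum.remove[OF S(1) z, of e] sum.remove[OF S(1) z, of "e(z := m)"]
              by simp
          qed
          then show ?thesis using b by blast
        qed
      qed
    qed
  qed
  show ?thesis
  proof (intro equalityI subsetI)
    fix x assume "x \<in> torsion R (irrelevant_ideal R G) M"
    then obtain t where x: "x \<in> carrier M" "\<And>r. r \<in> ideal_power R ?I t \<Longrightarrow> r \<odot>\<^bsub>M\<^esub> x = \<zero>\<^bsub>M\<^esub>"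
      unfolding torsion_def irrelevant_ideal_eq[OF S(2,3)] by blast
    have "(z [^] t) \<odot>\<^bsub>M\<^esub> x = \<zero>\<^bsub>M\<^esub>" if "z \<in> S" for z
      using x(2)[OF pow_in_ideal_power[OF I]] genideal_self[OF SR] that by blast
    then show "x \<in> power_torsion R S M" using x(1) unfolding power_torsion_def by blast
  next
    fix x assume "x \<in> power_torsion R S M"
    then have x: "x \<in> carrier M" "\<forall>z\<in>S. \<exists>t::nat. (z [^] t) \<odot>\<^bsub>M\<^esub> x = \<zero>\<^bsub>M\<^esub>"
      by (auto simp: power_torsion_def)
    then obtain e :: "'r \<Rightarrow> nat" where "\<And>z. z \<in> S \<Longrightarrow> (z [^] e z) \<odot>\<^bsub>M\<^esub> x = \<zero>\<^bsub>M\<^esub>" by metis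
    from kill[OF x(1) this refl] show "x \<in> torsion R (irrelevant_ideal R G) M"
      unfolding torsion_def irrelevant_ideal_eq[OF S(2,3)] using x(1) by blast
  qed
qed

text \<open>Covers every linear form, in particular the members of \<open>ys\<close>, which need not
  be among the chosen generators.\<close>

lemma torsion_power_torsion:
  assumes "w \<in> G 1" "x \<in> torsion R (irrelevant_ideal R G) M"
  shows "\<exists>t::nat. (w [^] t) \<odot>\<^bsub>M\<^esub> x = \<zero>\<^bsub>M\<^esub>"
proof -
  have GR: "(\<Union>a\<in>{1..}. G a) \<subseteq> carrier R" using Rgr.homog_carrier by blast
  have "w \<in> irrelevant_ideal R G"
    using genideal_self[OF GR] assms(1) unfolding irrelevant_ideal_def by auto
  moreover have "ideal (irrelevant_ideal R G) R"
    unfolding irrelevant_ideal_def by (rule genideal_ideal[OF GR])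
  ultimately show ?thesis
    using pow_in_ideal_power assms(2) unfolding torsion_def by blast
qed

end

section \<open>Torsion subcomplexes of injective complexes\<close>

definition torsion_subcomplex :: "'r ring \<Rightarrow> 'r set \<Rightarrow> ('r, 'm) gcomplex \<Rightarrow> ('r, 'm) gcomplex" where
  "torsion_subcomplex R Z C = C\<lparr>obj := \<lambda>i. sub_gmodule (obj C i) (power_torsion R Z (obj C i))\<rparr>"

lemma torsion_subcomplex_simps [simp]:
  "obj (torsion_subcomplex R Z C) i = sub_gmodule (obj C i) (power_torsion R Z (obj C i))"
  "diff (torsion_subcomplex R Z C) = diff C"
  by (simp_all add: torsion_subcomplex_def)

context graded_cx
begin

text \<open>Start of the induction on the forms, where no torsion has been imposed.\<close>

lemma torsion_subcomplex_empty: "torsion_subcomplex R {} C = C"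
proof -
  have "hcomp (obj C i) j \<inter> carrier (obj C i) = hcomp (obj C i) j" for i j
    using ob.gr.homog_carrier by blast
  then have "sub_gmodule (obj C i) (power_torsion R {} (obj C i)) = obj C i" for i
    by (simp add: power_torsion_def sub_gmodule_def)
  then show ?thesis by (simp add: torsion_subcomplex_def)
qed

lemma gmod_obj: "gmod R k G (obj C i)"
  by (intro gmod.intro standard_graded_algebra_axioms obj_gm)

lemma d_power_torsion:
  assumes Z: "Z \<subseteq> G 1" and x: "x \<in> power_torsion R Z (obj C i)"
  shows "diff C i x \<in> power_torsion R Z (obj C (i - 1))"
  unfolding power_torsion_def
proof (intro CollectI conjI ballI)
  have xc: "x \<in> carrier (obj C i)" using x by (simp add: power_torsion_def)
  then show "diff C i x \<in> carrier (obj C (i - 1))" by (rule d_closed)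
  fix z assume z: "z \<in> Z"
  have zc: "z \<in> carrier R" using z Z G_carrier by blast
  obtain t :: nat where t: "(z [^] t) \<odot>\<^bsub>obj C i\<^esub> x = \<zero>\<^bsub>obj C i\<^esub>"
    using x z by (auto simp: power_torsion_def)
  have "(z [^] t) \<odot>\<^bsub>obj C (i - 1)\<^esub> diff C i x = diff C i ((z [^] t) \<odot>\<^bsub>obj C i\<^esub> x)"
    using zc xc by (simp add: d_smult)
  then have "(z [^] t) \<odot>\<^bsub>obj C (i - 1)\<^esub> diff C i x = \<zero>\<^bsub>obj C (i - 1)\<^esub>" by (simp add: t)
  then show "\<exists>t::nat. (z [^] t) \<odot>\<^bsub>obj C (i - 1)\<^esub> diff C i x = \<zero>\<^bsub>obj C (i - 1)\<^esub>" by blast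
qed

lemma graded_cx_torsion_subcomplex:
  assumes Z: "Z \<subseteq> G 1"
  shows "graded_cx R k G (torsion_subcomplex R Z C)"
proof (intro graded_cx.intro standard_graded_algebra_axioms graded_cx_axioms.intro)
  have sub: "x \<in> carrier (obj C i)" if "x \<in> power_torsion R Z (obj C i)" for x i
    using that by (simp add: power_torsion_def)
  show "graded_complex R G (torsion_subcomplex R Z C)"
    unfolding graded_complex_def torsion_subcomplex_simps
  proof (intro conjI allI ballI)
    fix i
    show "graded_module R G (sub_gmodule (obj C i) (power_torsion R Z (obj C i)))"
      by (rule ob.graded_module_sub_gmodule[OF gmod.submodule_power_torsion[OF gmod_obj Z]
            _ gmod.hpart_power_torsion[OF gmod_obj Z]])
        (use G_carrier in auto)
    show "diff C i \<in> gr_hom R (sub_gmodule (obj C i) (power_torsion R Z (obj C i)))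
        (sub_gmodule (obj C (i - 1)) (power_torsion R Z (obj C (i - 1))))"
    proof (rule gr_homI)
      fix x j assume "x \<in> hcomp (sub_gmodule (obj C i) (power_torsion R Z (obj C i))) j"
      then show "diff C i x \<in> hcomp (sub_gmodule (obj C (i - 1)) (power_torsion R Z (obj C (i - 1)))) j"
        using d_homog[of x i j] d_power_torsion[OF Z, of x i] by simp
    qed (use d_power_torsion[OF Z] sub d_add d_smult in auto)
    fix x assume "x \<in> carrier (sub_gmodule (obj C i) (power_torsion R Z (obj C i)))"
    then show "diff C (i - 1) (diff C i x) =
        \<zero>\<^bsub>sub_gmodule (obj C (i - 2)) (power_torsion R Z (obj C (i - 2)))\<^esub>"
      using sub d_d by simp
  qed
qed

lemma gcx_map_torsion_subcomplex:
  assumes Z: "Z \<subseteq> G 1" and w: "w \<in> G 1"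
  shows "gcx_map R k G (torsion_subcomplex R (insert w Z) C) (torsion_subcomplex R Z C) (\<lambda>i x. x)"
proof (intro gcx_map.intro gcx_map_axioms.intro graded_cx_torsion_subcomplex)
  have "power_torsion R (insert w Z) M \<subseteq> power_torsion R Z M" for M :: "('r, 'm) gmodule"
    by (auto simp: power_torsion_def)
  then show "chain_map R (torsion_subcomplex R (insert w Z) C) (torsion_subcomplex R Z C) (\<lambda>i x. x)"
    by (auto simp: chain_map_def gr_hom_def)
qed (use Z w in auto)

text \<open>By divisibility, \<open>w\<close> acts bijectively on the quotient of the two torsion subcomplexes.\<close>

lemma acyclic_map_torsion_step:
  assumes inj: "\<And>i. gr_injective R G (obj C i)"
    and Z: "Z \<subseteq> G 1" and w: "w \<in> G 1" and xs: "set xs \<subseteq> G 1"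
  shows "acyclic_map (koszul R (xs @ [w]) (torsion_subcomplex R (insert w Z) C))
    (koszul R (xs @ [w]) (torsion_subcomplex R Z C)) (koszul_map (length (xs @ [w])) (\<lambda>i x. x))"
proof (rule gcx_map.acyclic_map_koszul_of_bijective[OF gcx_map_torsion_subcomplex[OF Z w] xs w],
    unfold torsion_subcomplex_simps)
  have wc: "w \<in> carrier R" using G_carrier[OF w] .
  have zc: "z \<in> carrier R" if "z \<in> Z" for z using that Z G_carrier by blast
  show "inj_on (\<lambda>x. x) A" for A :: "'m set" by simp
  fix i j y
  let ?E = "obj C i"
  assume "y \<in> hcomp (sub_gmodule ?E (power_torsion R Z ?E)) j"
  then have y: "y \<in> hcomp ?E j" "y \<in> power_torsion R Z ?E" by auto
  have yc: "y \<in> carrier ?E" using ob.gr.homog_carrier[OF y(1)] .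
  {
    obtain t e where e: "e \<in> hcomp ?E (j - 1)" "w [^] Suc t \<odot>\<^bsub>?E\<^esub> e = w [^] t \<odot>\<^bsub>?E\<^esub> y"
      and ann: "\<And>r. r \<in> carrier R \<Longrightarrow> r \<odot>\<^bsub>?E\<^esub> y = \<zero>\<^bsub>?E\<^esub> \<Longrightarrow> r \<odot>\<^bsub>?E\<^esub> e = \<zero>\<^bsub>?E\<^esub>"
      using injective_divisible[OF inj w y(1)] by blast
    have ec: "e \<in> carrier ?E" using ob.gr.homog_carrier[OF e(1)] .
    \<comment> \<open>Killed by \<open>w [^] t\<close>, hence in the smaller subcomplex; on the
      quotient, \<open>w\<close> therefore sends the class of \<open>e\<close> to that of
      \<open>y\<close>.\<close>
    let ?x = "w \<odot>\<^bsub>?E\<^esub> e \<oplus>\<^bsub>?E\<^esub> \<ominus>\<^bsub>?E\<^esub> y"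
    \<comment> \<open>Every power of \<open>z\<close> that kills \<open>y\<close> kills
      \<open>e\<close>; this is what the annihilator clause of \<open>injective_divisible\<close> is
      for.\<close>
    have e_tors: "e \<in> power_torsion R Z ?E"
      unfolding power_torsion_def
    proof (intro CollectI conjI ballI ec)
      fix z assume z: "z \<in> Z"
      then obtain t :: nat where "(z [^] t) \<odot>\<^bsub>?E\<^esub> y = \<zero>\<^bsub>?E\<^esub>"
        using y(2) by (auto simp: power_torsion_def)
      then show "\<exists>t::nat. (z [^] t) \<odot>\<^bsub>?E\<^esub> e = \<zero>\<^bsub>?E\<^esub>" using ann zc[OF z] by blast
    qed
    note T = ob.submoduleE[OF gmod.submodule_power_torsion[OF gmod_obj Z]]
    have "?x \<in> power_torsion R Z ?E"
      using T(5)[OF T(4)[OF wc e_tors] T(6)[OF y(2)]] .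
    moreover have "(w [^] t) \<odot>\<^bsub>?E\<^esub> ?x = \<zero>\<^bsub>?E\<^esub>"
    proof -
      have "(w [^] t) \<odot>\<^bsub>?E\<^esub> (w \<odot>\<^bsub>?E\<^esub> e) = w [^] Suc t \<odot>\<^bsub>?E\<^esub> e"
        using wc ec by (simp add: ob.smult_assoc1)
      then show ?thesis
        using wc ec yc e(2) by (simp add: ob.smult_r_distr ob.smult_r_minus ob.M.r_neg)
    qed
    ultimately have "?x \<in> power_torsion R (insert w Z) ?E" by (auto simp: power_torsion_def)
    moreover have "?x \<in> hcomp ?E j"
      using ob.gr.homog_add[OF _ ob.gr.homog_neg[OF y(1)]] ob.smult_degree[OF w e(1)] by simp
    moreover have "w \<odot>\<^bsub>?E\<^esub> e = y \<oplus>\<^bsub>?E\<^esub> ?x"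
      using wc ec yc by (simp add: ob.M.a_ac ob.M.r_neg1 ob.M.r_neg2 ob.M.r_neg)
    ultimately show "\<exists>v\<in>hcomp (sub_gmodule ?E (power_torsion R Z ?E)) (j - 1).
        \<exists>x\<in>hcomp (sub_gmodule ?E (power_torsion R (insert w Z) ?E)) j.
          w \<odot>\<^bsub>sub_gmodule ?E (power_torsion R Z ?E)\<^esub> v =
          y \<oplus>\<^bsub>sub_gmodule ?E (power_torsion R Z ?E)\<^esub> x"
      using e(1) e_tors by (intro bexI[of _ e] bexI[of _ ?x]) auto
  }
  assume "w \<odot>\<^bsub>sub_gmodule ?E (power_torsion R Z ?E)\<^esub> y
      \<in> (\<lambda>x. x) ` hcomp (sub_gmodule ?E (power_torsion R (insert w Z) ?E)) (j + 1)"
  then obtain t :: nat where "(w [^] t) \<odot>\<^bsub>?E\<^esub> (w \<odot>\<^bsub>?E\<^esub> y) = \<zero>\<^bsub>?E\<^esub>"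
    by (auto simp: power_torsion_def)
  \<comment> \<open>Injectivity on the quotient: if a power of \<open>w\<close> kills
    \<open>w y\<close>, the next power kills \<open>y\<close>.\<close>
  then have "(w [^] Suc t) \<odot>\<^bsub>?E\<^esub> y = \<zero>\<^bsub>?E\<^esub>" using wc yc by (simp add: ob.smult_assoc1)
  then have "y \<in> power_torsion R (insert w Z) ?E"
    using y(2) unfolding power_torsion_def by blast
  then show "y \<in> (\<lambda>x. x) ` hcomp (sub_gmodule ?E (power_torsion R (insert w Z) ?E)) j"
    using y(1) by simp
qed

text \<open>Each form is adjoined before the subcomplex shrinks. Adjoining keeps
  \<open>exact_above\<close> by \<open>bounded_exact_snoc\<close>; shrinking keeps it because the
  form is then among the Koszul variables. Carrying \<open>bounded_exact\<close> along makes the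
  next adjunction possible.\<close>

lemma exact_above_torsion_subcomplex:
  assumes inj: "\<And>i. gr_injective R G (obj C i)"
    and xs: "set xs \<subseteq> G 1" and bdd: "bounded_exact (koszul R xs C)" and zs: "set zs \<subseteq> G 1"
  shows "bounded_exact (koszul R (xs @ zs) (torsion_subcomplex R (set zs) C)) \<and>
    (\<forall>r. exact_above (koszul R (xs @ zs) (torsion_subcomplex R (set zs) C)) r \<longleftrightarrow>
      exact_above (koszul R xs C) r)"
  using zs
proof (induction zs rule: rev_induct)
  case Nil
  show ?case using bdd by (simp add: torsion_subcomplex_empty)
next
  case (snoc w zs)
  let ?Z = "set zs"
  have Z: "?Z \<subseteq> G 1" "w \<in> G 1" using snoc.prems by auto
  have xz: "set (xs @ zs) \<subseteq> G 1" using xs Z by auto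
  have xzw: "set (xs @ zs @ [w]) \<subseteq> G 1" using xz Z by auto
  let ?T = "torsion_subcomplex R ?Z C" and ?T' = "torsion_subcomplex R (insert w ?Z) C"
  interpret T: graded_cx R k G ?T by (rule graded_cx_torsion_subcomplex[OF Z(1)])
  interpret F: gcx_map R k G ?T' ?T "\<lambda>i x. x" by (rule gcx_map_torsion_subcomplex[OF Z])
  interpret K: gcx_map R k G "koszul R (xs @ zs @ [w]) ?T'" "koszul R (xs @ zs @ [w]) ?T"
    "koszul_map (length (xs @ zs @ [w])) (\<lambda>i x. x)"
    by (intro gcx_map.intro gcx_map_axioms.intro graded_cx.intro graded_cx_axioms.intro
        standard_graded_algebra_axioms F.chain_map_koszul F.C.graded_complex_koszul
        T.graded_complex_koszul xzw)
  have ex: "exact_at (koszul R (xs @ zs @ [w]) ?T') i j \<longleftrightarrow> exact_at (koszul R (xs @ zs @ [w]) ?T) i j" for i j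
    by (rule K.exact_at_iff) (use acyclic_map_torsion_step[OF inj Z xz] in simp)
  note IH = snoc.IH[OF Z(1)]
  note bdd' = T.bounded_exact_snoc[OF xz Z(2) conjunct1[OF IH]]
  show ?case
    using bdd' IH ex by (simp add: bounded_exact_def exact_above_def)
qed

text \<open>A Koszul chain has finitely many coordinates, so one power of \<open>w\<close> kills all
  of it. Hence \<open>exact_above_of_cone\<close> applies with zero as the bounding chain, and no
  bound on degrees is involved.\<close>

lemma exact_above_koszul_of_torsion:
  assumes tors: "\<And>i x w. x \<in> carrier (obj C i) \<Longrightarrow> w \<in> G 1 \<Longrightarrow>
      \<exists>t::nat. (w [^] t) \<odot>\<^bsub>obj C i\<^esub> x = \<zero>\<^bsub>obj C i\<^esub>"
    and "set xs \<subseteq> G 1"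
  shows "exact_above (koszul R xs C) r \<longleftrightarrow> exact_above C r"
  using assms(2)
proof (induction xs rule: rev_induct)
  case Nil
  show ?case by (simp add: exact_above_def exact_koszul_Nil)
next
  case (snoc w xs)
  then have xs: "set xs \<subseteq> G 1" and w: "w \<in> G 1" by auto
  have wc: "w \<in> carrier R" using G_carrier[OF w] .
  interpret K: cone_cx R k G "koszul R xs C" w "koszul R (xs @ [w]) C" "koszul_pair R (length xs) C"
    by (rule koszul_cone[OF graded_complex_koszul[OF xs] xs w])
  have "exact_above (koszul R (xs @ [w]) C) r \<longleftrightarrow> exact_above (koszul R xs C) r"
  proof
    assume "exact_above (koszul R (xs @ [w]) C) r"
    then show "exact_above (koszul R xs C) r"
    proof (rule K.exact_above_of_cone)
      fix i j z assume z: "z \<in> hcomp (obj (koszul R xs C) i) j"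
      let ?P = "Pow {0..<length xs}"
      have zc: "z \<in> carrier (koszul_obj (length xs) C i)"
        using K.ob.gr.homog_carrier[OF z] by (simp del: koszul_obj_simps)
      have "\<forall>S\<in>?P. \<exists>t::nat. (w [^] t) \<odot>\<^bsub>obj C (i - int (card S))\<^esub> z S = \<zero>\<^bsub>obj C (i - int (card S))\<^esub>"
        using tors[OF koszul_memD[OF zc] w] by blast
      then obtain t :: "nat set \<Rightarrow> nat" where
        t: "\<And>S. S \<in> ?P \<Longrightarrow> (w [^] t S) \<odot>\<^bsub>obj C (i - int (card S))\<^esub> z S = \<zero>\<^bsub>obj C (i - int (card S))\<^esub>"
        by metis
      define s where "s = Max (t ` ?P)"
      have "(w [^] s) \<odot>\<^bsub>obj C (i - int (card S))\<^esub> z S = \<zero>\<^bsub>obj C (i - int (card S))\<^esub>" if S: "S \<in> ?P" for S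
        by (rule ob.pow_smult_eq_zero_mono[OF wc koszul_memD[OF zc] t[OF S]])
          (use S in \<open>auto simp: s_def intro!: Max_ge\<close>)
      then have "(w [^] s) \<odot>\<^bsub>koszul_obj (length xs) C i\<^esub> z = \<zero>\<^bsub>koszul_obj (length xs) C i\<^esub>"
        by (auto simp: fun_eq_iff)
      then show "\<exists>t. \<exists>c\<in>hcomp (obj (koszul R xs C) (i + 1)) (j + int t).
          diff (koszul R xs C) (i + 1) c = (w [^] t) \<odot>\<^bsub>obj (koszul R xs C) i\<^esub> z"
        using K.d_zero[of "i + 1"] K.ob.gr.homog_zero[of "i + 1" "j + int s"]
        by (intro exI[of _ s] bexI[of _ "\<zero>\<^bsub>obj (koszul R xs C) (i + 1)\<^esub>"]) (simp_all del: koszul_obj_simps)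
    qed
  qed (rule K.exact_above_cone)
  then show ?case using snoc.IH[OF xs] by simp
qed

end

section \<open>Comparison of the regularities\<close>

theorem theorem4p3:
  fixes R :: "'r ring" and k :: "'r set" and G :: "nat \<Rightarrow> 'r set"
    and M :: "('r, 'm) gcomplex" and ys :: "'r list" and y :: 'r
  assumes "standard_graded_algebra R k G"
    and "set ys \<subseteq> G 1"
    and "in_Dfb R G M"
    and "\<forall>i. finite_length R (homology (koszul R ys M) i)"
    and "y \<in> G 1"
  shows "kreg R ys M = kreg R (ys @ [y]) M \<and>
    (\<forall>(J :: ('r, 'j) gcomplex) \<phi>. injective_resolution R G M J \<phi> \<longrightarrow>
       reg_by_resolution R G J = kreg R ys M)"
proof (intro conjI allI impI)
  interpret standard_graded_algebra R k G by fact
  interpret M: graded_cx R k G M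
    by unfold_locales (use assms(3) in \<open>simp add: in_Dfb_def\<close>)
  interpret KM: graded_cx R k G "koszul R ys M"
    by unfold_locales (rule M.graded_complex_koszul[OF assms(2)])
  \<comment> \<open>From here on finite length enters only through this vanishing in large
    degrees.\<close>
  have bdd: "bounded_exact (koszul R ys M)"
    unfolding bounded_exact_def using KM.exact_of_finite_length assms(4) by blast
  show "kreg R ys M = kreg R (ys @ [y]) M"
    by (rule M.kreg_eqI[OF assms(2) M.graded_cx_axioms])
      (use assms(2,5) M.bounded_exact_snoc(2)[OF assms(2,5) bdd] in auto)
  fix J :: "('r, 'j) gcomplex" and \<phi>
  assume res: "injective_resolution R G M J \<phi>"
  interpret J: graded_cx R k G J
    by unfold_locales (use res in \<open>simp add: injective_resolution_def\<close>)
  have inj: "gr_injective R G (obj J i)" for i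
    using res by (simp add: injective_resolution_def)
  have q: "quasi_iso R M J \<phi>" using res by (simp add: injective_resolution_def)
  interpret F: gcx_map R k G M J \<phi>
    by unfold_locales (use q in \<open>simp add: quasi_iso_def\<close>)
  interpret K: gcx_map R k G "koszul R ys M" "koszul R ys J" "koszul_map (length ys) \<phi>"
    by (intro gcx_map.intro gcx_map_axioms.intro graded_cx.intro graded_cx_axioms.intro
        standard_graded_algebra_axioms F.chain_map_koszul[OF assms(2)]
        M.graded_complex_koszul[OF assms(2)] J.graded_complex_koszul[OF assms(2)])
  have ex: "exact_at (koszul R ys M) i j \<longleftrightarrow> exact_at (koszul R ys J) i j" for i j
    by (rule K.exact_at_iff[OF F.acyclic_map_koszul[OF F.acyclic_map_of_quasi_iso[OF q] assms(2)]])
  have bddJ: "bounded_exact (koszul R ys J)"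
    using bdd by (simp add: bounded_exact_def ex)
  obtain S where S: "finite S" "S \<subseteq> G 1" "carrier R = generate_ring R (k \<union> S)"
    using generated by blast
  obtain zs where zs: "set zs = S" using finite_list[OF S(1)] by blast
  let ?T = "torsion_subcomplex R S J"
  interpret T: graded_cx R k G ?T by (rule J.graded_cx_torsion_subcomplex[OF S(2)])
  have tors: "torsion R (irrelevant_ideal R G) (obj J i) = power_torsion R S (obj J i)" for i
    by (rule gmod.torsion_eq_power_torsion[OF J.gmod_obj S])
  have T: "torsion_complex R (irrelevant_ideal R G) J = ?T"
    unfolding torsion_complex_def torsion_subcomplex_def tors ..
  \<comment> \<open>From the Koszul complex of \<open>?T\<close> on \<open>ys @ zs\<close> there are
    two ways down: dropping all variables leads to \<open>?T\<close>, and undoing the alternation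
    leads to the Koszul complex of \<open>J\<close> on \<open>ys\<close>, which \<open>ex\<close>
    compares with that of \<open>M\<close>.\<close>
  have above: "exact_above ?T r \<longleftrightarrow> exact_above (koszul R ys M) r" for r
  proof -
    have "exact_above (koszul R (ys @ zs) ?T) r \<longleftrightarrow> exact_above ?T r"
    proof (rule T.exact_above_koszul_of_torsion)
      fix i x w assume "x \<in> carrier (obj ?T i)" "w \<in> G 1"
      then show "\<exists>t::nat. (w [^]\<^bsub>R\<^esub> t) \<odot>\<^bsub>obj ?T i\<^esub> x = \<zero>\<^bsub>obj ?T i\<^esub>"
        using gmod.torsion_power_torsion[OF J.gmod_obj, of w x i] tors by simp
    qed (use assms(2) S(2) zs in auto)
    moreover have "exact_above (koszul R (ys @ zs) ?T) r \<longleftrightarrow> exact_above (koszul R ys J) r"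
      using J.exact_above_torsion_subcomplex[OF inj assms(2) bddJ, of zs] S(2) unfolding zs by blast
    ultimately show ?thesis by (simp add: exact_above_def ex)
  qed
  \<comment> \<open>Replacing \<open>i\<close> by \<open>- i\<close> turns cohomological into
    homological indexing.\<close>
  have reg: "reg_by_resolution R G J = Sup {ereal (of_int (j - i)) | i j. homology_nonzero ?T i j}"
  proof -
    have "{ereal (of_int (i + j)) | i j. homology_nonzero ?T (- i) j} =
        {ereal (of_int (j - i)) | i j. homology_nonzero ?T i j}"
    proof (intro equalityI subsetI)
      fix a assume "a \<in> {ereal (of_int (i + j)) | i j. homology_nonzero ?T (- i) j}"
      then obtain i j where "a = ereal (of_int (j - (- i)))" "homology_nonzero ?T (- i) j"
        by (auto simp: add.commute)
      then show "a \<in> {ereal (of_int (j - i)) | i j. homology_nonzero ?T i j}" by blast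
    next
      fix a assume "a \<in> {ereal (of_int (j - i)) | i j. homology_nonzero ?T i j}"
      then obtain i j where "a = ereal (of_int (- i + j))" "homology_nonzero ?T (- (- i)) j"
        by auto
      then show "a \<in> {ereal (of_int (i + j)) | i j. homology_nonzero ?T (- i) j}" by blast
    qed
    then show ?thesis unfolding reg_by_resolution_def T by simp
  qed
  show "reg_by_resolution R G J = kreg R ys M"
    unfolding reg kreg_def
    by (rule Sup_eq_of_bounds)
      (use above in \<open>simp add: exact_above_def T.homology_nonzero_iff KM.homology_nonzero_iff\<close>)
qed

end
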